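(* Let $T_1,T_2$ be disjoint locally compact Hausdorff spaces, $T=T_1\cup T_2$ their (topological) disjoint union, $\mu$ a bounded Radon measure on $T$, and $\mathfrak{A},\mathfrak{B}$ unital $C^*$-algebras of Hilbert space operators. Let $f$ be an operator convex function on an interval $J$, $(A_t)_{t\in T}$ a continuous field of self-adjoint operators in $\mathfrak{A}$ with spectra contained in $J$, and $(\Phi_t)_{t\in T}:\mathfrak{A}\to\mathfrak{B}$ a unital field of positive linear maps. Put $D_{T_1}=\int_{T_1}\Phi_t(I)\,d\mu(t)$ and $D_{T_2}=\int_{T_2}\Phi_t(I)\,d\mu(t)$. Assume that $D_{T_1}$, $D_{T_2}$ and each $\Phi_t(I)$ are invertible, and that the integrals below exist as Bochner integrals. Then: (i) $$\begin{aligned} f\left(\int_T\Phi_t(A_t)\,d\mu(t)\right)&\leq D_{T_1}^{1/2} f\left(D_{T_1}^{-1/2}\int_{T_1}\Phi_t(A_t)\,d\mu(t)\,D_{T_1}^{-1/2}\right) D_{T_1}^{1/2}+ D_{T_2}^{1/2} f\left(D_{T_2}^{-1/2}\int_{T_2}\Phi_t(A_t)\,d\mu(t)\,D_{T_2}^{-1/2}\right)D_{T_2}^{1/2}\\ &\leq\int_T\Phi_t(I)^{1/2}f\left(\Phi_t(I)^{-1/2}\Phi_t(A_t)\Phi_t(I)^{-1/2}\right)\Phi_t(I)^{1/2}\,d\mu(t)\\ &\leq \int_T\Phi_t(f(A_t))\,d\mu(t).\end{aligned}$$ (ii) $$\begin{aligned}\int_T\Phi_t(f(A_t))\,d\mu(t)-f\left(\int_T\Phi_t(A_t)\,d\mu(t)\right)&\geq\int_{T_1}\Phi_t(f(A_t))\,d\mu(t)-D_{T_1}^{1/2}f\left(D_{T_1}^{-1/2}\int_{T_1}\Phi_t(A_t)\,d\mu(t)\,D_{T_1}^{-1/2}\right)D_{T_1}^{1/2}\\&\geq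 0.\end{aligned}$$
   Context: A bounded operator is positive if $\langle Ax,x\rangle\ge 0$ for all $x$; $X\le Y$ means $Y-X$ is positive. A linear map is positive if it maps positive operators to positive operators. A continuous $f:J\to\mathbb{R}$ is operator convex if $f(\lambda X+(1-\lambda)Y)\le\lambda f(X)+(1-\lambda)f(Y)$ for all self-adjoint operators $X,Y$ (on any Hilbert space) with spectra in $J$ and all $\lambda\in[0,1]$. A unital $C^*$-algebra of operators contains the identity operator $I$. A field $(A_t)_{t\in T}$ in $\mathfrak{A}$ is continuous if $t\mapsto A_t$ is norm continuous. A field $(\Phi_t)_{t\in T}$ of positive linear maps $\mathfrak{A}\to\mathfrak{B}$ is assumed continuous, i.e. $t\mapsto\Phi_t(X)$ is norm continuous for every $X\in\mathfrak{A}$; it is unital if $t\mapsto\Phi_t(I)$ is integrable with $\int_T\Phi_t(I)\,d\mu(t)=I$. *)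

theory Defs
  imports "HOL-Analysis.Analysis"
begin

section \<open>Complex Hilbert spaces and their bounded operators\<close>

text \<open>The inner product is linear in the first argument. The norm axiom makes it positive definite,
  and the superclass \<^class>\<open>banach\<close> supplies completeness.\<close>

class chilbert = banach +
  fixes scaleC :: "complex \<Rightarrow> 'a \<Rightarrow> 'a" (infixr \<open>*\<^sub>C\<close> 75)
    and cinner :: "'a \<Rightarrow> 'a \<Rightarrow> complex"
  assumes scaleC_of_real: "of_real r *\<^sub>C x = r *\<^sub>R x"
    and scaleC_add_right: "c *\<^sub>C (x + y) = c *\<^sub>C x + c *\<^sub>C y"
    and scaleC_add_left: "(c + d) *\<^sub>C x = c *\<^sub>C x + d *\<^sub>C x"
    and scaleC_scaleC: "c *\<^sub>C d *\<^sub>C x = (c * d) *\<^sub>C x"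
    and cinner_commute: "cinner x y = cnj (cinner y x)"
    and cinner_add_left: "cinner (x + y) z = cinner x z + cinner y z"
    and cinner_scaleC_left: "cinner (c *\<^sub>C x) y = c * cinner x y"
    and cinner_same: "cinner x x = of_real ((norm x)\<^sup>2)"

lemma norm_scaleC: "norm (c *\<^sub>C x) = cmod c * norm (x :: 'h::chilbert)"
proof -
  have "cinner (c *\<^sub>C x) (c *\<^sub>C x) = (c * cnj c) * cinner x x"
    by (metis cinner_commute cinner_scaleC_left complex_cnj_mult mult.assoc)
  also have "\<dots> = of_real ((cmod c * norm x)\<^sup>2)"
    by (simp add: cinner_same complex_norm_square[symmetric] power_mult_distrib)
  finally have "(norm (c *\<^sub>C x))\<^sup>2 = (cmod c * norm x)\<^sup>2"
    by (metis cinner_same of_real_eq_iff)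
  then show ?thesis by simp
qed

lemma bounded_linear_scaleC: "bounded_linear (\<lambda>x :: 'h::chilbert. c *\<^sub>C x)"
proof (rule bounded_linear_intro[of _ "cmod c"])
  show "c *\<^sub>C (r *\<^sub>R x) = r *\<^sub>R (c *\<^sub>C x)" for r and x :: 'h
    by (metis mult.commute scaleC_of_real scaleC_scaleC)
qed (auto simp: scaleC_add_right norm_scaleC mult.commute)

text \<open>The type \<open>'h \<Rightarrow>\<^sub>L 'h\<close> contains all bounded real-linear maps; the bounded operators
  in the sense of complex Hilbert spaces are those in \<open>{X. clinear_op X}\<close>. The
  norm of \<open>'h \<Rightarrow>\<^sub>L 'h\<close> is the operator norm.\<close>

definition clinear_op :: "('h::chilbert \<Rightarrow>\<^sub>L 'h) \<Rightarrow> bool" where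
  "clinear_op X \<longleftrightarrow> (\<forall>c x. X (c *\<^sub>C x) = c *\<^sub>C X x)"

definition op_scaleC :: "complex \<Rightarrow> ('h::chilbert \<Rightarrow>\<^sub>L 'h) \<Rightarrow> ('h \<Rightarrow>\<^sub>L 'h)" where
  "op_scaleC c X = Blinfun (\<lambda>x. c *\<^sub>C X x)"

lemma op_scaleC_apply: "op_scaleC c X x = c *\<^sub>C X x"
  unfolding op_scaleC_def
  by (subst bounded_linear_Blinfun_apply)
     (auto intro: bounded_linear_compose[OF bounded_linear_scaleC blinfun.bounded_linear_right])

definition is_adjoint :: "('h::chilbert \<Rightarrow>\<^sub>L 'h) \<Rightarrow> ('h \<Rightarrow>\<^sub>L 'h) \<Rightarrow> bool" where
  "is_adjoint X Y \<longleftrightarrow> (\<forall>x y. cinner (X x) y = cinner x (Y y))"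

definition selfadjoint :: "('h::chilbert \<Rightarrow>\<^sub>L 'h) \<Rightarrow> bool" where
  "selfadjoint X \<longleftrightarrow> clinear_op X \<and> is_adjoint X X"

definition positive_op :: "('h::chilbert \<Rightarrow>\<^sub>L 'h) \<Rightarrow> bool" where
  "positive_op X \<longleftrightarrow> clinear_op X \<and> (\<forall>x. cinner (X x) x \<in> \<real>\<^sub>\<ge>\<^sub>0)"

definition op_le :: "('h::chilbert \<Rightarrow>\<^sub>L 'h) \<Rightarrow> ('h \<Rightarrow>\<^sub>L 'h) \<Rightarrow> bool" (infix \<open>\<preceq>\<close> 50) where
  "X \<preceq> Y \<longleftrightarrow> positive_op (Y - X)"


section \<open>Spectrum and continuous functional calculus\<close>

text \<open>Operator convexity quantifies over Hilbert spaces. These are encoded as the closed complex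
  subspaces \<open>S\<close> of an ambient space \<open>'h\<close>, each given by its orthogonal projection \<open>e\<close>: the algebra
  of bounded operators on \<open>S = range e\<close> is \<open>ops_on e\<close>, whose identity operator is \<open>e\<close>.
  The notions below are therefore relative to \<open>e\<close>; for \<open>e = id_blinfun\<close> they
  are the usual ones for operators on \<open>'h\<close>.\<close>

definition projection :: "('h::chilbert \<Rightarrow>\<^sub>L 'h) \<Rightarrow> bool" where
  "projection e \<longleftrightarrow> selfadjoint e \<and> e o\<^sub>L e = e"

definition ops_on :: "('h::chilbert \<Rightarrow>\<^sub>L 'h) \<Rightarrow> ('h \<Rightarrow>\<^sub>L 'h) set" where
  "ops_on e = {X. clinear_op X \<and> e o\<^sub>L X o\<^sub>L e = X}"

definition invertible_on :: "('h::chilbert \<Rightarrow>\<^sub>L 'h) \<Rightarrow> ('h \<Rightarrow>\<^sub>L 'h) \<Rightarrow> bool" where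
  "invertible_on e X \<longleftrightarrow> (\<exists>Y\<in>ops_on e. X o\<^sub>L Y = e \<and> Y o\<^sub>L X = e)"

definition spectrum_on :: "('h::chilbert \<Rightarrow>\<^sub>L 'h) \<Rightarrow> ('h \<Rightarrow>\<^sub>L 'h) \<Rightarrow> complex set" where
  "spectrum_on e X = {z. \<not> invertible_on e (X - op_scaleC z e)}"

primrec op_power :: "('h::chilbert \<Rightarrow>\<^sub>L 'h) \<Rightarrow> ('h \<Rightarrow>\<^sub>L 'h) \<Rightarrow> nat \<Rightarrow> ('h \<Rightarrow>\<^sub>L 'h)" where
  "op_power e X 0 = e"
| "op_power e X (Suc n) = X o\<^sub>L op_power e X n"

definition op_poly :: "('h::chilbert \<Rightarrow>\<^sub>L 'h) \<Rightarrow> real poly \<Rightarrow> ('h \<Rightarrow>\<^sub>L 'h) \<Rightarrow> ('h \<Rightarrow>\<^sub>L 'h)" where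
  "op_poly e p X = (\<Sum>i\<le>degree p. coeff p i *\<^sub>R op_power e X i)"

text \<open>For self-adjoint \<open>X\<close> and \<open>f\<close> continuous on the (compact, real) spectrum, \<open>f(X)\<close> is
  the norm limit of \<open>p\<^sub>n(X)\<close> for polynomials \<open>p\<^sub>n\<close> that converge to \<open>f\<close> uniformly on the spectrum.
  Such \<open>p\<^sub>n\<close> exist by Weierstrass, and the limit does not depend on their choice.\<close>

definition cfc_on :: "('h::chilbert \<Rightarrow>\<^sub>L 'h) \<Rightarrow> (real \<Rightarrow> real) \<Rightarrow> ('h \<Rightarrow>\<^sub>L 'h) \<Rightarrow> ('h \<Rightarrow>\<^sub>L 'h)" where
  "cfc_on e f X = (THE Y. \<exists>p :: nat \<Rightarrow> real poly.
     uniform_limit {r. of_real r \<in> spectrum_on e X} (\<lambda>n. poly (p n)) f sequentially \<and>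
     (\<lambda>n. op_poly e (p n) X) \<longlonglongrightarrow> Y)"

definition spectrum_in :: "('h::chilbert \<Rightarrow>\<^sub>L 'h) \<Rightarrow> ('h \<Rightarrow>\<^sub>L 'h) \<Rightarrow> real set \<Rightarrow> bool" where
  "spectrum_in e X J \<longleftrightarrow> spectrum_on e X \<subseteq> of_real ` J"

abbreviation invertible_op :: "('h::chilbert \<Rightarrow>\<^sub>L 'h) \<Rightarrow> bool" where
  "invertible_op \<equiv> invertible_on id_blinfun"

abbreviation cfc :: "(real \<Rightarrow> real) \<Rightarrow> ('h::chilbert \<Rightarrow>\<^sub>L 'h) \<Rightarrow> ('h \<Rightarrow>\<^sub>L 'h)" where
  "cfc \<equiv> cfc_on id_blinfun"

text \<open>Real powers of a positive operator; used for exponent \<open>1/2\<close>, and for exponent \<open>-1/2\<close> when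
  the operator is also invertible (its spectrum then avoids the bad point \<open>0\<close>).\<close>

definition op_powr :: "('h::chilbert \<Rightarrow>\<^sub>L 'h) \<Rightarrow> real \<Rightarrow> ('h \<Rightarrow>\<^sub>L 'h)" where
  "op_powr D s = cfc (\<lambda>x. x powr s) D"

definition op_perspective ::
    "(real \<Rightarrow> real) \<Rightarrow> ('h::chilbert \<Rightarrow>\<^sub>L 'h) \<Rightarrow> ('h \<Rightarrow>\<^sub>L 'h) \<Rightarrow> ('h \<Rightarrow>\<^sub>L 'h)" where
  "op_perspective f D Z =
     op_powr D (1/2) o\<^sub>L cfc f (op_powr D (-1/2) o\<^sub>L Z o\<^sub>L op_powr D (-1/2)) o\<^sub>L op_powr D (1/2)"


section \<open>Operator convex functions\<close>

text \<open>HOL cannot quantify over all Hilbert spaces inside a formula. The definition takes an ambient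
  space \<open>'u\<close> as a parameter and quantifies over all its closed subspaces. Up to
  isomorphism these are all Hilbert spaces of dimension at most that of \<open>'u\<close>.\<close>

definition operator_convex_on :: "'u::chilbert itself \<Rightarrow> real set \<Rightarrow> (real \<Rightarrow> real) \<Rightarrow> bool" where
  "operator_convex_on _ J f \<longleftrightarrow> continuous_on J f \<and>
    (\<forall>(e :: 'u \<Rightarrow>\<^sub>L 'u) X Y. \<forall>l\<in>{0..1}.
       projection e \<and> X \<in> ops_on e \<and> Y \<in> ops_on e \<and>
       selfadjoint X \<and> selfadjoint Y \<and> spectrum_in e X J \<and> spectrum_in e Y J \<longrightarrow>
       cfc_on e f (l *\<^sub>R X + (1 - l) *\<^sub>R Y) \<preceq> l *\<^sub>R cfc_on e f X + (1 - l) *\<^sub>R cfc_on e f Y)"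

definition infinite_dimensional :: "'u::chilbert itself \<Rightarrow> bool" where
  "infinite_dimensional _ \<longleftrightarrow>
     (\<exists>b :: nat \<Rightarrow> 'u. \<forall>m n. cinner (b m) (b n) = (if m = n then 1 else 0))"


section \<open>\<open>C\<^sup>*\<close>-algebras of operators and positive linear maps\<close>

definition unital_cstar_algebra :: "('h::chilbert \<Rightarrow>\<^sub>L 'h) set \<Rightarrow> bool" where
  "unital_cstar_algebra \<AA> \<longleftrightarrow>
     (\<forall>X\<in>\<AA>. clinear_op X) \<and> id_blinfun \<in> \<AA> \<and>
     (\<forall>X\<in>\<AA>. \<forall>Y\<in>\<AA>. X + Y \<in> \<AA> \<and> X o\<^sub>L Y \<in> \<AA>) \<and>
     (\<forall>c. \<forall>X\<in>\<AA>. op_scaleC c X \<in> \<AA>) \<and>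
     (\<forall>X\<in>\<AA>. \<exists>Y\<in>\<AA>. is_adjoint X Y) \<and>
     closed \<AA>"

definition positive_linear_map :: "('h::chilbert \<Rightarrow>\<^sub>L 'h) set \<Rightarrow> ('k::chilbert \<Rightarrow>\<^sub>L 'k) set \<Rightarrow>
    (('h \<Rightarrow>\<^sub>L 'h) \<Rightarrow> ('k \<Rightarrow>\<^sub>L 'k)) \<Rightarrow> bool" where
  "positive_linear_map \<AA> \<BB> \<phi> \<longleftrightarrow>
     (\<forall>X\<in>\<AA>. \<phi> X \<in> \<BB>) \<and>
     (\<forall>X\<in>\<AA>. \<forall>Y\<in>\<AA>. \<phi> (X + Y) = \<phi> X + \<phi> Y) \<and>
     (\<forall>c. \<forall>X\<in>\<AA>. \<phi> (op_scaleC c X) = op_scaleC c (\<phi> X)) \<and>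
     (\<forall>X\<in>\<AA>. positive_op X \<longrightarrow> positive_op (\<phi> X))"


section \<open>Topological sums, Radon measures and Bochner integrals\<close>

text \<open>The sum of two spaces with disjoint point sets, on the union of these sets.\<close>

definition disjoint_union_topology :: "'t topology \<Rightarrow> 't topology \<Rightarrow> 't topology" where
  "disjoint_union_topology X Y = topology (\<lambda>U. U \<subseteq> topspace X \<union> topspace Y \<and>
     openin X (U \<inter> topspace X) \<and> openin Y (U \<inter> topspace Y))"

lemma openin_disjoint_union_topology:
  "openin (disjoint_union_topology X Y) U \<longleftrightarrow> U \<subseteq> topspace X \<union> topspace Y \<and>
     openin X (U \<inter> topspace X) \<and> openin Y (U \<inter> topspace Y)"
proof -
  have int: "openin Z (S \<inter> U \<inter> topspace Z)"
    if "openin Z (S \<inter> topspace Z)" "openin Z (U \<inter> topspace Z)" for Z :: "'a topology" and S U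
    using openin_Int[OF that] by (simp add: Int_ac)
  have un: "openin Z (\<Union>\<K> \<inter> topspace Z)"
    if "\<forall>K\<in>\<K>. openin Z (K \<inter> topspace Z)" for Z :: "'a topology" and \<K>
    unfolding Int_Union2 using that by (intro openin_Union) blast
  have "istopology (\<lambda>U. U \<subseteq> topspace X \<union> topspace Y \<and>
     openin X (U \<inter> topspace X) \<and> openin Y (U \<inter> topspace Y))"
    unfolding istopology_def
  proof (intro conjI allI impI; (elim conjE)?)
    fix S U
    assume "S \<subseteq> topspace X \<union> topspace Y"
    then show "S \<inter> U \<subseteq> topspace X \<union> topspace Y" by (rule le_infI1)
  qed (use int un in \<open>simp_all add: Sup_le_iff\<close>)
  then show ?thesis
    by (simp add: disjoint_union_topology_def)
qed

lemma topspace_disjoint_union_topology [simp]: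
  "topspace (disjoint_union_topology X Y) = topspace X \<union> topspace Y"
proof (rule antisym)
  show "topspace (disjoint_union_topology X Y) \<subseteq> topspace X \<union> topspace Y"
    using openin_topspace[of "disjoint_union_topology X Y"]
    by (simp only: openin_disjoint_union_topology)
  have "openin (disjoint_union_topology X Y) (topspace X \<union> topspace Y)"
    by (simp add: openin_disjoint_union_topology Int_absorb1 Int_absorb2)
  then show "topspace X \<union> topspace Y \<subseteq> topspace (disjoint_union_topology X Y)"
    by (rule openin_subset)
qed

text \<open>A finite Borel measure that is inner regular with respect to compact sets.
  Finiteness makes outer regularity on Borel sets automatic.\<close>

definition bounded_radon_measure :: "'t topology \<Rightarrow> 't measure \<Rightarrow> bool" where
  "bounded_radon_measure X M \<longleftrightarrow>
     space M = topspace X \<and> sets M = sigma_sets (topspace X) {U. openin X U} \<and>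
     finite_measure M \<and>
     (\<forall>B\<in>sets M. emeasure M B = (SUP K\<in>{K. compactin X K \<and> K \<subseteq> B}. emeasure M K))"

text \<open>The library's Bochner integral is restricted to second countable target spaces, which excludes
  the bounded operators on an infinite dimensional space. The following repeats the definition of
  \<^const>\<open>has_bochner_integral\<close> for an arbitrary Banach space.\<close>

definition has_integral_bochner :: "'t measure \<Rightarrow> ('t \<Rightarrow> 'b::banach) \<Rightarrow> 'b \<Rightarrow> bool" where
  "has_integral_bochner M g x \<longleftrightarrow> g \<in> borel_measurable M \<and>
     (\<exists>s. (\<forall>i. Bochner_Integration.simple_bochner_integrable M (s i)) \<and>
          (\<lambda>i. \<integral>\<^sup>+t. ennreal (norm (g t - s i t)) \<partial>M) \<longlonglongrightarrow> 0 \<and>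
          (\<lambda>i. Bochner_Integration.simple_bochner_integral M (s i)) \<longlonglongrightarrow> x)"

definition bochner_integrable :: "'t measure \<Rightarrow> ('t \<Rightarrow> 'b::banach) \<Rightarrow> bool" where
  "bochner_integrable M g \<longleftrightarrow> (\<exists>x. has_integral_bochner M g x)"

definition bochner_int :: "'t measure \<Rightarrow> 't set \<Rightarrow> ('t \<Rightarrow> 'b::banach) \<Rightarrow> 'b" where
  "bochner_int M S g = (THE x. has_integral_bochner M (\<lambda>t. indicat_real S t *\<^sub>R g t) x)"


section \<open>Fields of operators and of maps\<close>

definition continuous_field ::
    "'t topology \<Rightarrow> ('h::chilbert \<Rightarrow>\<^sub>L 'h) set \<Rightarrow> ('t \<Rightarrow> 'h \<Rightarrow>\<^sub>L 'h) \<Rightarrow> bool" where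
  "continuous_field T \<AA> A \<longleftrightarrow> (\<forall>t\<in>topspace T. A t \<in> \<AA>) \<and> continuous_map T euclidean A"

definition positive_map_field ::
    "'t topology \<Rightarrow> ('h::chilbert \<Rightarrow>\<^sub>L 'h) set \<Rightarrow> ('k::chilbert \<Rightarrow>\<^sub>L 'k) set \<Rightarrow>
     ('t \<Rightarrow> ('h \<Rightarrow>\<^sub>L 'h) \<Rightarrow> ('k \<Rightarrow>\<^sub>L 'k)) \<Rightarrow> bool" where
  "positive_map_field T \<AA> \<BB> \<Phi> \<longleftrightarrow>
     (\<forall>t\<in>topspace T. positive_linear_map \<AA> \<BB> (\<Phi> t)) \<and>
     (\<forall>X\<in>\<AA>. continuous_map T euclidean (\<lambda>t. \<Phi> t X))"

definition unital_field ::
    "'t measure \<Rightarrow> ('t \<Rightarrow> ('h::chilbert \<Rightarrow>\<^sub>L 'h) \<Rightarrow> ('k::chilbert \<Rightarrow>\<^sub>L 'k)) \<Rightarrow> bool" where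
  "unital_field M \<Phi> \<longleftrightarrow> has_integral_bochner M (\<lambda>t. \<Phi> t id_blinfun) id_blinfun"

end

theory Submission
  imports Defs "HOL-Computational_Algebra.Fundamental_Theorem_Algebra"
begin

text \<open>Let \<open>Y = \<Sum> x\<^sub>i P\<^sub>i\<close> with \<open>x\<^sub>i \<in> J\<close> and positive \<open>P\<^sub>i\<close> that sum to \<open>I\<close>. Up to an error \<open>\<epsilon>\<close> the function \<open>f\<close>
  is a polynomial, so \<open>\<langle>f(Y) \<xi>, \<xi>\<rangle>\<close> depends only on finitely many vectors \<open>Y\<^sup>k \<xi>\<close>, and a Naimark dilation of
  them fits into any infinite dimensional universe. There operator convexity, applied to an operator and its conjugate by a
  reflection, gives \<open>f(\<Sum> x\<^sub>i P\<^sub>i) \<le> \<Sum> f(x\<^sub>i) P\<^sub>i\<close>. Bernstein polynomials turn this into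
  \<open>f(L(x)) \<le> L(f)\<close> for every unital positive linear map \<open>L\<close> on the continuous functions of an interval
  \<open>[a, b] \<subseteq> J\<close>.

  The triples \<open>(L(1), L(x), L(f))\<close> of positive linear maps \<open>L\<close> form a convex cone. It contains
  \<open>(\<Phi>\<^sub>t(I), \<Phi>\<^sub>t(A\<^sub>t), \<Phi>\<^sub>t(f(A\<^sub>t)))\<close> and all \<open>(D, Z, D\<^sup>1\<^sup>/\<^sup>2 f(D\<^sup>-\<^sup>1\<^sup>/\<^sup>2 Z D\<^sup>-\<^sup>1\<^sup>/\<^sup>2) D\<^sup>1\<^sup>/\<^sup>2)\<close>. Sums stay in the cone, and
  Bochner integrals stay in its closure because the distance to a convex cone is sublinear. For a triple
  \<open>(D, Z, G)\<close> in the closure, conjugation by \<open>D\<^sup>-\<^sup>1\<^sup>/\<^sup>2\<close> reduces \<open>D\<^sup>1\<^sup>/\<^sup>2 f(D\<^sup>-\<^sup>1\<^sup>/\<^sup>2 Z D\<^sup>-\<^sup>1\<^sup>/\<^sup>2) D\<^sup>1\<^sup>/\<^sup>2 \<le> G\<close> to the case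
  \<open>D = I\<close>. Every inequality of the theorem is of this form.\<close>

section \<open>Inner products and self-adjoint operators\<close>

text \<open>Three obstacles shape the argument. Convexity of \<open>f\<close> is known only on
  subspaces of \<open>'u\<close>, while \<open>'k\<close> may be larger and then embeds in no such
  subspace; this is why a vector \<xi> is fixed, \<open>f\<close> is traded for a polynomial, and
  only the finitely many inner products that enter its form are carried over to \<open>'u\<close>.
  Next, \<open>J\<close> may be unbounded, open or half open, and the bounds of \<open>A t\<close>
  vary with \<open>t\<close>, so no compact interval need serve the whole field: each triple of the
  cone brings its own \<open>a\<close>, \<open>b\<close> in \<open>J\<close>. That an integrated
  triple still satisfies a D \<le> Z \<le> b D with \<open>a\<close>, \<open>b\<close> in
  \<open>J\<close> itself, and not merely in its closure, takes a separate measure argument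
  (\<open>sigma_bound\<close>); without it \<open>f\<close> of the normalised integral could not be
  evaluated. Finally, \<open>f(X)\<close> is not additive in \<open>X\<close>, so it cannot be
  integrated directly. A triple records only data that are linear in L; sums and integrals are taken
  there, and the nonlinear expression is compared with the third entry once, after normalising D to
  the identity.\<close>

lemma cinner_add_right: "cinner x (y + z) = cinner x y + cinner (x :: 'h::chilbert) z"
  by (metis cinner_add_left cinner_commute complex_cnj_add)

lemma cinner_scaleC_right: "cinner x (c *\<^sub>C y) = cnj c * cinner (x :: 'h::chilbert) y"
  by (metis cinner_commute cinner_scaleC_left complex_cnj_mult)

lemma cinner_scaleR_left: "cinner (r *\<^sub>R x) y = of_real r * cinner (x :: 'h::chilbert) y"
  by (metis cinner_scaleC_left scaleC_of_real)

lemma cinner_scaleR_right: "cinner x (r *\<^sub>R y) = of_real r * cinner (x :: 'h::chilbert) y"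
  by (metis cinner_scaleC_right scaleC_of_real complex_cnj_complex_of_real)

lemma cinner_zero_left [simp]: "cinner 0 (y :: 'h::chilbert) = 0"
  using cinner_scaleR_left[of 0 0 y] by simp

lemma cinner_zero_right [simp]: "cinner (y :: 'h::chilbert) 0 = 0"
  using cinner_scaleR_right[of y 0 0] by simp

lemma cinner_diff_left: "cinner (x - y) z = cinner x z - cinner (y :: 'h::chilbert) z"
  using cinner_add_left[of "x - y" y z] by simp

lemma cinner_diff_right: "cinner z (x - y) = cinner z x - cinner z (y :: 'h::chilbert)"
  using cinner_add_right[of z "x - y" y] by simp

lemma Re_cinner_same: "Re (cinner x x) = (norm (x :: 'h::chilbert))\<^sup>2"
  by (simp add: cinner_same)

lemma cauchy_schwarz: "cmod (cinner x y) \<le> norm x * norm (y :: 'h::chilbert)"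
proof (cases "y = 0")
  case False
  \<comment> \<open>c y is the orthogonal projection of x onto the line through y; its distance from
    x measures the defect of the inequality.\<close>
  define c where "c = cinner x y / of_real ((norm y)\<^sup>2)"
  have ny: "norm y > 0" using False by simp
  have c: "c * of_real ((norm y)\<^sup>2) = cinner x y"
    using ny by (simp add: c_def)
  have "of_real ((norm (x - c *\<^sub>C y))\<^sup>2) = cinner (x - c *\<^sub>C y) (x - c *\<^sub>C y)"
    by (simp add: cinner_same)
  also have "\<dots> = cinner x x - cnj c * cinner x y - c * (cnj (cinner x y) - cnj c * cinner y y)"
    using cinner_commute[of y x]
    by (simp add: cinner_diff_left cinner_diff_right cinner_scaleC_left cinner_scaleC_right algebra_simps)
  also have "cnj (cinner x y) = cnj c * cinner y y"
    by (metis c cinner_same complex_cnj_complex_of_real complex_cnj_mult)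
  finally have "of_real ((norm (x - c *\<^sub>C y))\<^sup>2) = cinner x x - cnj c * cinner x y"
    by simp
  then have "of_real ((norm y)\<^sup>2 * (norm (x - c *\<^sub>C y))\<^sup>2)
      = of_real ((norm y)\<^sup>2) * (cinner x x - cnj c * cinner x y)"
    by (simp only: of_real_mult)
  also have "\<dots> = of_real ((norm y)\<^sup>2 * (norm x)\<^sup>2) - cnj (c * of_real ((norm y)\<^sup>2)) * cinner x y"
    by (simp add: cinner_same right_diff_distrib mult_ac)
  also have "\<dots> = of_real ((norm y)\<^sup>2 * (norm x)\<^sup>2 - (cmod (cinner x y))\<^sup>2)"
    by (simp only: c of_real_diff complex_norm_square) (simp add: mult.commute)
  finally have "(norm y)\<^sup>2 * (norm x)\<^sup>2 - (cmod (cinner x y))\<^sup>2 = (norm y)\<^sup>2 * (norm (x - c *\<^sub>C y))\<^sup>2"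
    by (simp only: of_real_eq_iff)
  also have "\<dots> \<ge> 0" by simp
  finally have "(cmod (cinner x y))\<^sup>2 \<le> (norm x * norm y)\<^sup>2"
    by (simp add: power_mult_distrib mult.commute)
  then show ?thesis by (rule power2_le_imp_le) simp
qed simp

lemma bounded_bilinear_cinner: "bounded_bilinear (cinner :: 'h::chilbert \<Rightarrow> 'h \<Rightarrow> complex)"
proof (rule bounded_bilinear.intro)
  show "\<exists>K. \<forall>a b. cmod (cinner (a :: 'h) b) \<le> norm a * norm b * K"
    by (intro exI[of _ 1]) (simp add: cauchy_schwarz)
qed (simp_all add: cinner_add_left cinner_add_right cinner_scaleR_left cinner_scaleR_right
    scaleR_conv_of_real)

interpretation cinner: bounded_bilinear "cinner :: 'h::chilbert \<Rightarrow> 'h \<Rightarrow> complex"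
  by (rule bounded_bilinear_cinner)

lemma cinner_eqI:
  assumes "\<And>z. cinner x z = cinner y (z :: 'h::chilbert)"
  shows "x = y"
proof -
  have "cinner (x - y) (x - y) = 0"
    by (simp add: cinner_diff_left assms)
  then show ?thesis by (simp add: cinner_same)
qed

lemma scaleC_diff_right: "c *\<^sub>C (x - y) = c *\<^sub>C x - c *\<^sub>C (y :: 'h::chilbert)"
  using bounded_linear.linear[OF bounded_linear_scaleC] by (rule linear_diff)

lemma scaleC_zero_right [simp]: "c *\<^sub>C (0 :: 'h::chilbert) = 0"
  using scaleC_diff_right[of c 0 0] by simp

lemma scaleC_scaleR: "c *\<^sub>C (r *\<^sub>R x) = r *\<^sub>R (c *\<^sub>C (x :: 'h::chilbert))"
  by (metis mult.commute scaleC_of_real scaleC_scaleC)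

lemma scaleC_one [simp]: "1 *\<^sub>C (x :: 'h::chilbert) = x"
  using scaleC_of_real[of 1 x] by simp

lemma scaleC_sum_right: "c *\<^sub>C (\<Sum>i\<in>I. g i) = (\<Sum>i\<in>I. c *\<^sub>C (g i :: 'h::chilbert))"
  using bounded_linear.linear[OF bounded_linear_scaleC] by (rule linear_sum)

lemma op_scaleC_of_real: "op_scaleC (of_real r) X = r *\<^sub>R X"
  by (rule blinfun_eqI) (simp add: op_scaleC_apply scaleC_of_real blinfun.scaleR_left)

lemmas blinfun_comp_simps =
  bounded_bilinear.add_left[OF bounded_bilinear_blinfun_compose]
  bounded_bilinear.add_right[OF bounded_bilinear_blinfun_compose]
  bounded_bilinear.diff_left[OF bounded_bilinear_blinfun_compose]
  bounded_bilinear.diff_right[OF bounded_bilinear_blinfun_compose]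
  bounded_bilinear.scaleR_left[OF bounded_bilinear_blinfun_compose]
  bounded_bilinear.scaleR_right[OF bounded_bilinear_blinfun_compose]
  bounded_bilinear.minus_left[OF bounded_bilinear_blinfun_compose]
  bounded_bilinear.minus_right[OF bounded_bilinear_blinfun_compose]

lemma blinfun_compose_sum_left: "(\<Sum>i\<in>I. g i) o\<^sub>L X = (\<Sum>i\<in>I. g i o\<^sub>L X)"
  by (rule bounded_bilinear.sum_left[OF bounded_bilinear_blinfun_compose])

lemma blinfun_compose_sum_right: "X o\<^sub>L (\<Sum>i\<in>I. g i) = (\<Sum>i\<in>I. X o\<^sub>L g i)"
  by (rule bounded_bilinear.sum_right[OF bounded_bilinear_blinfun_compose])

lemma blinfun_comp_id [simp]: "X o\<^sub>L id_blinfun = X" "id_blinfun o\<^sub>L X = X"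
  by (rule blinfun_eqI; simp)+

lemma blinfun_compose_assoc: "(X o\<^sub>L Y) o\<^sub>L Z = X o\<^sub>L (Y o\<^sub>L Z)"
  by (rule blinfun_eqI) simp

lemma tendsto_blinfun_compose [tendsto_intros]:
  assumes "(f \<longlongrightarrow> X) F" "(g \<longlongrightarrow> Y) F"
  shows "((\<lambda>t. f t o\<^sub>L g t) \<longlongrightarrow> X o\<^sub>L Y) F"
  by (rule bounded_bilinear.tendsto[OF bounded_bilinear_blinfun_compose assms])

lemma clinear_op_compose: "clinear_op X \<Longrightarrow> clinear_op Y \<Longrightarrow> clinear_op (X o\<^sub>L Y)"
  and clinear_op_add: "clinear_op X \<Longrightarrow> clinear_op Y \<Longrightarrow> clinear_op (X + Y)"
  and clinear_op_diff: "clinear_op X \<Longrightarrow> clinear_op Y \<Longrightarrow> clinear_op (X - Y)"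
  and clinear_op_scaleR: "clinear_op X \<Longrightarrow> clinear_op (r *\<^sub>R X)"
  and clinear_op_scaleC: "clinear_op X \<Longrightarrow> clinear_op (op_scaleC c X)"
  and clinear_op_id [simp]: "clinear_op id_blinfun"
  and clinear_op_zero [simp]: "clinear_op 0"
  by (auto simp: clinear_op_def blinfun.bilinear_simps scaleC_add_right scaleC_diff_right
      scaleC_scaleR op_scaleC_apply scaleC_scaleC mult.commute)

lemma clinear_op_limit:
  assumes "X \<longlonglongrightarrow> Y" "\<And>n::nat. clinear_op (X n)"
  shows "clinear_op Y"
  unfolding clinear_op_def
proof (intro allI)
  fix c x
  have "(\<lambda>n. X n (c *\<^sub>C x)) \<longlonglongrightarrow> Y (c *\<^sub>C x)"
    by (intro blinfun.tendsto assms tendsto_const)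
  moreover have "(\<lambda>n. X n (c *\<^sub>C x)) \<longlonglongrightarrow> c *\<^sub>C Y x"
    using assms(2) unfolding clinear_op_def
    by (auto intro!: bounded_linear.tendsto[OF bounded_linear_scaleC] blinfun.tendsto assms tendsto_const)
  ultimately show "Y (c *\<^sub>C x) = c *\<^sub>C Y x"
    by (rule LIMSEQ_unique)
qed

lemma selfadjoint_cinner: "selfadjoint X \<Longrightarrow> cinner (X x) y = cinner x (X y)"
  by (simp add: selfadjoint_def is_adjoint_def)

lemma selfadjoint_clinear: "selfadjoint X \<Longrightarrow> clinear_op X"
  by (simp add: selfadjoint_def)

lemma selfadjointI:
  "clinear_op X \<Longrightarrow> (\<And>x y. cinner (X x) y = cinner x (X y)) \<Longrightarrow> selfadjoint X"
  by (simp add: selfadjoint_def is_adjoint_def)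

lemma selfadjoint_add: "selfadjoint X \<Longrightarrow> selfadjoint Y \<Longrightarrow> selfadjoint (X + Y)"
  and selfadjoint_diff: "selfadjoint X \<Longrightarrow> selfadjoint Y \<Longrightarrow> selfadjoint (X - Y)"
  and selfadjoint_scaleR: "selfadjoint X \<Longrightarrow> selfadjoint (r *\<^sub>R X)"
  and selfadjoint_id [simp]: "selfadjoint id_blinfun"
  and selfadjoint_zero [simp]: "selfadjoint 0"
  by (auto simp: selfadjoint_def is_adjoint_def clinear_op_add clinear_op_diff clinear_op_scaleR
      blinfun.bilinear_simps cinner_add_left cinner_add_right cinner_diff_left cinner_diff_right
      cinner_scaleR_left cinner_scaleR_right)

lemma selfadjoint_sum: "(\<And>i. i \<in> I \<Longrightarrow> selfadjoint (X i)) \<Longrightarrow> selfadjoint (\<Sum>i\<in>I. X i)"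
  by (induction I rule: infinite_finite_induct) (auto intro: selfadjoint_add)

lemma selfadjoint_compose_commute:
  assumes "selfadjoint X" "selfadjoint Y" "X o\<^sub>L Y = Y o\<^sub>L X"
  shows "selfadjoint (X o\<^sub>L Y)"
proof (rule selfadjointI)
  show "clinear_op (X o\<^sub>L Y)"
    using assms by (simp add: clinear_op_compose selfadjoint_clinear)
  show "cinner ((X o\<^sub>L Y) x) y = cinner x ((X o\<^sub>L Y) y)" for x y
  proof -
    have "cinner ((X o\<^sub>L Y) x) y = cinner x ((Y o\<^sub>L X) y)"
      by (simp add: selfadjoint_cinner[OF assms(1)] selfadjoint_cinner[OF assms(2)])
    then show ?thesis by (simp only: assms(3))
  qed
qed

lemma selfadjoint_conj: "selfadjoint S \<Longrightarrow> selfadjoint X \<Longrightarrow> selfadjoint (S o\<^sub>L X o\<^sub>L S)"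
  by (rule selfadjointI) (simp_all add: clinear_op_compose selfadjoint_clinear selfadjoint_cinner)

lemma selfadjoint_limit:
  assumes "X \<longlonglongrightarrow> Y" "\<And>n::nat. selfadjoint (X n)"
  shows "selfadjoint Y"
proof (rule selfadjointI)
  show "clinear_op Y"
    using assms selfadjoint_clinear by (blast intro: clinear_op_limit)
  fix x y
  have "(\<lambda>n. cinner (X n x) y) \<longlonglongrightarrow> cinner (Y x) y"
    by (intro cinner.tendsto blinfun.tendsto assms tendsto_const)
  moreover have "(\<lambda>n. cinner (X n x) y) \<longlonglongrightarrow> cinner x (Y y)"
    unfolding selfadjoint_cinner[OF assms(2)]
    by (intro cinner.tendsto blinfun.tendsto assms tendsto_const)
  ultimately show "cinner (Y x) y = cinner x (Y y)"
    by (rule LIMSEQ_unique)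
qed

section \<open>Quadratic forms and the operator order\<close>

definition qform :: "('h::chilbert \<Rightarrow>\<^sub>L 'h) \<Rightarrow> 'h \<Rightarrow> real" where
  "qform X x = Re (cinner (X x) x)"

lemma qform_add: "qform (X + Y) x = qform X x + qform Y x"
  and qform_diff: "qform (X - Y) x = qform X x - qform Y x"
  and qform_scaleR: "qform (r *\<^sub>R X) x = r * qform X x"
  and qform_minus: "qform (- X) x = - qform X x"
  and qform_id: "qform id_blinfun x = (norm x)\<^sup>2"
  and qform_zero [simp]: "qform 0 x = 0"
  by (simp_all add: qform_def blinfun.bilinear_simps cinner_add_left cinner_diff_left
      cinner_scaleR_left cinner.minus_left cinner_same)

lemmas qform_simps = qform_add qform_diff qform_scaleR qform_minus

lemma qform_sum: "qform (\<Sum>i\<in>I. X i) x = (\<Sum>i\<in>I. qform (X i) x)"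
  by (induction I rule: infinite_finite_induct) (auto simp: qform_add)

lemma qform_conj: "selfadjoint S \<Longrightarrow> qform (S o\<^sub>L X o\<^sub>L S) x = qform X (S x)"
  by (simp add: qform_def selfadjoint_cinner)

lemma tendsto_qform: "X \<longlonglongrightarrow> Y \<Longrightarrow> (\<lambda>n. qform (X n) x) \<longlonglongrightarrow> qform Y x"
  unfolding qform_def
  by (intro tendsto_Re cinner.tendsto blinfun.tendsto tendsto_const)

lemma abs_qform_le: "\<bar>qform X x\<bar> \<le> norm X * (norm x)\<^sup>2"
proof -
  have "\<bar>qform X x\<bar> \<le> cmod (cinner (X x) x)"
    unfolding qform_def by (rule abs_Re_le_cmod)
  also have "\<dots> \<le> norm (X x) * norm x" by (rule cauchy_schwarz)
  also have "\<dots> \<le> (norm X * norm x) * norm x"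
    by (intro mult_right_mono norm_blinfun) simp
  finally show ?thesis by (simp add: power2_eq_square mult.assoc)
qed

lemma selfadjoint_cinner_real: "selfadjoint X \<Longrightarrow> cinner (X x) x = of_real (qform X x)"
proof -
  assume "selfadjoint X"
  then have "cinner (X x) x = cnj (cinner (X x) x)"
    by (metis cinner_commute selfadjoint_cinner)
  then have "Im (cinner (X x) x) = 0"
    by (metis Reals_cnj_iff complex_is_Real_iff)
  then show ?thesis by (simp add: qform_def complex_eq_iff)
qed

lemma positive_opI:
  assumes "selfadjoint X" "\<And>x. 0 \<le> qform X x"
  shows "positive_op X"
  using assms by (simp add: positive_op_def selfadjoint_clinear selfadjoint_cinner_real)

lemma positive_op_qform: "positive_op X \<Longrightarrow> 0 \<le> qform X x"
  by (simp add: positive_op_def qform_def complex_nonneg_Reals_iff)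

text \<open>On a complex space a form with real values is Hermitian: evaluated at x + y it
  determines the imaginary part of \<open>cinner (X x) y\<close>, at x + i y the real part.\<close>

lemma positive_op_selfadjoint:
  assumes "positive_op X"
  shows "selfadjoint X"
proof (rule selfadjointI)
  show cl: "clinear_op X" using assms by (simp add: positive_op_def)
  fix x y
  have im: "Im (cinner (X z) z) = 0" for z
    using assms by (simp add: positive_op_def complex_nonneg_Reals_iff)
  have "Im (cinner (X (x + y)) (x + y)) = 0" by (rule im)
  then have 1: "Im (cinner (X x) y) + Im (cinner (X y) x) = 0"
    by (simp add: blinfun.bilinear_simps cinner_add_left cinner_add_right im)
  have "Im (cinner (X (x + \<i> *\<^sub>C y)) (x + \<i> *\<^sub>C y)) = 0" by (rule im)
  then have 2: "Re (cinner (X x) y) = Re (cinner (X y) x)"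
    using cl by (simp add: blinfun.bilinear_simps clinear_op_def cinner_add_left cinner_add_right im
        cinner_scaleC_left cinner_scaleC_right)
  have "cinner (X x) y = cnj (cinner (X y) x)"
    using 1 2 by (simp add: complex_eq_iff)
  then show "cinner (X x) y = cinner x (X y)"
    by (metis cinner_commute)
qed

lemma op_leI:
  "selfadjoint X \<Longrightarrow> selfadjoint Y \<Longrightarrow> (\<And>x. qform X x \<le> qform Y x) \<Longrightarrow> X \<preceq> Y"
  by (auto simp: op_le_def qform_simps intro!: positive_opI selfadjoint_diff)

lemma op_le_qform: "X \<preceq> Y \<Longrightarrow> qform X x \<le> qform Y x"
  using positive_op_qform[of "Y - X" x] by (simp add: op_le_def qform_simps)

lemma positive_op_add: "positive_op X \<Longrightarrow> positive_op Y \<Longrightarrow> positive_op (X + Y)"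
  by (rule positive_opI) (simp_all add: selfadjoint_add positive_op_selfadjoint qform_add positive_op_qform)

lemma positive_op_scaleR: "positive_op X \<Longrightarrow> 0 \<le> r \<Longrightarrow> positive_op (r *\<^sub>R X)"
  by (rule positive_opI) (simp_all add: selfadjoint_scaleR positive_op_selfadjoint qform_scaleR positive_op_qform)

lemma positive_op_conj: "selfadjoint S \<Longrightarrow> positive_op X \<Longrightarrow> positive_op (S o\<^sub>L X o\<^sub>L S)"
  by (rule positive_opI) (simp_all add: selfadjoint_conj positive_op_selfadjoint qform_conj positive_op_qform)

lemma positive_op_limit:
  assumes "X \<longlonglongrightarrow> Y" "\<And>n::nat. positive_op (X n)"
  shows "positive_op Y"
proof (rule positive_opI)
  show "selfadjoint Y"
    by (rule selfadjoint_limit[OF assms(1) positive_op_selfadjoint[OF assms(2)]])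
  show "0 \<le> qform Y x" for x
    by (rule LIMSEQ_le_const[OF tendsto_qform[OF assms(1)]]) (simp add: positive_op_qform[OF assms(2)])
qed

lemma positive_op_id: "positive_op id_blinfun"
  by (rule positive_opI) (simp_all add: qform_id)

lemma positive_op_zero: "positive_op 0"
  by (rule positive_opI) simp_all

lemma op_le_add: "X \<preceq> Y \<Longrightarrow> X' \<preceq> Y' \<Longrightarrow> X + X' \<preceq> Y + Y'"
  using positive_op_add[of "Y - X" "Y' - X'"] by (simp add: op_le_def algebra_simps)

text \<open>On the zero space all operators coincide. That space is treated apart because spectra
  are empty there and yield no form bounds with endpoints in \<open>J\<close>.\<close>

lemma op_le_trivial:
  assumes "(id_blinfun :: 'k::chilbert \<Rightarrow>\<^sub>L 'k) = 0"
  shows "(X :: 'k \<Rightarrow>\<^sub>L 'k) \<preceq> Y"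
proof -
  have "x = 0" for x :: 'k
    using arg_cong[OF assms, of "\<lambda>X. X x"] by simp
  then have "V = 0" for V :: "'k \<Rightarrow>\<^sub>L 'k"
    by (intro blinfun_eqI) metis
  then show ?thesis using positive_op_zero unfolding op_le_def by metis
qed

text \<open>Polarisation: the forms at x + y and x - y differ by four times the real part of
  \<open>cinner (X x) y\<close>, and the parallelogram law adds up their two bounds.\<close>

lemma norm_le_numerical_radius:
  assumes X: "selfadjoint X" and c: "\<And>x. \<bar>qform X x\<bar> \<le> c * (norm x)\<^sup>2" "0 \<le> c"
  shows "norm X \<le> c"
proof (rule norm_blinfun_bound)
  show "norm (X x) \<le> c * norm x" for x
  proof (cases "X x = 0 \<or> x = 0")
    case False
    \<comment> \<open>The direction of X x turns that real part into a norm; the length of x makes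
      the parallelogram sum equal to 4 (norm x)^2.\<close>
    define y where "y = (norm x / norm (X x)) *\<^sub>R X x"
    have ny: "norm y = norm x" using False by (simp add: y_def)
    have "cinner (X y) x = cnj (cinner (X x) y)"
      by (metis cinner_commute selfadjoint_cinner[OF X])
    then have "qform X (x + y) - qform X (x - y) = 4 * Re (cinner (X x) y)"
      by (simp add: qform_def blinfun.bilinear_simps cinner_add_left cinner_add_right
          cinner_diff_left cinner_diff_right)
    moreover have "Re (cinner (X x) y) = norm x * norm (X x)"
      using False by (simp add: y_def cinner_scaleR_right cinner_same power2_eq_square)
    moreover have "qform X (x + y) - qform X (x - y) \<le> c * ((norm (x + y))\<^sup>2 + (norm (x - y))\<^sup>2)"
      using c(1)[of "x + y"] c(1)[of "x - y"] by (simp add: algebra_simps)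
    moreover have "(norm (x + y))\<^sup>2 + (norm (x - y))\<^sup>2 = 2 * (norm x)\<^sup>2 + 2 * (norm y)\<^sup>2"
      by (simp only: Re_cinner_same[symmetric])
        (simp add: cinner_add_left cinner_add_right cinner_diff_left cinner_diff_right)
    ultimately have "4 * (norm x * norm (X x)) \<le> c * (4 * (norm x)\<^sup>2)"
      by (simp add: ny)
    then have "norm x * norm (X x) \<le> norm x * (c * norm x)"
      by (simp add: power2_eq_square mult_ac)
    then show ?thesis using False by simp
  qed (use c in auto)
qed (use c in auto)

text \<open>Nonnegativity of the form at x - t X x; for t = 1 / norm X the quadratic term cancels
  half of the linear one. No square root of X appears, since the functional calculus is built on
  this estimate.\<close>

lemma positive_op_norm_sq_le:
  assumes X: "selfadjoint X" and pos: "\<And>x. 0 \<le> qform X x"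
  shows "(norm (X x))\<^sup>2 \<le> norm X * qform X x"
proof (cases "X = 0")
  case False
  then have nX: "norm X > 0" by simp
  define t where "t = 1 / norm X"
  have "0 \<le> qform X (x - t *\<^sub>R X x)" by (rule pos)
  also have "\<dots> = qform X x - 2 * t * (norm (X x))\<^sup>2 + t\<^sup>2 * qform X (X x)"
  proof -
    have "cinner (X (X x)) x = cinner (X x) (X x)"
      by (simp add: selfadjoint_cinner[OF X])
    then show ?thesis
      by (simp add: qform_def blinfun.bilinear_simps cinner_diff_left cinner_diff_right cinner_same
          cinner_scaleR_left cinner_scaleR_right power2_eq_square algebra_simps)
  qed
  also have "\<dots> \<le> qform X x - 2 * t * (norm (X x))\<^sup>2 + t\<^sup>2 * (norm X * (norm (X x))\<^sup>2)"
    using abs_qform_le[of X "X x"] by (intro add_left_mono mult_left_mono) auto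
  also have "t\<^sup>2 * (norm X * (norm (X x))\<^sup>2) = t * (norm (X x))\<^sup>2"
    using nX by (simp add: t_def power2_eq_square)
  finally have "t * (norm (X x))\<^sup>2 \<le> qform X x" by simp
  then show ?thesis using nX by (simp add: t_def field_simps)
qed simp

section \<open>Operators below a projection\<close>

lemma projection_id [simp]: "projection id_blinfun"
  by (simp add: projection_def)

lemma ops_on_id: "ops_on id_blinfun = {X. clinear_op X}"
  by (simp add: ops_on_def)

lemma projection_idem: "projection e \<Longrightarrow> e o\<^sub>L e = e"
  and projection_selfadjoint: "projection e \<Longrightarrow> selfadjoint e"
  by (simp_all add: projection_def)

lemma projection_qform: "projection e \<Longrightarrow> qform e x = (norm (e x))\<^sup>2"
proof -
  assume e: "projection e"
  have "cinner (e x) x = cinner (e (e x)) x"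
    using projection_idem[OF e] by (metis blinfun_apply_blinfun_compose)
  also have "\<dots> = cinner (e x) (e x)"
    by (rule selfadjoint_cinner[OF projection_selfadjoint[OF e]])
  finally show ?thesis by (simp add: qform_def cinner_same)
qed

lemma projection_norm_le: "projection e \<Longrightarrow> norm (e x) \<le> norm x"
proof -
  assume e: "projection e"
  have "(norm (e x))\<^sup>2 \<le> cmod (cinner (e x) x)"
    unfolding projection_qform[OF e, symmetric] qform_def by (rule complex_Re_le_cmod)
  also have "\<dots> \<le> norm (e x) * norm x" by (rule cauchy_schwarz)
  finally show ?thesis
    by (cases "e x = 0") (auto simp: power2_eq_square)
qed

lemma ops_on_left: "projection e \<Longrightarrow> X \<in> ops_on e \<Longrightarrow> e o\<^sub>L X = X"
  and ops_on_right: "projection e \<Longrightarrow> X \<in> ops_on e \<Longrightarrow> X o\<^sub>L e = X"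
  by (auto simp: ops_on_def projection_def) (metis blinfun_compose_assoc)+

lemma ops_onI:
  assumes "clinear_op X" "e o\<^sub>L X = X" "X o\<^sub>L e = X"
  shows "X \<in> ops_on e"
  using assms by (simp add: ops_on_def)

lemma ops_on_clinear: "X \<in> ops_on e \<Longrightarrow> clinear_op X"
  by (simp add: ops_on_def)

lemma ops_on_self: "projection e \<Longrightarrow> e \<in> ops_on e"
  by (simp add: ops_on_def projection_def selfadjoint_def)

lemma ops_on_add: "X \<in> ops_on e \<Longrightarrow> Y \<in> ops_on e \<Longrightarrow> X + Y \<in> ops_on e"
  and ops_on_diff: "X \<in> ops_on e \<Longrightarrow> Y \<in> ops_on e \<Longrightarrow> X - Y \<in> ops_on e"
  and ops_on_scaleR: "X \<in> ops_on e \<Longrightarrow> r *\<^sub>R X \<in> ops_on e"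
  and ops_on_zero: "0 \<in> ops_on e"
  by (auto simp: ops_on_def clinear_op_add clinear_op_diff clinear_op_scaleR blinfun_comp_simps)

lemma op_scaleC_compose:
  "op_scaleC c X o\<^sub>L Y = op_scaleC c (X o\<^sub>L Y)"
  "clinear_op Y \<Longrightarrow> Y o\<^sub>L op_scaleC c X = op_scaleC c (Y o\<^sub>L X)"
  by (auto intro!: blinfun_eqI simp: op_scaleC_apply clinear_op_def)

lemma ops_on_scaleC: "projection e \<Longrightarrow> X \<in> ops_on e \<Longrightarrow> op_scaleC c X \<in> ops_on e"
  by (rule ops_onI)
    (auto simp: op_scaleC_compose selfadjoint_clinear projection_selfadjoint ops_on_left ops_on_right
      intro: clinear_op_scaleC ops_on_clinear)

lemma ops_on_sum: "(\<And>i. i \<in> I \<Longrightarrow> X i \<in> ops_on e) \<Longrightarrow> (\<Sum>i\<in>I. X i) \<in> ops_on e"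
  by (induction I rule: infinite_finite_induct) (auto intro: ops_on_add ops_on_zero)

lemma ops_on_compose:
  "projection e \<Longrightarrow> X \<in> ops_on e \<Longrightarrow> Y \<in> ops_on e \<Longrightarrow> X o\<^sub>L Y \<in> ops_on e"
  by (rule ops_onI)
    (simp_all add: clinear_op_compose ops_on_clinear blinfun_compose_assoc ops_on_right,
      simp add: ops_on_left flip: blinfun_compose_assoc)

lemma ops_on_limit:
  assumes "X \<longlonglongrightarrow> Y" "\<And>n::nat. X n \<in> ops_on e"
  shows "Y \<in> ops_on e"
proof -
  have "clinear_op Y"
    using assms ops_on_clinear by (blast intro: clinear_op_limit)
  moreover have "(\<lambda>n. e o\<^sub>L X n o\<^sub>L e) \<longlonglongrightarrow> (e o\<^sub>L Y o\<^sub>L e)"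
    by (intro tendsto_intros assms)
  moreover have "(\<lambda>n. e o\<^sub>L X n o\<^sub>L e) \<longlonglongrightarrow> Y"
    using assms by (simp add: ops_on_def)
  ultimately show ?thesis
    using LIMSEQ_unique by (auto simp: ops_on_def)
qed

section \<open>Spectrum and form bounds\<close>

definition sa_on :: "('h::chilbert \<Rightarrow>\<^sub>L 'h) \<Rightarrow> ('h \<Rightarrow>\<^sub>L 'h) \<Rightarrow> bool" where
  "sa_on e X \<longleftrightarrow> projection e \<and> X \<in> ops_on e \<and> selfadjoint X"

text \<open>The order bounds a e \<le> X \<le> b e. They stand in for spectral inclusion in most of
  the development because they pass through sums, limits and positive maps directly.\<close>

definition form_in :: "('h::chilbert \<Rightarrow>\<^sub>L 'h) \<Rightarrow> real \<Rightarrow> real \<Rightarrow> ('h \<Rightarrow>\<^sub>L 'h) \<Rightarrow> bool" where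
  "form_in e a b X \<longleftrightarrow> (\<forall>x. a * qform e x \<le> qform X x \<and> qform X x \<le> b * qform e x)"

lemma sa_onD:
  assumes "sa_on e X"
  shows "projection e" "X \<in> ops_on e" "selfadjoint X"
  using assms by (simp_all add: sa_on_def)

lemma sa_on_id: "sa_on id_blinfun X \<longleftrightarrow> selfadjoint X"
  by (auto simp: sa_on_def ops_on_id selfadjoint_clinear)

lemma sa_on_self: "projection e \<Longrightarrow> sa_on e e"
  by (simp add: sa_on_def ops_on_self projection_selfadjoint)

lemma sa_on_add: "sa_on e X \<Longrightarrow> sa_on e Y \<Longrightarrow> sa_on e (X + Y)"
  and sa_on_diff: "sa_on e X \<Longrightarrow> sa_on e Y \<Longrightarrow> sa_on e (X - Y)"
  and sa_on_scaleR: "sa_on e X \<Longrightarrow> sa_on e (r *\<^sub>R X)"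
  by (auto simp: sa_on_def intro: ops_on_add ops_on_diff ops_on_scaleR selfadjoint_add
      selfadjoint_diff selfadjoint_scaleR)

lemma sa_on_minus: "sa_on e X \<Longrightarrow> sa_on e (- X)"
  using sa_on_scaleR[of e X "-1"] by simp

lemma sa_on_limit: "X \<longlonglongrightarrow> Y \<Longrightarrow> (\<And>n::nat. sa_on e (X n)) \<Longrightarrow> sa_on e Y"
  unfolding sa_on_def using ops_on_limit selfadjoint_limit by blast

lemma qform_nonneg_projection: "projection e \<Longrightarrow> 0 \<le> qform e x"
  by (simp add: projection_qform)

lemma qform_projection_le: "projection e \<Longrightarrow> qform e x \<le> (norm x)\<^sup>2"
  by (simp add: projection_qform projection_norm_le)

lemma ops_on_apply:
  assumes "projection e" "X \<in> ops_on e"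
  shows "X (e x) = X x" "e (X x) = X x"
  using ops_on_right[OF assms] ops_on_left[OF assms]
  by (metis blinfun_apply_blinfun_compose)+

lemma qform_ops_on:
  assumes "projection e" "X \<in> ops_on e"
  shows "qform X (e x) = qform X x"
proof -
  have "cinner (X x) (e x) = cinner (e (X x)) x"
    by (rule selfadjoint_cinner[OF projection_selfadjoint[OF assms(1)], symmetric])
  then show ?thesis by (simp add: qform_def ops_on_apply[OF assms])
qed

lemma abs_qform_le_on:
  assumes "projection e" "X \<in> ops_on e"
  shows "\<bar>qform X x\<bar> \<le> norm X * qform e x"
  using abs_qform_le[of X "e x"] by (simp add: qform_ops_on[OF assms] projection_qform assms)

lemma form_in_norm: "projection e \<Longrightarrow> X \<in> ops_on e \<Longrightarrow> form_in e (- norm X) (norm X) X"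
  using abs_qform_le_on[of e X] unfolding form_in_def abs_le_iff by (auto simp: minus_le_iff)

lemma norm_le_form_in:
  assumes "sa_on e X" "form_in e (- c) c X" "0 \<le> c"
  shows "norm X \<le> c"
proof (rule norm_le_numerical_radius)
  show "selfadjoint X" using assms sa_onD by blast
  show "\<bar>qform X x\<bar> \<le> c * (norm x)\<^sup>2" for x
  proof -
    have "\<bar>qform X x\<bar> \<le> c * qform e x"
      using assms(2) by (auto simp: form_in_def abs_le_iff minus_le_iff)
    also have "\<dots> \<le> c * (norm x)\<^sup>2"
      using assms by (intro mult_left_mono qform_projection_le sa_onD)
    finally show ?thesis .
  qed
qed fact

lemma op_power_ops_on: "projection e \<Longrightarrow> X \<in> ops_on e \<Longrightarrow> op_power e X n \<in> ops_on e"
  by (induction n) (auto intro: ops_on_self ops_on_compose)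

lemma op_power_commute:
  "projection e \<Longrightarrow> X \<in> ops_on e \<Longrightarrow> op_power e X n o\<^sub>L X = X o\<^sub>L op_power e X n"
  by (induction n) (simp_all add: ops_on_left ops_on_right blinfun_compose_assoc)

lemma invertible_onI:
  "Y \<in> ops_on e \<Longrightarrow> X o\<^sub>L Y = e \<Longrightarrow> Y o\<^sub>L X = e \<Longrightarrow> invertible_on e X"
  by (auto simp: invertible_on_def)

lemma invertible_on_compose:
  assumes e: "projection e" and X: "invertible_on e X" "invertible_on e Y" "X \<in> ops_on e" "Y \<in> ops_on e"
  shows "invertible_on e (X o\<^sub>L Y)"
proof -
  obtain R S where R: "R \<in> ops_on e" "X o\<^sub>L R = e" "R o\<^sub>L X = e"
    and S: "S \<in> ops_on e" "Y o\<^sub>L S = e" "S o\<^sub>L Y = e"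
    using X by (auto simp: invertible_on_def)
  have "(X o\<^sub>L Y) o\<^sub>L (S o\<^sub>L R) = X o\<^sub>L ((Y o\<^sub>L S) o\<^sub>L R)"
    and "(S o\<^sub>L R) o\<^sub>L (X o\<^sub>L Y) = S o\<^sub>L ((R o\<^sub>L X) o\<^sub>L Y)"
    by (simp_all only: blinfun_compose_assoc)
  then show ?thesis
    using R S X e by (intro invertible_onI[of "S o\<^sub>L R"]) (auto simp: ops_on_left intro: ops_on_compose)
qed

lemma invertible_on_scaleC:
  assumes e: "projection e" and X: "X \<in> ops_on e" and u: "u \<noteq> 0" and inv: "invertible_on e (op_scaleC u X)"
  shows "invertible_on e X"
proof -
  obtain R where R: "R \<in> ops_on e" "op_scaleC u X o\<^sub>L R = e" "R o\<^sub>L op_scaleC u X = e"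
    using inv by (auto simp: invertible_on_def)
  have "X o\<^sub>L op_scaleC u R = e" "op_scaleC u R o\<^sub>L X = e"
    using R(2,3) op_scaleC_compose(2)[OF ops_on_clinear[OF X], of u R]
      op_scaleC_compose(2)[OF ops_on_clinear[OF R(1)], of u X]
    by (simp_all only: op_scaleC_compose(1))
  then show ?thesis
    using R e by (intro invertible_onI[of "op_scaleC u R"]) (auto intro: ops_on_scaleC)
qed

lemma invertible_on_minus:
  assumes "projection e" "X \<in> ops_on e" "invertible_on e (- X)"
  shows "invertible_on e X"
  using invertible_on_scaleC[of e X "-1"] op_scaleC_of_real[of "-1" X] assms by simp

text \<open>For small \<open>\<tau> > 0\<close> the operator \<open>e - \<tau> T\<close> is a strict contraction, so \<open>\<tau> T\<close> is
  inverted by a Neumann series.\<close>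

lemma coercive_invertible_on:
  assumes e: "projection e" and T: "T \<in> ops_on e" and c: "c > 0"
    and coercive: "\<And>x. c * qform e x \<le> qform T x"
  shows "invertible_on e T"
proof -
  define M where "M = norm T + c"
  have M: "M > 0" "norm T \<le> M" "c \<le> M" using c by (auto simp: M_def add_nonneg_pos)
  \<comment> \<open>This choice minimises 1 - 2 \<tau> c + \<tau>^2 M^2, and the minimum is
    \<open>k\<close> below.\<close>
  define \<tau> where "\<tau> = c / M\<^sup>2"
  have \<tau>: "\<tau> > 0" using c M by (simp add: \<tau>_def)
  define N where "N = e - \<tau> *\<^sub>R T"
  have N: "N \<in> ops_on e"
    unfolding N_def by (intro ops_on_diff ops_on_self ops_on_scaleR e T)
  define k where "k = 1 - c\<^sup>2 / M\<^sup>2"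
  have "c\<^sup>2 \<le> M\<^sup>2" using c M by (intro power_mono) auto
  then have k: "0 \<le> k" "k < 1" using c M by (auto simp: k_def)
  have "(norm (N x))\<^sup>2 \<le> k * (norm x)\<^sup>2" for x
  proof -
    have "cinner (T x) (e x) = cinner (T x) x"
      using selfadjoint_cinner[OF projection_selfadjoint[OF e], of "T x" x] by (simp add: ops_on_apply[OF e T])
    moreover have "cinner (e x) (T x) = cnj (cinner (T x) (e x))"
      by (rule cinner_commute)
    ultimately have "(norm (N x))\<^sup>2 = (norm (e x))\<^sup>2 - 2 * \<tau> * qform T x + \<tau>\<^sup>2 * (norm (T x))\<^sup>2"
      unfolding N_def Re_cinner_same[symmetric]
      by (simp add: blinfun.bilinear_simps cinner_diff_left cinner_diff_right cinner_scaleR_left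
          cinner_scaleR_right qform_def power2_eq_square algebra_simps)
    also have "\<dots> \<le> (norm (e x))\<^sup>2 - 2 * \<tau> * (c * (norm (e x))\<^sup>2) + \<tau>\<^sup>2 * (M\<^sup>2 * (norm (e x))\<^sup>2)"
    proof (intro add_mono diff_mono mult_left_mono order_refl)
      show "c * (norm (e x))\<^sup>2 \<le> qform T x"
        using coercive[of x] by (simp add: projection_qform e)
      have "norm (T x) \<le> norm T * norm (e x)"
        using norm_blinfun[of T "e x"] by (simp add: ops_on_apply[OF e T])
      also have "\<dots> \<le> M * norm (e x)" using M by (intro mult_right_mono) auto
      finally show "(norm (T x))\<^sup>2 \<le> M\<^sup>2 * (norm (e x))\<^sup>2"
        by (simp flip: power_mult_distrib add: power_mono)
    qed (use \<tau> in auto)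
    also have "\<dots> = k * (norm (e x))\<^sup>2"
      using M by (simp add: k_def \<tau>_def power2_eq_square field_simps)
    also have "\<dots> \<le> k * (norm x)\<^sup>2"
      using k projection_norm_le[OF e, of x] by (intro mult_left_mono power_mono) auto
    finally show ?thesis .
  qed
  then have "norm (N x) \<le> sqrt k * norm x" for x
    by (metis norm_ge_zero real_sqrt_le_mono real_sqrt_mult real_sqrt_abs abs_of_nonneg)
  then have nN: "norm N \<le> sqrt k" using k by (intro norm_blinfun_bound) auto
  have nP: "norm (op_power e N n) \<le> sqrt k ^ n" for n
  proof (induction n)
    case 0
    have "norm e \<le> 1" using projection_norm_le[OF e] by (intro norm_blinfun_bound) auto
    then show ?case by simp
  next
    case (Suc n)
    have "norm (op_power e N (Suc n)) \<le> norm N * norm (op_power e N n)"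
      by (simp add: norm_blinfun_compose)
    also have "\<dots> \<le> sqrt k * sqrt k ^ n" using nN Suc k by (intro mult_mono) auto
    finally show ?case by simp
  qed
  have sm: "summable (op_power e N)"
    by (rule summable_comparison_test'[OF summable_geometric[of "sqrt k"]]) (use nP k in auto)
  define S where "S = suminf (op_power e N)"
  have "(\<lambda>n. \<Sum>i<n. op_power e N i) \<longlonglongrightarrow> S"
    unfolding S_def by (rule summable_LIMSEQ[OF sm])
  then have S: "S \<in> ops_on e"
    by (rule ops_on_limit) (auto intro!: ops_on_sum op_power_ops_on e N)
  have shift: "(\<Sum>n. op_power e N (Suc n)) = S - e"
    using suminf_split_head[OF sm] by (simp add: S_def)
  have NS: "N o\<^sub>L S = S - e"
    unfolding S_def using bounded_linear.suminf[OF bounded_bilinear.bounded_linear_right[OF bounded_bilinear_blinfun_compose] sm, of N] shift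
    by (simp add: S_def)
  have SN: "S o\<^sub>L N = S - e"
    unfolding S_def using bounded_linear.suminf[OF bounded_bilinear.bounded_linear_left[OF bounded_bilinear_blinfun_compose] sm, of N] shift
    by (simp add: S_def op_power_commute[OF e N])
  have T_N: "\<tau> *\<^sub>R T = e - N" by (simp add: N_def)
  have "(\<tau> *\<^sub>R T) o\<^sub>L S = e" "S o\<^sub>L (\<tau> *\<^sub>R T) = e"
    unfolding T_N by (simp_all add: blinfun_comp_simps NS SN ops_on_left[OF e S] ops_on_right[OF e S])
  then have "T o\<^sub>L (\<tau> *\<^sub>R S) = e" "(\<tau> *\<^sub>R S) o\<^sub>L T = e"
    by (simp_all add: blinfun_comp_simps)
  then show ?thesis
    using S by (intro invertible_onI[of "\<tau> *\<^sub>R S"]) (auto intro: ops_on_scaleR)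
qed

text \<open>For z outside [a, b] a suitable factor u makes u (X - z e) coercive, hence invertible: u
  = i or -i by the sign of Im z when z is not real, u = 1 to the left of a and u = -1 to the right
  of b.\<close>

lemma form_in_spectrum:
  assumes X: "sa_on e X" and ab: "form_in e a b X"
  shows "spectrum_on e X \<subseteq> of_real ` {a..b}"
proof
  fix z assume z: "z \<in> spectrum_on e X"
  note e = sa_onD(1)[OF X]
  let ?Y = "X - op_scaleC z e"
  have Y: "?Y \<in> ops_on e"
    by (intro ops_on_diff ops_on_scaleC ops_on_self e sa_onD[OF X])
  have q: "qform (op_scaleC u ?Y) x = Re (u * (of_real (qform X x) - z * of_real (qform e x)))" for u x
    using selfadjoint_cinner_real[OF sa_onD(3)[OF X], of x]
      selfadjoint_cinner_real[OF projection_selfadjoint[OF e], of x]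
    by (simp add: qform_def[of "op_scaleC u ?Y"] op_scaleC_apply blinfun.bilinear_simps cinner_scaleC_left cinner_diff_left)
  have no: False if "u \<noteq> 0" "c > 0"
    "\<And>x. c * qform e x \<le> Re (u * (of_real (qform X x) - z * of_real (qform e x)))" for u c
  proof -
    have "invertible_on e (op_scaleC u ?Y)"
      using that q by (intro coercive_invertible_on[of e _ c] e ops_on_scaleC Y) auto
    then show False
      using invertible_on_scaleC[OF e Y that(1)] z by (simp add: spectrum_on_def)
  qed
  have X_ab: "a * qform e x \<le> qform X x" "qform X x \<le> b * qform e x" for x
    using ab by (auto simp: form_in_def)
  have Im0: "Im z = 0"
  proof (rule ccontr)
    assume "Im z \<noteq> 0"
    then show False
      by (intro no[of "\<i> * of_real (sgn (Im z))" "\<bar>Im z\<bar>"])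
        (auto simp: sgn_if qform_nonneg_projection[OF e])
  qed
  moreover have "a \<le> Re z"
  proof (rule ccontr)
    assume "\<not> a \<le> Re z"
    then show False
      using Im0 X_ab by (intro no[of 1 "a - Re z"]) (auto simp: algebra_simps)
  qed
  moreover have "Re z \<le> b"
  proof (rule ccontr)
    assume "\<not> Re z \<le> b"
    then show False
      using Im0 X_ab by (intro no[of "-1" "Re z - b"]) (auto simp: algebra_simps)
  qed
  ultimately show "z \<in> of_real ` {a..b}"
    by (intro image_eqI[of _ _ "Re z"]) (auto simp: complex_eq_iff)
qed

lemma form_in_spectrum_in:
  assumes "sa_on e X" "form_in e a b X" "{a..b} \<subseteq> J"
  shows "spectrum_in e X J"
  using form_in_spectrum[OF assms(1,2)] assms(3) by (auto simp: spectrum_in_def)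

text \<open>If R inverts X then e x = R (X x), so the norm of e x is controlled by that of X x, and
  \<open>positive_op_norm_sq_le\<close> controls the latter by the form.\<close>

lemma invertible_lower_bound:
  assumes X: "sa_on e X" and pos: "\<And>x. 0 \<le> qform X x" and inv: "invertible_on e X"
  obtains \<delta> where "\<delta> > 0" "\<And>x. \<delta> * qform e x \<le> qform X x"
proof -
  note e = sa_onD(1)[OF X]
  obtain R where R: "R \<in> ops_on e" "R o\<^sub>L X = e"
    using inv by (auto simp: invertible_on_def)
  \<comment> \<open>The summand 1 keeps \<open>K\<close> positive when \<open>R\<close> or
    \<open>X\<close> vanishes.\<close>
  define K where "K = (norm R)\<^sup>2 * norm X + 1"
  have K: "K > 0" by (simp add: K_def add_nonneg_pos)
  have "1 / K * qform e x \<le> qform X x" for x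
  proof -
    have "qform e x = (norm (R (X x)))\<^sup>2"
      using R(2) by (metis projection_qform[OF e] blinfun_apply_blinfun_compose)
    also have "\<dots> \<le> (norm R * norm (X x))\<^sup>2"
      by (intro power_mono norm_blinfun) auto
    also have "\<dots> \<le> (norm R)\<^sup>2 * (norm X * qform X x)"
      unfolding power_mult_distrib
      by (intro mult_left_mono positive_op_norm_sq_le pos sa_onD[OF X]) auto
    also have "\<dots> \<le> K * qform X x"
      using pos[of x] by (simp add: K_def algebra_simps)
    finally show ?thesis using K by (simp add: field_simps)
  qed
  with K show ?thesis by (intro that[of "1 / K"]) auto
qed

lemma invertible_on_of_real:
  "of_real a \<notin> spectrum_on e X \<Longrightarrow> invertible_on e (X - a *\<^sub>R e)"
  by (simp add: spectrum_on_def op_scaleC_of_real)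

text \<open>m is the largest lower bound of the form relative to e. If X - m e were invertible,
  \<open>invertible_lower_bound\<close> would raise m by some \<delta>. For e = 0 every number is a
  lower bound and none is largest.\<close>

lemma min_in_spectrum:
  assumes X: "sa_on e X" and ne: "e \<noteq> 0"
  obtains m where "of_real m \<in> spectrum_on e X" "\<And>x. m * qform e x \<le> qform X x"
proof -
  note e = sa_onD(1)[OF X]
  obtain x0 where x0: "e x0 \<noteq> 0" using ne by (metis blinfun_eqI zero_blinfun.rep_eq)
  define S where "S = {a. \<forall>x. a * qform e x \<le> qform X x}"
  have "- norm X \<in> S"
    using form_in_norm[OF e sa_onD(2)[OF X]] by (auto simp: S_def form_in_def)
  then have S0: "S \<noteq> {}" by auto
  have pos: "qform e x0 > 0" using x0 by (simp add: projection_qform e)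
  have ub: "a \<le> qform X x / qform e x" if "a \<in> S" "qform e x > 0" for a x
    using that by (auto simp: S_def field_simps)
  then have bdd: "bdd_above S" using pos by (intro bdd_aboveI[of _ "qform X x0 / qform e x0"]) auto
  define m where "m = Sup S"
  have mS: "m \<in> S"
  proof -
    have "m * qform e x \<le> qform X x" for x
    proof (cases "qform e x > 0")
      case True
      then have "m \<le> qform X x / qform e x"
        unfolding m_def using ub S0 by (intro cSup_least) auto
      then show ?thesis using True by (simp add: field_simps)
    next
      case False
      then have "qform e x = 0" using qform_nonneg_projection[OF e, of x] by simp
      then show ?thesis using abs_qform_le_on[OF e sa_onD(2)[OF X], of x] by simp
    qed
    then show ?thesis by (simp add: S_def)
  qed
  have "of_real m \<in> spectrum_on e X"
  proof (rule ccontr)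
    assume "of_real m \<notin> spectrum_on e X"
    then have inv: "invertible_on e (X - m *\<^sub>R e)" by (rule invertible_on_of_real)
    have sa: "sa_on e (X - m *\<^sub>R e)"
      by (intro sa_on_diff X sa_on_scaleR sa_on_self e)
    obtain \<delta> where \<delta>: "\<delta> > 0" "\<And>x. \<delta> * qform e x \<le> qform (X - m *\<^sub>R e) x"
      using mS by (auto simp: S_def qform_simps intro: invertible_lower_bound[OF sa _ inv])
    then have "m + \<delta> \<in> S" by (auto simp: S_def qform_simps algebra_simps)
    then have "m + \<delta> \<le> m" unfolding m_def using bdd by (rule cSup_upper)
    then show False using \<delta> by simp
  qed
  then show ?thesis using mS that by (auto simp: S_def)
qed

lemma max_in_spectrum:
  assumes X: "sa_on e X" and ne: "e \<noteq> 0"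
  obtains m where "of_real m \<in> spectrum_on e X" "\<And>x. qform X x \<le> m * qform e x"
proof -
  note e = sa_onD(1)[OF X]
  obtain m where m: "of_real m \<in> spectrum_on e (- X)" "\<And>x. m * qform e x \<le> qform (- X) x"
    using min_in_spectrum[OF sa_on_minus[OF X] ne] by blast
  have "of_real (- m) \<in> spectrum_on e X"
  proof (rule ccontr)
    assume "of_real (- m) \<notin> spectrum_on e X"
    then have "invertible_on e (X + m *\<^sub>R e)"
      using invertible_on_of_real[of "- m" e X] by simp
    then have "invertible_on e (- X - m *\<^sub>R e)"
      using invertible_on_minus[of e "- X - m *\<^sub>R e"] e sa_onD[OF X]
      by (simp add: ops_on_diff ops_on_scaleR ops_on_self sa_onD(2)[OF sa_on_minus[OF X]] add.commute)
    then show False using m(1) by (simp add: spectrum_on_def op_scaleC_of_real)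
  qed
  moreover have "qform X x \<le> - m * qform e x" for x
    using m(2)[of x] by (simp add: qform_minus)
  ultimately show ?thesis by (rule that)
qed

text \<open>The extreme values of the form are themselves points of the spectrum, which is why they
  lie in \<open>J\<close> even when \<open>J\<close> is not closed.\<close>

lemma spectrum_in_form_in:
  assumes X: "sa_on e X" and ne: "e \<noteq> 0" and J: "spectrum_in e X J"
  obtains a b where "a \<in> J" "b \<in> J" "a \<le> b" "form_in e a b X"
proof -
  note e = sa_onD(1)[OF X]
  obtain a where a: "of_real a \<in> spectrum_on e X" "\<And>x. a * qform e x \<le> qform X x"
    using min_in_spectrum[OF X ne] by blast
  obtain b where b: "of_real b \<in> spectrum_on e X" "\<And>x. qform X x \<le> b * qform e x"
    using max_in_spectrum[OF X ne] by blast
  obtain x0 where x0: "e x0 \<noteq> 0" using ne by (metis blinfun_eqI zero_blinfun.rep_eq)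
  then have "qform e x0 > 0" by (simp add: projection_qform e)
  moreover have "a * qform e x0 \<le> b * qform e x0" using a(2) b(2) order_trans by blast
  ultimately have "a \<le> b" by simp
  moreover have "a \<in> J" "b \<in> J" using J a(1) b(1) by (auto simp: spectrum_in_def)
  ultimately show ?thesis using a b by (intro that) (auto simp: form_in_def)
qed

section \<open>Polynomials of an operator\<close>

lemma op_poly_altdef:
  assumes "degree p \<le> n"
  shows "op_poly e p X = (\<Sum>i\<le>n. coeff p i *\<^sub>R op_power e X i)"
  unfolding op_poly_def
  using assms by (intro sum.mono_neutral_left) (auto simp: coeff_eq_0)

lemma op_poly_0 [simp]: "op_poly e 0 X = 0"
  by (simp add: op_poly_def)

lemma op_poly_pCons: "op_poly e (pCons c p) X = c *\<^sub>R e + (X o\<^sub>L op_poly e p X)"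
proof -
  have "op_poly e (pCons c p) X = (\<Sum>i\<le>Suc (degree p). coeff (pCons c p) i *\<^sub>R op_power e X i)"
    by (rule op_poly_altdef) (rule degree_pCons_le)
  also have "\<dots> = c *\<^sub>R e + (\<Sum>i\<le>degree p. coeff p i *\<^sub>R (X o\<^sub>L op_power e X i))"
    by (subst sum.atMost_Suc_shift) simp
  finally show ?thesis
    by (simp add: op_poly_def blinfun_compose_sum_right blinfun_comp_simps)
qed

lemma op_poly_const: "op_poly e [:c:] X = c *\<^sub>R e"
  by (simp add: op_poly_pCons)

lemma op_poly_one: "op_poly e 1 X = e"
  by (simp add: one_pCons op_poly_const)

lemma op_poly_add: "op_poly e (p + q) X = op_poly e p X + op_poly e q X"
proof -
  let ?n = "max (degree p) (degree q)"
  have "op_poly e (p + q) X = (\<Sum>i\<le>?n. coeff (p + q) i *\<^sub>R op_power e X i)"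
    by (rule op_poly_altdef) (rule degree_add_le_max)
  then show ?thesis
    by (simp add: op_poly_altdef[of p ?n] op_poly_altdef[of q ?n] scaleR_add_left sum.distrib)
qed

lemma op_poly_smult: "op_poly e (smult c p) X = c *\<^sub>R op_poly e p X"
  using op_poly_altdef[OF degree_smult_le, of e c p X]
  by (simp add: op_poly_def scaleR_sum_right)

lemma op_poly_minus: "op_poly e (- p) X = - op_poly e p X"
  using op_poly_smult[of e "-1" p X] by simp

lemma op_poly_diff: "op_poly e (p - q) X = op_poly e p X - op_poly e q X"
  using op_poly_add[of e p "- q" X] by (simp add: op_poly_minus)

lemma op_poly_ops_on: "projection e \<Longrightarrow> X \<in> ops_on e \<Longrightarrow> op_poly e p X \<in> ops_on e"
  unfolding op_poly_def by (intro ops_on_sum ops_on_scaleR op_power_ops_on)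

lemma op_poly_mult:
  assumes "projection e" "X \<in> ops_on e"
  shows "op_poly e (p * q) X = op_poly e p X o\<^sub>L op_poly e q X"
proof (induction p)
  case (pCons c p)
  then show ?case
    using op_poly_ops_on[OF assms, of q]
    by (simp add: op_poly_add op_poly_smult op_poly_pCons blinfun_comp_simps ops_on_left assms
        blinfun_compose_assoc)
qed simp

lemma op_poly_X: "projection e \<Longrightarrow> X \<in> ops_on e \<Longrightarrow> op_poly e [:0, 1:] X = X"
  by (simp add: op_poly_pCons ops_on_right)

lemma op_power_selfadjoint: "sa_on e X \<Longrightarrow> selfadjoint (op_power e X n)"
  by (induction n)
    (auto simp: op_power_commute sa_onD projection_selfadjoint intro!: selfadjoint_compose_commute)

lemma op_poly_sa_on: "sa_on e X \<Longrightarrow> sa_on e (op_poly e p X)"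
  unfolding sa_on_def op_poly_def
  by (auto intro!: selfadjoint_sum selfadjoint_scaleR op_power_selfadjoint ops_on_sum ops_on_scaleR
      op_power_ops_on simp: sa_on_def)

section \<open>Spectral mapping for real polynomials\<close>

lemma map_poly_of_real_add:
  "map_poly of_real (p + q) = map_poly of_real p + (map_poly of_real q :: complex poly)"
  by (intro poly_eqI) (simp add: coeff_map_poly)

lemma map_poly_of_real_mult:
  "map_poly of_real (p * q) = map_poly of_real p * (map_poly of_real q :: complex poly)"
  by (intro poly_eqI) (simp add: coeff_map_poly coeff_mult)

text \<open>The remainder modulo the quadratic is linear with real coefficients and vanishes at a
  nonreal point, so it is 0. The factorisation stays real because \<open>op_poly\<close> takes real
  coefficients.\<close>

lemma real_poly_quadratic_factor:
  fixes q :: "real poly" and z :: complex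
  assumes z: "poly (map_poly of_real q) z = 0" and Im: "Im z \<noteq> 0"
  shows "[:(Re z)\<^sup>2 + (Im z)\<^sup>2, - 2 * Re z, 1:] dvd q"
proof -
  let ?d = "[:(Re z)\<^sup>2 + (Im z)\<^sup>2, - 2 * Re z, 1:]"
  have d: "poly (map_poly of_real ?d) z = 0"
    by (simp add: map_poly_pCons complex_eq_iff power2_eq_square algebra_simps)
  have "degree (q mod ?d) < degree ?d"
    using degree_mod_less[of ?d q] by auto
  then have "degree (q mod ?d) \<le> 1" by simp
  then obtain c0 c1 where r: "q mod ?d = [:c0, c1:]"
    by (metis One_nat_def degree1_coeffs degree_eq_zeroE le_SucE le_zero_eq pCons_0_0)
  have "q = q div ?d * ?d + [:c0, c1:]"
    using div_mult_mod_eq[of q ?d] r by simp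
  then have "map_poly of_real q = map_poly of_real (q div ?d) * map_poly of_real ?d
      + (map_poly of_real [:c0, c1:] :: complex poly)"
    by (metis map_poly_of_real_add map_poly_of_real_mult)
  then have "poly (map_poly of_real [:c0, c1:]) z = 0"
    using z d by simp
  then have "c1 = 0" "c0 = 0"
    using Im by (auto simp: map_poly_pCons complex_eq_iff)
  then show ?thesis using r by (simp add: dvd_eq_mod_eq_0)
qed

text \<open>One half of the spectral mapping theorem. A complex root z of q gives a real factor. For
  real z it is X - z e, invertible unless z is in the spectrum; otherwise it is (X - Re z e)^2 + (Im
  z)^2 e, which is coercive. So either a root is found in the spectrum or the failure of
  invertibility passes to the cofactor, of smaller degree.\<close>

lemma op_poly_not_invertible:
  assumes X: "sa_on e X" and ne: "e \<noteq> 0" and ninv: "\<not> invertible_on e (op_poly e q X)"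
  shows "\<exists>r. poly q r = 0 \<and> of_real r \<in> spectrum_on e X"
  using ninv
proof (induction "degree q" arbitrary: q rule: less_induct)
  case less
  note e = sa_onD(1)[OF X] and Xe = sa_onD(2)[OF X]
  show ?case
  proof (cases "degree q = 0")
    case True
    then obtain c where q: "q = [:c:]" by (metis degree_eq_zeroE)
    have "c = 0"
    proof (rule ccontr)
      assume "c \<noteq> 0"
      then have "invertible_on e (op_poly e q X)"
        using e by (intro invertible_onI[of "(1 / c) *\<^sub>R e"])
          (auto simp: q op_poly_const blinfun_comp_simps projection_idem intro: ops_on_scaleR ops_on_self)
      then show False using less.prems by simp
    qed
    \<comment> \<open>q is the zero polynomial here, so any point of the nonempty spectrum is a
      root.\<close>
    then show ?thesis using min_in_spectrum[OF X ne] q by (metis poly_0 pCons_0_0)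
  next
    case False
    have "\<not> constant (poly (map_poly complex_of_real q))"
      using False by (simp add: constant_degree degree_map_poly)
    then obtain z where z: "poly (map_poly complex_of_real q) z = 0"
      using fundamental_theorem_of_algebra by blast
    show ?thesis
    proof (cases "Im z = 0")
      case True
      then have zr: "z = of_real (Re z)" by (simp add: complex_eq_iff)
      have "poly (map_poly complex_of_real q) (of_real r) = of_real (poly q r)" for r
        by (induction q) (simp_all add: map_poly_pCons)
      then have "poly q (Re z) = 0" using z zr by (metis of_real_eq_0_iff)
      then obtain q' where q': "q = [:- Re z, 1:] * q'"
        by (metis dvdE poly_eq_0_iff_dvd)
      show ?thesis
      proof (cases "of_real (Re z) \<in> spectrum_on e X")
        case True
        then show ?thesis using \<open>poly q (Re z) = 0\<close> by blast
      next
        case nspec: False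
        have "op_poly e [:- Re z, 1:] X = X - Re z *\<^sub>R e"
          by (simp add: op_poly_pCons ops_on_right[OF e Xe])
        then have "invertible_on e (op_poly e [:- Re z, 1:] X)"
          using invertible_on_of_real[OF nspec] by simp
        then have "\<not> invertible_on e (op_poly e q' X)"
          using less.prems invertible_on_compose[OF e _ _ op_poly_ops_on[OF e Xe] op_poly_ops_on[OF e Xe]]
          by (metis q' op_poly_mult[OF e Xe])
        moreover have "q' \<noteq> 0" using q' False by auto
        then have "degree q' < degree q" by (simp only: q') (subst degree_mult_eq, auto)
        ultimately show ?thesis using less.hyps unfolding q' poly_mult mult_eq_0_iff by blast
      qed
    next
      case Im: False
      let ?d = "[:(Re z)\<^sup>2 + (Im z)\<^sup>2, - 2 * Re z, 1:]"
      obtain q' where q': "q = ?d * q'"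
        using real_poly_quadratic_factor[OF z Im] by (metis dvdE)
      let ?Y = "X - Re z *\<^sub>R e"
      have Y: "sa_on e ?Y" by (intro sa_on_diff sa_on_scaleR sa_on_self X e)
      have d: "op_poly e ?d X = (?Y o\<^sub>L ?Y) + (Im z)\<^sup>2 *\<^sub>R e"
        by (simp add: op_poly_pCons ops_on_right[OF e Xe] ops_on_left[OF e Xe] blinfun_comp_simps
            projection_idem[OF e] power2_eq_square algebra_simps flip: scaleR_add_left)
      have "qform (?Y o\<^sub>L ?Y) x \<ge> 0" for x
        using selfadjoint_cinner[OF sa_onD(3)[OF Y], of "?Y x" x]
        by (simp only: qform_def blinfun_apply_blinfun_compose Re_cinner_same zero_le_power2)
      then have "(Im z)\<^sup>2 * qform e x \<le> qform (op_poly e ?d X) x" for x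
        unfolding d by (simp add: qform_simps)
      then have "invertible_on e (op_poly e ?d X)"
        using Im by (intro coercive_invertible_on[of e _ "(Im z)\<^sup>2"] e op_poly_ops_on Xe) auto
      then have "\<not> invertible_on e (op_poly e q' X)"
        using less.prems invertible_on_compose[OF e _ _ op_poly_ops_on[OF e Xe] op_poly_ops_on[OF e Xe]]
        by (metis q' op_poly_mult[OF e Xe])
      moreover have "q' \<noteq> 0" using q' False by auto
      then have "degree q' < degree q" by (simp only: q') (subst degree_mult_eq, auto)
      ultimately show ?thesis using less.hyps unfolding q' poly_mult mult_eq_0_iff by blast
    qed
  qed
qed

text \<open>The least value m of the form of p(X) lies in the spectrum of p(X), so p - m has a root
  r in the spectrum of X and m = p(r) is nonnegative.\<close>

lemma op_poly_nonneg:
  assumes X: "sa_on e X" and p: "\<And>r. of_real r \<in> spectrum_on e X \<Longrightarrow> 0 \<le> poly p r"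
  shows "0 \<le> qform (op_poly e p X) x"
proof (cases "e = 0")
  case True
  then have "op_poly e p X = 0"
    using sa_onD(2)[OF op_poly_sa_on[OF X, of p]] by (simp add: ops_on_def)
  then show ?thesis by simp
next
  case False
  note e = sa_onD(1)[OF X]
  obtain m where m: "of_real m \<in> spectrum_on e (op_poly e p X)"
    "\<And>x. m * qform e x \<le> qform (op_poly e p X) x"
    using min_in_spectrum[OF op_poly_sa_on[OF X] False] by blast
  have "op_poly e (p - [:m:]) X = op_poly e p X - m *\<^sub>R e"
    by (simp add: op_poly_diff op_poly_const)
  then have "\<not> invertible_on e (op_poly e (p - [:m:]) X)"
    using m(1) by (simp add: spectrum_on_def op_scaleC_of_real)
  then obtain r where "poly (p - [:m:]) r = 0" "of_real r \<in> spectrum_on e X"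
    using op_poly_not_invertible[OF X False] by blast
  then have "m \<ge> 0" using p by auto
  then have "0 \<le> m * qform e x" using qform_nonneg_projection[OF e] by simp
  also have "\<dots> \<le> qform (op_poly e p X) x" by (rule m)
  finally show ?thesis .
qed

lemma op_poly_form_in:
  assumes X: "sa_on e X"
    and p: "\<And>r. of_real r \<in> spectrum_on e X \<Longrightarrow> poly p r \<in> {a..b}"
  shows "form_in e a b (op_poly e p X)"
proof -
  have "0 \<le> qform (op_poly e (p - [:a:]) X) x" "0 \<le> qform (op_poly e ([:b:] - p) X) x" for x
    using p by (auto intro!: op_poly_nonneg[OF X])
  then show ?thesis
    by (simp add: form_in_def op_poly_diff op_poly_const qform_simps)
qed

lemma op_poly_norm_le:
  assumes X: "sa_on e X" and c: "0 \<le> c"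
    and p: "\<And>r. of_real r \<in> spectrum_on e X \<Longrightarrow> \<bar>poly p r\<bar> \<le> c"
  shows "norm (op_poly e p X) \<le> c"
proof (rule norm_le_form_in[OF op_poly_sa_on[OF X] _ c])
  show "form_in e (- c) c (op_poly e p X)"
    using p by (intro op_poly_form_in[OF X]) (auto simp: abs_le_iff minus_le_iff)
qed

section \<open>Bernstein approximation on an interval\<close>

text \<open>The Bernstein basis transported affinely from [0, 1] to [a, b], kept as a polynomial so
  that a map defined only on polynomials can be applied to it.\<close>

definition bernstein_poly :: "real \<Rightarrow> real \<Rightarrow> nat \<Rightarrow> nat \<Rightarrow> real poly" where
  "bernstein_poly a b n k =
     smult (real (n choose k)) ([:- a / (b - a), 1 / (b - a):] ^ k * [:b / (b - a), - 1 / (b - a):] ^ (n - k))"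

definition bernstein_approx :: "(real \<Rightarrow> real) \<Rightarrow> real \<Rightarrow> real \<Rightarrow> nat \<Rightarrow> real poly" where
  "bernstein_approx f a b n = (\<Sum>k\<le>n. smult (f (a + (b - a) * (k / n))) (bernstein_poly a b n k))"

lemma poly_bernstein_poly:
  assumes "a < b"
  shows "poly (bernstein_poly a b n k) x = Bernstein n k ((x - a) / (b - a))"
proof -
  have "1 - (x - a) / (b - a) = (b - x) / (b - a)"
    using assms by (simp add: field_simps)
  moreover have "poly [:- a / (b - a), 1 / (b - a):] x = (x - a) / (b - a)"
    "poly [:b / (b - a), - 1 / (b - a):] x = (b - x) / (b - a)"
    by (simp_all add: diff_divide_distrib)
  ultimately show ?thesis
    by (simp only: bernstein_poly_def Bernstein_def poly_smult poly_mult poly_power mult.assoc)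
qed

lemma poly_bernstein_approx:
  assumes "a < b"
  shows "poly (bernstein_approx f a b n) x =
    (\<Sum>k\<le>n. f (a + (b - a) * (k / n)) * Bernstein n k ((x - a) / (b - a)))"
  by (simp add: bernstein_approx_def poly_sum poly_bernstein_poly[OF assms])

lemma bernstein_poly_sum:
  assumes "a < b"
  shows "(\<Sum>k\<le>n. bernstein_poly a b n k) = 1"
proof -
  have "poly (\<Sum>k\<le>n. bernstein_poly a b n k) x = poly 1 x" for x
    by (simp add: poly_sum poly_bernstein_poly[OF assms])
  then show ?thesis by (intro poly_eq_poly_eq_iff[THEN iffD1] ext)
qed

text \<open>Exactness for the identity is what writes L(x) as a sum of nodes times positive
  operators with no error term, the shape that \<open>povm_jensen\<close> treats.\<close>

lemma bernstein_approx_id: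
  assumes "a < b" "n > 0"
  shows "bernstein_approx (\<lambda>x. x) a b n = [:0, 1:]"
proof -
  have "poly (bernstein_approx (\<lambda>x. x) a b n) x = poly [:0, 1:] x" for x
  proof -
    let ?s = "(x - a) / (b - a)"
    have "poly (bernstein_approx (\<lambda>x. x) a b n) x
        = (\<Sum>k\<le>n. a * Bernstein n k ?s + (b - a) / n * (real k * Bernstein n k ?s))"
      by (simp add: poly_bernstein_approx[OF assms(1)] algebra_simps)
    also have "\<dots> = a * (\<Sum>k\<le>n. Bernstein n k ?s) + (b - a) / n * (\<Sum>k\<le>n. real k * Bernstein n k ?s)"
      by (simp only: sum.distrib sum_distrib_left)
    also have "\<dots> = x"
      using assms by simp
    finally show ?thesis by simp
  qed
  then show ?thesis by (intro poly_eq_poly_eq_iff[THEN iffD1] ext)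
qed

lemma bernstein_approx_uniform:
  fixes f :: "real \<Rightarrow> real"
  assumes f: "continuous_on {a..b} f" and ab: "a < b"
  shows "uniform_limit {a..b} (\<lambda>n. poly (bernstein_approx f a b n)) f sequentially"
proof (rule uniform_limitI)
  fix \<epsilon> :: real assume \<epsilon>: "\<epsilon> > 0"
  let ?g = "\<lambda>s. f (a + (b - a) * s)"
  have "(\<lambda>s. a + (b - a) * s) ` {0..1} \<subseteq> {a..b}"
  proof (rule image_subsetI)
    fix s :: real assume "s \<in> {0..1}"
    then have "(b - a) * s \<le> b - a" "0 \<le> (b - a) * s"
      using ab by (auto intro!: mult_left_le mult_nonneg_nonneg)
    then show "a + (b - a) * s \<in> {a..b}" by (simp add: le_diff_eq add.commute)
  qed
  then have "continuous_on {0..1} ?g"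
    by (intro continuous_on_compose2[OF f]) (auto intro!: continuous_intros)
  from Bernstein_Weierstrass[OF this \<epsilon>] obtain N where
    N: "\<And>n s. N \<le> n \<Longrightarrow> s \<in> {0..1} \<Longrightarrow> \<bar>?g s - (\<Sum>k\<le>n. ?g (k / n) * Bernstein n k s)\<bar> < \<epsilon>"
    by blast
  have "dist (poly (bernstein_approx f a b n) x) (f x) < \<epsilon>" if "n \<ge> N" "x \<in> {a..b}" for n x
  proof -
    have "(x - a) / (b - a) \<in> {0..1}" "a + (b - a) * ((x - a) / (b - a)) = x"
      using that ab by (auto simp: field_simps)
    then show ?thesis
      using N[OF that(1), of "(x - a) / (b - a)"]
      by (simp add: poly_bernstein_approx[OF ab] dist_real_def abs_minus_commute)
  qed
  then show "\<forall>\<^sub>F n in sequentially. \<forall>x\<in>{a..b}. dist (poly (bernstein_approx f a b n) x) (f x) < \<epsilon>"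
    unfolding eventually_sequentially by blast
qed

lemma polynomial_approximation:
  fixes f :: "real \<Rightarrow> real"
  assumes f: "continuous_on {a..b} f"
  obtains p where "uniform_limit {a..b} (\<lambda>n. poly (p n)) f sequentially"
proof (cases "a < b")
  case True
  show ?thesis by (rule that[OF bernstein_approx_uniform[OF f True]])
next
  case False
  \<comment> \<open>The interval contains at most the point a.\<close>
  have "uniform_limit {a..b} (\<lambda>n. poly [:f a:]) f sequentially"
  proof (rule uniform_limitI)
    fix \<epsilon> :: real assume "\<epsilon> > 0"
    moreover have "x = a" if "x \<in> {a..b}" for x using False that by simp
    ultimately have "\<forall>x\<in>{a..b}. dist (poly [:f a:] x) (f x) < \<epsilon>" by fastforce
    then show "\<forall>\<^sub>F n in sequentially. \<forall>x\<in>{a..b}. dist (poly [:f a:] x) (f x) < \<epsilon>"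
      by simp
  qed
  then show ?thesis by (rule that)
qed

lemma polynomial_approximation_eps:
  fixes f :: "real \<Rightarrow> real"
  assumes f: "continuous_on {a..b} f" and "\<epsilon> > 0"
  obtains p where "\<And>x. x \<in> {a..b} \<Longrightarrow> \<bar>poly p x - f x\<bar> \<le> \<epsilon>"
proof -
  obtain p where "uniform_limit {a..b} (\<lambda>n. poly (p n)) f sequentially"
    using polynomial_approximation[OF f] .
  from uniform_limitD[OF this assms(2)] obtain n where "\<forall>x\<in>{a..b}. dist (poly (p n) x) (f x) < \<epsilon>"
    by (auto simp: eventually_sequentially)
  then show ?thesis by (intro that[of "p n"]) (simp add: dist_real_def less_imp_le)
qed

section \<open>Functional calculus on an interval containing the spectrum\<close>

lemma op_poly_dist_le:
  assumes "sa_on e X" "0 \<le> c" "\<And>r. of_real r \<in> spectrum_on e X \<Longrightarrow> \<bar>poly p r - poly q r\<bar> \<le> c"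
  shows "norm (op_poly e p X - op_poly e q X) \<le> c"
  using op_poly_norm_le[of e X c "p - q"] assms by (simp add: op_poly_diff)

lemma form_in_spectrum_real:
  assumes "sa_on e X" "form_in e a b X" "of_real r \<in> spectrum_on e X"
  shows "r \<in> {a..b}"
proof -
  have "complex_of_real r \<in> of_real ` {a..b}"
    using form_in_spectrum[OF assms(1,2)] assms(3) by blast
  then show ?thesis by (auto simp only: image_iff of_real_eq_iff)
qed

text \<open>Uniform convergence on the spectrum suffices: this is what makes the limit that defines
  \<^const>\<open>cfc_on\<close> unique, although the theorem is only used with an interval around the spectrum.\<close>

lemma op_poly_limits_agree:
  assumes X: "sa_on e X"
    and p: "uniform_limit {r. of_real r \<in> spectrum_on e X} (\<lambda>n. poly (p n)) f sequentially"
    and q: "uniform_limit {r. of_real r \<in> spectrum_on e X} (\<lambda>n. poly (q n)) f sequentially"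
  shows "(\<lambda>n. op_poly e (p n) X - op_poly e (q n) X) \<longlonglongrightarrow> 0"
proof (rule LIMSEQ_I)
  fix \<epsilon> :: real assume "\<epsilon> > 0"
  then have \<epsilon>: "\<epsilon> / 4 > 0" by simp
  have "\<forall>\<^sub>F n in sequentially. norm (op_poly e (p n) X - op_poly e (q n) X - 0) < \<epsilon>"
    using uniform_limitD[OF p \<epsilon>] uniform_limitD[OF q \<epsilon>]
  proof eventually_elim
    case (elim n)
    have "norm (op_poly e (p n) X - op_poly e (q n) X) \<le> \<epsilon> / 2"
    proof (rule op_poly_dist_le[OF X])
      fix r assume r: "of_real r \<in> spectrum_on e X"
      have "dist (poly (p n) r) (f r) < \<epsilon> / 4" "dist (poly (q n) r) (f r) < \<epsilon> / 4"
        using elim r by auto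
      then show "\<bar>poly (p n) r - poly (q n) r\<bar> \<le> \<epsilon> / 2"
        unfolding dist_real_def by linarith
    qed (use \<epsilon> in auto)
    then show ?case using \<epsilon> by simp
  qed
  then show "\<exists>N. \<forall>n\<ge>N. norm (op_poly e (p n) X - op_poly e (q n) X - 0) < \<epsilon>"
    by (simp add: eventually_sequentially)
qed

text \<open>The norm of p(X) is at most the supremum of p over the spectrum, so uniformly convergent
  polynomials give a Cauchy sequence; \<open>op_poly_limits_agree\<close> makes its limit the only
  candidate in the definite description. From here on any interval with form bounds replaces the
  spectrum.\<close>

lemma cfc_on_tendsto:
  assumes X: "sa_on e X" and ab: "form_in e a b X"
    and p: "uniform_limit {a..b} (\<lambda>n. poly (p n)) f sequentially"
  shows "(\<lambda>n. op_poly e (p n) X) \<longlonglongrightarrow> cfc_on e f X"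
proof -
  let ?S = "{r. of_real r \<in> spectrum_on e X}"
  have S: "?S \<subseteq> {a..b}" using form_in_spectrum_real[OF X ab] by auto
  have pS: "uniform_limit ?S (\<lambda>n. poly (p n)) f sequentially"
    by (rule uniform_limit_on_subset[OF p S])
  have "Cauchy (\<lambda>n. op_poly e (p n) X)"
  proof (rule CauchyI)
    fix \<epsilon> :: real assume "\<epsilon> > 0"
    then have \<epsilon>: "\<epsilon> / 4 > 0" by simp
    obtain N where N: "\<And>n r. n \<ge> N \<Longrightarrow> r \<in> ?S \<Longrightarrow> dist (poly (p n) r) (f r) < \<epsilon> / 4"
      using uniform_limitD[OF pS \<epsilon>] by (auto simp: eventually_sequentially)
    have "norm (op_poly e (p m) X - op_poly e (p n) X) \<le> \<epsilon> / 2" if "m \<ge> N" "n \<ge> N" for m n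
    proof (rule op_poly_dist_le[OF X])
      fix r assume "of_real r \<in> spectrum_on e X"
      then have "dist (poly (p m) r) (f r) < \<epsilon> / 4" "dist (poly (p n) r) (f r) < \<epsilon> / 4"
        using N that by auto
      then show "\<bar>poly (p m) r - poly (p n) r\<bar> \<le> \<epsilon> / 2"
        unfolding dist_real_def by linarith
    qed (use \<epsilon> in auto)
    moreover have "\<epsilon> / 2 < \<epsilon>" using \<open>\<epsilon> > 0\<close> by simp
    ultimately show "\<exists>M. \<forall>m\<ge>M. \<forall>n\<ge>M. norm (op_poly e (p m) X - op_poly e (p n) X) < \<epsilon>"
      by (intro exI[of _ N] allI impI) (rule le_less_trans)
  qed
  then obtain Y where Y: "(\<lambda>n. op_poly e (p n) X) \<longlonglongrightarrow> Y"
    unfolding Cauchy_convergent_iff convergent_def by (rule exE)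
  have "cfc_on e f X = Y"
    unfolding cfc_on_def
  proof (rule the_equality)
    show "\<exists>p. uniform_limit ?S (\<lambda>n. poly (p n)) f sequentially \<and> (\<lambda>n. op_poly e (p n) X) \<longlonglongrightarrow> Y"
      using pS Y by blast
  next
    fix Y' assume "\<exists>q. uniform_limit ?S (\<lambda>n. poly (q n)) f sequentially \<and> (\<lambda>n. op_poly e (q n) X) \<longlonglongrightarrow> Y'"
    then obtain q where q: "uniform_limit ?S (\<lambda>n. poly (q n)) f sequentially"
      "(\<lambda>n. op_poly e (q n) X) \<longlonglongrightarrow> Y'" by blast
    have "(\<lambda>n. op_poly e (q n) X - op_poly e (p n) X) \<longlonglongrightarrow> Y' - Y"
      by (intro tendsto_diff q Y)
    then have "Y' - Y = 0"
      using op_poly_limits_agree[OF X q(1) pS] LIMSEQ_unique by blast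
    then show "Y' = Y" by simp
  qed
  then show ?thesis using Y by simp
qed

lemma cfc_on_eqI:
  assumes "sa_on e X" "form_in e a b X"
    "uniform_limit {a..b} (\<lambda>n. poly (p n)) f sequentially" "(\<lambda>n. op_poly e (p n) X) \<longlonglongrightarrow> Y"
  shows "cfc_on e f X = Y"
  using cfc_on_tendsto[OF assms(1-3)] assms(4) LIMSEQ_unique by blast

lemma cfc_on_sa:
  assumes "sa_on e X" "form_in e a b X" "continuous_on {a..b} f"
  shows "sa_on e (cfc_on e f X)"
proof -
  obtain p where p: "uniform_limit {a..b} (\<lambda>n. poly (p n)) f sequentially"
    using polynomial_approximation[OF assms(3)] .
  show ?thesis
    by (rule sa_on_limit[OF cfc_on_tendsto[OF assms(1,2) p] op_poly_sa_on[OF assms(1)]])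
qed

lemma cfc_on_poly_dist_le:
  assumes X: "sa_on e X" "form_in e a b X" and f: "continuous_on {a..b} f" and c: "0 \<le> c"
    and p: "\<And>x. x \<in> {a..b} \<Longrightarrow> \<bar>poly p x - f x\<bar> \<le> c"
  shows "norm (cfc_on e f X - op_poly e p X) \<le> c"
proof (rule field_le_epsilon)
  fix \<epsilon> :: real assume \<epsilon>: "\<epsilon> > 0"
  obtain q where q: "uniform_limit {a..b} (\<lambda>n. poly (q n)) f sequentially"
    using polynomial_approximation[OF f] .
  have "\<forall>\<^sub>F n in sequentially. norm (op_poly e (q n) X - op_poly e p X) \<le> c + \<epsilon>"
    using uniform_limitD[OF q \<epsilon>]
  proof eventually_elim
    case (elim n)
    show ?case
    proof (rule op_poly_dist_le[OF X(1)])
      fix r assume "of_real r \<in> spectrum_on e X"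
      then have r: "r \<in> {a..b}" by (rule form_in_spectrum_real[OF X])
      then have "dist (poly (q n) r) (f r) < \<epsilon>" using elim by blast
      then show "\<bar>poly (q n) r - poly p r\<bar> \<le> c + \<epsilon>"
        using p[OF r] by (simp add: dist_real_def)
    qed (use c \<epsilon> in auto)
  qed
  moreover have "(\<lambda>n. norm (op_poly e (q n) X - op_poly e p X)) \<longlonglongrightarrow> norm (cfc_on e f X - op_poly e p X)"
    by (intro tendsto_intros cfc_on_tendsto[OF X q])
  ultimately show "norm (cfc_on e f X - op_poly e p X) \<le> c + \<epsilon>"
    by (intro tendsto_upperbound[of _ _ sequentially]) auto
qed

lemma cfc_on_qform_dist_le:
  assumes X: "sa_on e X" "form_in e a b X" and f: "continuous_on {a..b} f" and c: "0 \<le> c"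
    and p: "\<And>x. x \<in> {a..b} \<Longrightarrow> \<bar>poly p x - f x\<bar> \<le> c"
  shows "\<bar>qform (cfc_on e f X) x - qform (op_poly e p X) x\<bar> \<le> c * (norm x)\<^sup>2"
proof -
  have "\<bar>qform (cfc_on e f X - op_poly e p X) x\<bar> \<le> norm (cfc_on e f X - op_poly e p X) * (norm x)\<^sup>2"
    by (rule abs_qform_le)
  also have "\<dots> \<le> c * (norm x)\<^sup>2"
    by (intro mult_right_mono cfc_on_poly_dist_le[OF assms]) auto
  finally show ?thesis by (simp add: qform_simps)
qed

lemma cfc_on_cong:
  assumes "sa_on e X" "form_in e a b X" "continuous_on {a..b} f" "\<And>x. x \<in> {a..b} \<Longrightarrow> f x = g x"
  shows "cfc_on e f X = cfc_on e g X"
proof -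
  obtain p where p: "uniform_limit {a..b} (\<lambda>n. poly (p n)) f sequentially"
    using polynomial_approximation[OF assms(3)] .
  then have "uniform_limit {a..b} (\<lambda>n. poly (p n)) g sequentially"
    using assms(4) by (simp add: uniform_limit_iff)
  then show ?thesis
    using cfc_on_tendsto[OF assms(1,2) p] by (intro cfc_on_eqI[OF assms(1,2), symmetric])
qed

lemma cfc_on_poly:
  assumes "sa_on e X" "form_in e a b X"
  shows "cfc_on e (poly p) X = op_poly e p X"
  by (rule cfc_on_eqI[OF assms, of "\<lambda>_. p"]) (auto intro: uniform_limit_const)

lemma cfc_on_mult:
  assumes X: "sa_on e X" "form_in e a b X" and fg: "continuous_on {a..b} f" "continuous_on {a..b} g"
  shows "cfc_on e (\<lambda>x. f x * g x) X = cfc_on e f X o\<^sub>L cfc_on e g X"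
proof -
  obtain p where p: "uniform_limit {a..b} (\<lambda>n. poly (p n)) f sequentially"
    using polynomial_approximation[OF fg(1)] .
  obtain q where q: "uniform_limit {a..b} (\<lambda>n. poly (q n)) g sequentially"
    using polynomial_approximation[OF fg(2)] .
  have bdd: "bounded (f ` {a..b})" "bounded (g ` {a..b})"
    using fg by (auto intro!: compact_imp_bounded compact_continuous_image)
  have "uniform_limit {a..b} (\<lambda>n. poly (p n * q n)) (\<lambda>x. f x * g x) sequentially"
    using uniform_lim_mult[OF p q bdd] by (simp only: uniform_limit_iff poly_mult)
  moreover have "(\<lambda>n. op_poly e (p n * q n) X) \<longlonglongrightarrow> (cfc_on e f X o\<^sub>L cfc_on e g X)"
    unfolding op_poly_mult[OF sa_onD(1,2)[OF X(1)]]
    by (intro tendsto_intros cfc_on_tendsto[OF X] p q)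
  ultimately show ?thesis by (rule cfc_on_eqI[OF X])
qed

lemma tendsto_op_poly:
  assumes "X \<longlonglongrightarrow> Y"
  shows "(\<lambda>n. op_poly e p (X n)) \<longlonglongrightarrow> op_poly e p Y"
proof -
  have "(\<lambda>n. op_power e (X n) i) \<longlonglongrightarrow> op_power e Y i" for i
    by (induction i) (auto intro!: tendsto_intros assms)
  then show ?thesis
    unfolding op_poly_def by (intro tendsto_sum tendsto_scaleR tendsto_const)
qed

lemma form_in_limit:
  assumes "X \<longlonglongrightarrow> Y" "\<forall>\<^sub>F n in sequentially. form_in e a b (X n)"
  shows "form_in e a b Y"
proof -
  have *: "(\<lambda>n. qform (X n) x) \<longlonglongrightarrow> qform Y x" for x
    by (rule tendsto_qform[OF assms(1)])
  have "\<forall>\<^sub>F n in sequentially. a * qform e x \<le> qform (X n) x"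
    "\<forall>\<^sub>F n in sequentially. qform (X n) x \<le> b * qform e x" for x
    using assms(2) by (eventually_elim, auto simp: form_in_def)+
  then show ?thesis
    unfolding form_in_def
    by (intro allI conjI tendsto_lowerbound[OF *] tendsto_upperbound[OF *] trivial_limit_sequentially)
qed

text \<open>A single polynomial near f on [a, b] serves the limit and all large n at once, and
  polynomials of an operator are norm continuous. Hence the demand for one common interval.\<close>

lemma tendsto_cfc_on:
  assumes XY: "X \<longlonglongrightarrow> Y" and X: "\<And>n. sa_on e (X n)"
    and ab: "\<forall>\<^sub>F n in sequentially. form_in e a b (X n)" and f: "continuous_on {a..b} f"
  shows "(\<lambda>n. cfc_on e f (X n)) \<longlonglongrightarrow> cfc_on e f Y"
proof (rule LIMSEQ_I)
  fix \<epsilon> :: real assume \<epsilon>: "\<epsilon> > 0"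
  have Y: "sa_on e Y" "form_in e a b Y"
    using sa_on_limit[OF XY X] form_in_limit[OF XY ab] by auto
  obtain p where p: "\<And>x. x \<in> {a..b} \<Longrightarrow> \<bar>poly p x - f x\<bar> \<le> \<epsilon> / 4"
    using polynomial_approximation_eps[OF f, of "\<epsilon> / 4"] \<epsilon> by auto
  have "\<forall>\<^sub>F n in sequentially. norm (op_poly e p (X n) - op_poly e p Y) < \<epsilon> / 4"
    using tendstoD[OF tendsto_op_poly[OF XY, of e p], of "\<epsilon> / 4"] \<epsilon> by (simp add: dist_norm)
  then have "\<forall>\<^sub>F n in sequentially. norm (cfc_on e f (X n) - cfc_on e f Y) < \<epsilon>"
    using ab
  proof eventually_elim
    case (elim n)
    have "norm (cfc_on e f (X n) - op_poly e p (X n)) \<le> \<epsilon> / 4" "norm (cfc_on e f Y - op_poly e p Y) \<le> \<epsilon> / 4"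
      by (rule cfc_on_poly_dist_le[OF X elim(2) f _ p] cfc_on_poly_dist_le[OF Y f _ p];
          use \<epsilon> in simp)+
    moreover have "norm (cfc_on e f (X n) - cfc_on e f Y) \<le>
        norm (cfc_on e f (X n) - op_poly e p (X n)) + norm (op_poly e p (X n) - op_poly e p Y)
        + norm (cfc_on e f Y - op_poly e p Y)"
      using norm_triangle_ineq[of "cfc_on e f (X n) - op_poly e p (X n)" "op_poly e p (X n) - op_poly e p Y"]
        norm_triangle_ineq4[of "cfc_on e f (X n) - op_poly e p Y" "cfc_on e f Y - op_poly e p Y"]
      by simp
    ultimately show ?case
      using elim(1) \<epsilon> by linarith
  qed
  then show "\<exists>N. \<forall>n\<ge>N. norm (cfc_on e f (X n) - cfc_on e f Y) < \<epsilon>"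
    by (simp add: eventually_sequentially)
qed

text \<open>Invertibility moves the form bounds to some [\<delta>, norm D] with \<delta> > 0. There
  every real power is continuous, and products of powers are computed by
  \<open>cfc_on_mult\<close>.\<close>

lemma op_powr_half:
  assumes D: "selfadjoint D" "\<And>x. 0 \<le> qform D x" and inv: "invertible_op D"
  shows "selfadjoint (op_powr D (1/2))" "selfadjoint (op_powr D (-1/2))"
    "op_powr D (1/2) o\<^sub>L op_powr D (1/2) = D"
    "op_powr D (1/2) o\<^sub>L op_powr D (-1/2) = id_blinfun"
    "op_powr D (-1/2) o\<^sub>L op_powr D (1/2) = id_blinfun"
proof -
  have sa: "sa_on id_blinfun D" using D by (simp add: sa_on_id)
  obtain \<delta> where \<delta>: "\<delta> > 0" "\<And>x. \<delta> * qform id_blinfun x \<le> qform D x"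
    using invertible_lower_bound[OF sa D(2) inv] by blast
  then have bd: "form_in id_blinfun \<delta> (norm D) D"
    using form_in_norm[of id_blinfun D] sa_onD(2)[OF sa] by (auto simp: form_in_def)
  note X = sa bd
  have cont: "continuous_on {\<delta>..norm D} (\<lambda>x. x powr s)" for s
    using \<delta> by (intro continuous_intros) auto
  show "selfadjoint (op_powr D (1/2))" "selfadjoint (op_powr D (-1/2))"
    using cfc_on_sa[OF X cont] unfolding op_powr_def sa_on_id by blast+
  \<comment> \<open>The products needed equal the polynomials x and 1 on positive numbers, where the
    calculus can be evaluated.\<close>
  have mult: "op_powr D s o\<^sub>L op_powr D t = cfc (poly p) D"
    if "\<And>x. x > 0 \<Longrightarrow> x powr s * x powr t = poly p x" for s t p
    unfolding op_powr_def cfc_on_mult[OF X cont cont, symmetric]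
    using that \<delta> by (intro cfc_on_cong[OF X]) (auto intro!: continuous_intros cont)
  show "op_powr D (1/2) o\<^sub>L op_powr D (1/2) = D"
    by (subst mult[of _ _ "[:0, 1:]"])
      (simp_all add: cfc_on_poly[OF X] op_poly_X sa_onD[OF sa] flip: powr_add)
  show "op_powr D (1/2) o\<^sub>L op_powr D (-1/2) = id_blinfun"
    "op_powr D (-1/2) o\<^sub>L op_powr D (1/2) = id_blinfun"
    by (subst mult[of _ _ 1]; simp add: cfc_on_poly[OF X] op_poly_one flip: powr_add)+
qed

section \<open>Gram-Schmidt and finite rank projections\<close>

definition orthonormal_on :: "'i set \<Rightarrow> ('i \<Rightarrow> 'h::chilbert) \<Rightarrow> bool" where
  "orthonormal_on I w \<longleftrightarrow> (\<forall>i\<in>I. \<forall>j\<in>I. cinner (w i) (w j) = (if i = j then 1 else 0))"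

definition fin_proj :: "'i set \<Rightarrow> ('i \<Rightarrow> 'h::chilbert) \<Rightarrow> 'h \<Rightarrow>\<^sub>L 'h" where
  "fin_proj I w = Blinfun (\<lambda>x. \<Sum>i\<in>I. cinner x (w i) *\<^sub>C w i)"

lemma bounded_linear_rank_one: "bounded_linear (\<lambda>x :: 'h::chilbert. cinner x v *\<^sub>C w)"
proof (rule bounded_linear_intro[of _ "norm v * norm w"])
  fix x :: 'h
  have "norm (cinner x v *\<^sub>C w) = cmod (cinner x v) * norm w" by (rule norm_scaleC)
  also have "\<dots> \<le> (norm x * norm v) * norm w" by (intro mult_right_mono cauchy_schwarz) simp
  finally show "norm (cinner x v *\<^sub>C w) \<le> norm x * (norm v * norm w)" by (simp add: mult.assoc)
qed (simp_all add: cinner_add_left scaleC_add_left cinner_scaleR_left scaleC_of_real flip: scaleC_scaleC)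

lemma fin_proj_apply: "fin_proj I w x = (\<Sum>i\<in>I. cinner x (w i) *\<^sub>C w i)"
  unfolding fin_proj_def
  by (subst bounded_linear_Blinfun_apply) (auto intro!: bounded_linear_sum bounded_linear_rank_one)

lemma cinner_orthonormal_sum:
  assumes "orthonormal_on I w" "finite I" "j \<in> I"
  shows "cinner (\<Sum>i\<in>I. c i *\<^sub>C w i) (w j) = c j"
proof -
  have "cinner (\<Sum>i\<in>I. c i *\<^sub>C w i) (w j) = (\<Sum>i\<in>I. if i = j then c i else 0)"
    unfolding cinner.sum_left cinner_scaleC_left
    using assms by (intro sum.cong) (auto simp: orthonormal_on_def)
  then show ?thesis using assms by simp
qed

lemma projection_fin_proj:
  assumes "orthonormal_on I w" "finite I"
  shows "projection (fin_proj I w)"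
  unfolding projection_def
proof
  show "selfadjoint (fin_proj I w)"
  proof (rule selfadjointI)
    show "clinear_op (fin_proj I w)"
      by (simp add: clinear_op_def fin_proj_apply cinner_scaleC_left scaleC_sum_right scaleC_scaleC)
    show "cinner (fin_proj I w x) y = cinner x (fin_proj I w y)" for x y
      unfolding fin_proj_apply cinner.sum_left cinner.sum_right cinner_scaleC_left cinner_scaleC_right
      by (intro sum.cong refl) (metis cinner_commute mult.commute)
  qed
  show "fin_proj I w o\<^sub>L fin_proj I w = fin_proj I w"
  proof (rule blinfun_eqI)
    show "(fin_proj I w o\<^sub>L fin_proj I w) x = fin_proj I w x" for x
      unfolding blinfun_apply_blinfun_compose fin_proj_apply
      by (intro sum.cong refl arg_cong2[where f = scaleC] cinner_orthonormal_sum[OF assms])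
  qed
qed

text \<open>The last clause says that the orthonormal vectors lie in the span of the given ones.\<close>

lemma gram_schmidt:
  fixes v :: "nat \<Rightarrow> 'h::chilbert"
  obtains d :: nat and w where "orthonormal_on {..<d} w"
    "\<And>i. i < m \<Longrightarrow> fin_proj {..<d} w (v i) = v i"
    "\<And>z l. (\<And>i. i < m \<Longrightarrow> cinner z (v i) = 0) \<Longrightarrow> l < d \<Longrightarrow> cinner z (w l) = 0"
proof -
  have "\<exists>(d :: nat) w. orthonormal_on {..<d} w \<and> (\<forall>i<m. fin_proj {..<d} w (v i) = v i) \<and>
      (\<forall>z. (\<forall>i<m. cinner z (v i) = 0) \<longrightarrow> (\<forall>l<d. cinner z (w l) = 0))"
  proof (induction m)
    case 0
    show ?case by (rule exI[of _ 0]) (simp add: orthonormal_on_def)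
  next
    case (Suc m)
    then obtain d w where w: "orthonormal_on {..<d::nat} w" "\<forall>i<m. fin_proj {..<d} w (v i) = v i"
      "\<forall>z. (\<forall>i<m. cinner z (v i) = 0) \<longrightarrow> (\<forall>l<d. cinner z (w l) = 0)" by blast
    let ?P = "fin_proj {..<d} w"
    have P: "projection ?P" by (rule projection_fin_proj[OF w(1)]) simp
    define r where "r = v m - ?P (v m)"
    show ?case
    proof (cases "r = 0")
      case True
      then have "\<forall>i<Suc m. ?P (v i) = v i" using w(2) by (auto simp: r_def less_Suc_eq)
      with w show ?thesis by (intro exI[of _ d] exI[of _ w]) auto
    next
      case False
      define w' where "w' = w(d := (1 / norm r) *\<^sub>R r)"
      have w'_lt: "w' l = w l" if "l < d" for l using that by (simp add: w'_def)
      have w'_d: "w' d = (1 / norm r) *\<^sub>R r" by (simp add: w'_def)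
      have P_w: "?P (w l) = w l" if "l < d" for l
      proof -
        have "?P (w l) = (\<Sum>i<d. (if i = l then w i else 0))"
          unfolding fin_proj_apply using w(1) that
          by (intro sum.cong) (auto simp: orthonormal_on_def, metis scaleC_of_real of_real_0 scaleR_zero_left)
        then show ?thesis using that by simp
      qed
      have r_w: "cinner r (w l) = 0" if "l < d" for l
        using P_w[OF that] selfadjoint_cinner[OF projection_selfadjoint[OF P], of "v m" "w l"]
        by (simp add: r_def cinner_diff_left)
      have w_r: "cinner (w l) r = 0" if "l < d" for l
        using r_w[OF that] by (metis cinner_commute complex_cnj_zero)
      have "cinner (w' d) (w' d) = 1"
        using False by (simp add: w'_d cinner_scaleR_left cinner_scaleR_right cinner_same power2_eq_square)
      moreover have "cinner (w i) (w j) = (if i = j then 1 else 0)" if "i < d" "j < d" for i j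
        using w(1) that by (simp add: orthonormal_on_def)
      moreover have "cinner (w' d) (w l) = 0" "cinner (w l) (w' d) = 0" if "l < d" for l
        using r_w[OF that] w_r[OF that] by (simp_all add: w'_d cinner_scaleR_left cinner_scaleR_right)
      ultimately have on: "orthonormal_on {..<Suc d} w'"
        by (auto simp: orthonormal_on_def less_Suc_eq w'_lt)
      have P'_eq: "fin_proj {..<Suc d} w' x = ?P x + cinner x (w' d) *\<^sub>C w' d" for x
        unfolding fin_proj_apply by (simp add: w'_lt)
      have v_r: "cinner (v i) r = 0" if "i < m" for i
      proof -
        have "cinner (v i) r = cinner (?P (v i)) r" using w(2) that by simp
        also have "\<dots> = cinner (v i) (?P r)"
          by (rule selfadjoint_cinner[OF projection_selfadjoint[OF P]])
        also have "?P r = 0"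
          using projection_idem[OF P] unfolding r_def blinfun.diff_right
          by (metis blinfun_apply_blinfun_compose diff_self)
        finally show ?thesis by simp
      qed
      have "cinner (v m) r = cinner r r + cinner (?P (v m)) r"
        by (simp add: r_def cinner_diff_left)
      moreover have "cinner (?P (v m)) r = 0"
        unfolding fin_proj_apply cinner.sum_left cinner_scaleC_left using w_r by simp
      ultimately have "cinner (v m) (w' d) = of_real (norm r)"
        using False by (simp add: w'_d cinner_scaleR_right cinner_same power2_eq_square)
      then have "fin_proj {..<Suc d} w' (v m) = v m"
        using False by (simp add: P'_eq scaleC_of_real w'_d) (simp add: r_def)
      moreover have "fin_proj {..<Suc d} w' (v i) = v i" if "i < m" for i
        using w(2) that v_r[OF that] by (simp add: P'_eq w'_d cinner_scaleR_right)
          (metis scaleC_of_real of_real_0 scaleR_zero_left)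
      moreover have "cinner z (w' l) = 0" if z: "\<forall>i<Suc m. cinner z (v i) = 0" and l: "l < Suc d" for z l
      proof -
        have zw: "cinner z (w l) = 0" if "l < d" for l using w(3) z that by auto
        then have "cinner z (?P (v m)) = 0"
          unfolding fin_proj_apply cinner.sum_right cinner_scaleC_right by simp
        then have "cinner z r = 0" using z by (simp add: r_def cinner_diff_right)
        then show ?thesis
          using l zw by (cases "l = d") (auto simp: w'_d w'_lt cinner_scaleR_right)
      qed
      ultimately show ?thesis
        using on by (intro exI[of _ "Suc d"] exI[of _ w']) (auto simp: less_Suc_eq)
    qed
  qed
  then show ?thesis using that by blast
qed

text \<open>The n groups of vectors \<open>w i\<close> are placed in mutually orthogonal blocks of
  the universe, preserving inner products within each group only. Finitely many vectors span a
  finite-dimensional space, so an orthonormal sequence leaves room for all blocks whatever the size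
  of \<open>'k\<close>.\<close>

lemma orthogonal_copies:
  fixes w :: "nat \<Rightarrow> nat \<Rightarrow> 'k::chilbert" and n m :: nat
  assumes "infinite_dimensional TYPE('u::chilbert)"
  obtains u :: "nat \<Rightarrow> nat \<Rightarrow> 'u::chilbert" and Q :: "nat \<Rightarrow> 'u \<Rightarrow>\<^sub>L 'u"
  where "\<And>i k l. i < n \<Longrightarrow> k < m \<Longrightarrow> l < m \<Longrightarrow> cinner (u i k) (u i l) = cinner (w i k) (w i l)"
    "\<And>i j k l. i \<noteq> j \<Longrightarrow> cinner (u i k) (u j l) = 0"
    "\<And>i. projection (Q i)" "\<And>i j. i \<noteq> j \<Longrightarrow> Q i o\<^sub>L Q j = 0"
    "\<And>i k. Q i (u i k) = u i k" "\<And>i j k. i \<noteq> j \<Longrightarrow> Q i (u j k) = 0"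
proof -
  obtain b :: "nat \<Rightarrow> 'u" where b: "\<And>i j. cinner (b i) (b j) = (if i = j then 1 else 0)"
    using assms by (auto simp: infinite_dimensional_def)
  \<comment> \<open>\<open>div\<close> and \<open>mod\<close> list the n * m vectors as one
    sequence, so that one orthonormal system z serves all groups.\<close>
  obtain d z where z: "orthonormal_on {..<d::nat} z"
    "\<And>i. i < n * m \<Longrightarrow> fin_proj {..<d} z (w (i div m) (i mod m)) = w (i div m) (i mod m)"
    using gram_schmidt[of "n * m" "\<lambda>i. w (i div m) (i mod m)"] by metis
  have w_z: "fin_proj {..<d} z (w i k) = w i k" if "i < n" "k < m" for i k
  proof -
    have "i * m + k < (i + 1) * m" using that by simp
    also have "\<dots> \<le> n * m" using that by (intro mult_right_mono) auto
    finally have "i * m + k < n * m" .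
    from z(2)[OF this] show ?thesis using that by simp
  qed
  \<comment> \<open>The pairing function cuts the orthonormal sequence of the universe into
    infinitely many orthogonal blocks, indexed by i.\<close>
  define c where "c i l = b (prod_encode (i, l))" for i l
  have c: "cinner (c i k) (c j l) = (if i = j \<and> k = l then 1 else 0)" for i j k l
    by (simp add: c_def b prod_encode_eq)
  \<comment> \<open>The coordinates of \<open>w i k\<close> with respect to z are reused in block
    i.\<close>
  define u where "u i k = (\<Sum>l<d. cinner (w i k) (z l) *\<^sub>C c i l)" for i k
  define Q where "Q i = fin_proj {..<d} (c i)" for i
  have on: "orthonormal_on {..<d} (c i)" for i by (simp add: orthonormal_on_def c)
  have u_c: "cinner (u i k) (c j l) = (if i = j then cinner (w i k) (z l) else 0)" if "l < d" for i j k l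
    using cinner_orthonormal_sum[OF on, of l] that
    by (auto simp: u_def cinner.sum_left cinner_scaleC_left c)
  have u_u: "cinner (u i k) (u j l) = (\<Sum>t<d. cnj (cinner (w j l) (z t)) * cinner (u i k) (c j t))" for i j k l
    by (simp add: u_def[of j] cinner.sum_right cinner_scaleC_right)
  show ?thesis
  proof (rule that[of u Q])
    show "cinner (u i k) (u i l) = cinner (w i k) (w i l)" if "i < n" "k < m" "l < m" for i k l
    proof -
      have "cinner (u i k) (u i l) = (\<Sum>t<d. cnj (cinner (w i l) (z t)) * cinner (w i k) (z t))"
        unfolding u_u by (intro sum.cong) (simp_all add: u_c)
      also have "\<dots> = cinner (w i k) (fin_proj {..<d} z (w i l))"
        by (simp add: fin_proj_apply cinner.sum_right cinner_scaleC_right)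
      finally show ?thesis using that by (simp add: w_z)
    qed
    show "cinner (u i k) (u j l) = 0" if "i \<noteq> j" for i j k l
      unfolding u_u using that by (simp add: u_c)
    show "projection (Q i)" for i
      unfolding Q_def by (rule projection_fin_proj[OF on]) simp
    have zero: "0 *\<^sub>C x = 0" for x :: 'u
      by (metis scaleC_of_real of_real_0 scaleR_zero_left)
    show "Q i (u i k) = u i k" for i k
      by (simp add: Q_def fin_proj_apply u_c) (simp add: u_def)
    show "Q i (u j k) = 0" if "i \<noteq> j" for i j k
      using that by (simp add: Q_def fin_proj_apply u_c zero)
    show "Q i o\<^sub>L Q j = 0" if "i \<noteq> j" for i j
      using that by (intro blinfun_eqI)
        (simp add: Q_def fin_proj_apply cinner.sum_left cinner_scaleC_left c zero)
  qed
qed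

lemma positive_sqrt:
  assumes "positive_op P"
  obtains R where "selfadjoint R" "R o\<^sub>L R = P"
proof -
  have sa: "sa_on id_blinfun P" using assms by (simp add: sa_on_id positive_op_selfadjoint)
  have bd: "form_in id_blinfun 0 (norm P) P"
    using form_in_norm[of id_blinfun P] sa_onD(2)[OF sa] positive_op_qform[OF assms]
    by (auto simp: form_in_def)
  have cont: "continuous_on {0..norm P} sqrt" by (intro continuous_intros)
  have "cfc sqrt P o\<^sub>L cfc sqrt P = cfc (\<lambda>x. sqrt x * sqrt x) P"
    by (rule cfc_on_mult[OF sa bd cont cont, symmetric])
  also have "\<dots> = cfc (poly [:0, 1:]) P"
    by (rule cfc_on_cong[OF sa bd]) (auto intro!: continuous_intros)
  also have "\<dots> = P"
    by (simp add: cfc_on_poly[OF sa bd] op_poly_X sa_onD[OF sa])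
  finally show ?thesis
    using cfc_on_sa[OF sa bd cont] by (intro that) (auto simp: sa_on_id)
qed

section \<open>The Jensen inequality for positive operators summing to the identity\<close>

lemma operator_convex_midpoint:
  fixes E :: "'u::chilbert \<Rightarrow>\<^sub>L 'u"
  assumes "operator_convex_on TYPE('u) J f" "sa_on E X" "sa_on E Y"
    "form_in E a b X" "form_in E a b Y" "{a..b} \<subseteq> J"
  shows "cfc_on E f ((1/2) *\<^sub>R X + (1/2) *\<^sub>R Y) \<preceq> (1/2) *\<^sub>R cfc_on E f X + (1/2) *\<^sub>R cfc_on E f Y"
proof -
  have "spectrum_in E X J" "spectrum_in E Y J"
    using assms form_in_spectrum_in by blast+
  moreover have "projection E \<and> X \<in> ops_on E \<and> Y \<in> ops_on E \<and> selfadjoint X \<and> selfadjoint Y"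
    using assms(2,3) by (auto simp: sa_on_def)
  moreover have "(1/2 :: real) \<in> {0..1}" by simp
  ultimately have "cfc_on E f ((1/2) *\<^sub>R X + (1 - 1/2) *\<^sub>R Y)
      \<preceq> (1/2) *\<^sub>R cfc_on E f X + (1 - 1/2) *\<^sub>R cfc_on E f Y"
    using assms(1) unfolding operator_convex_on_def by blast
  then show ?thesis by simp
qed

lemma op_poly_qform:
  "qform (op_poly e p X) x = (\<Sum>k\<le>degree p. coeff p k * Re (cinner (op_power e X k x) x))"
  by (simp add: op_poly_def qform_def blinfun.sum_left cinner.sum_left blinfun.scaleR_left
      cinner_scaleR_left)

lemma le_if_le_add_eps:
  fixes A B c :: real
  assumes "\<And>\<epsilon>. \<epsilon> > 0 \<Longrightarrow> A \<le> B + \<epsilon> * c" "0 \<le> c"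
  shows "A \<le> B"
proof (rule field_le_epsilon)
  fix \<delta> :: real assume \<delta>: "\<delta> > 0"
  \<comment> \<open>The denominator c + 1 covers c = 0.\<close>
  have "A \<le> B + \<delta> / (c + 1) * c" using assms \<delta> by (intro assms) auto
  also have "\<delta> / (c + 1) * c \<le> \<delta>" using assms(2) \<delta> by (simp add: field_simps)
  finally show "A \<le> B + \<delta>" by simp
qed

text \<open>The vectors \<open>Y\<^sup>k \<xi>\<close> with \<open>k \<le> deg p\<close> determine \<open>\<langle>p(Y) \<xi>, \<xi>\<rangle>\<close>. They are dilated to vectors
  \<open>W k\<close> of the universe, on which \<open>X = \<Sum> x\<^sub>i Q\<^sub>i\<close> with orthogonal projections \<open>Q\<^sub>i\<close> compresses
  to \<open>Y\<close>. The midpoint of \<open>X\<close> and its conjugate by the reflection \<open>U = 2e - E\<close> is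
  block diagonal with this compression as a block.\<close>

lemma povm_jensen_poly:
  fixes P :: "nat \<Rightarrow> 'k::chilbert \<Rightarrow>\<^sub>L 'k"
  assumes universe: "infinite_dimensional TYPE('u::chilbert)"
    and convex: "operator_convex_on TYPE('u) J f"
    and J: "{a..b} \<subseteq> J"
    and P: "\<And>i. i < n \<Longrightarrow> positive_op (P i)" and P_sum: "(\<Sum>i<n. P i) = id_blinfun"
    and x: "\<And>i. i < n \<Longrightarrow> x i \<in> {a..b}"
    and p: "\<And>r. r \<in> {a..b} \<Longrightarrow> \<bar>poly p r - f r\<bar> \<le> \<epsilon>" and \<epsilon>: "0 \<le> \<epsilon>"
  shows "qform (op_poly id_blinfun p (\<Sum>i<n. x i *\<^sub>R P i)) \<xi>
    \<le> (\<Sum>i<n. poly p (x i) * qform (P i) \<xi>) + 2 * \<epsilon> * (norm \<xi>)\<^sup>2"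
proof -
  define Y where "Y = (\<Sum>i<n. x i *\<^sub>R P i)"
  define N where "N = degree p"
  define y where "y k = op_power id_blinfun Y k \<xi>" for k
  have y_Suc: "y (Suc k) = Y (y k)" for k by (simp add: y_def)
  have "\<exists>R. i < n \<longrightarrow> selfadjoint R \<and> R o\<^sub>L R = P i" for i
  proof (cases "i < n")
    case True
    from positive_sqrt[OF P[OF this]] show ?thesis by metis
  qed simp
  then have "\<exists>R. \<forall>i. i < n \<longrightarrow> selfadjoint (R i) \<and> R i o\<^sub>L R i = P i"
    by (intro choice allI)
  then obtain R where R: "\<And>i. i < n \<Longrightarrow> selfadjoint (R i)" "\<And>i. i < n \<Longrightarrow> R i o\<^sub>L R i = P i"
    by blast
  obtain u :: "nat \<Rightarrow> nat \<Rightarrow> 'u" and Q :: "nat \<Rightarrow> 'u \<Rightarrow>\<^sub>L 'u"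
    where u_same: "\<And>i k l. i < n \<Longrightarrow> k < Suc N \<Longrightarrow> l < Suc N \<Longrightarrow>
        cinner (u i k) (u i l) = cinner (R i (y k)) (R i (y l))"
      and u_orth: "\<And>i j k l. i \<noteq> j \<Longrightarrow> cinner (u i k) (u j l) = 0"
      and Q_proj: "\<And>i. projection (Q i)" and Q_orth: "\<And>i j. i \<noteq> j \<Longrightarrow> Q i o\<^sub>L Q j = 0"
      and Q_u: "\<And>i k. Q i (u i k) = u i k" and Q_u_orth: "\<And>i j k. i \<noteq> j \<Longrightarrow> Q i (u j k) = 0"
    using orthogonal_copies[OF universe, of n "Suc N" "\<lambda>i k. R i (y k)"] by blast
  have u_P: "cinner (u i k) (u i l) = cinner (P i (y k)) (y l)" if "i < n" "k \<le> N" "l \<le> N" for i k l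
    using u_same[of i k l] selfadjoint_cinner[OF R(1)[OF that(1)], of "R i (y k)" "y l"] R(2)[OF that(1)] that
    by (metis blinfun_apply_blinfun_compose less_Suc_eq_le)
  \<comment> \<open>In the Naimark dilation, V y = (R i y) over i is an isometry because the
    \<open>P i\<close> sum to the identity, and \<open>P i\<close> is the compression of
    \<open>Q i\<close>. \<open>W k\<close> plays the part of V (y k), although V itself is never
    defined.\<close>
  define W where "W k = (\<Sum>i<n. u i k)" for k
  define E where "E = (\<Sum>i<n. Q i)"
  define X where "X = (\<Sum>i<n. x i *\<^sub>R Q i)"
  have Q_W: "Q i (W k) = u i k" if "i < n" for i k
  proof -
    have "Q i (W k) = (\<Sum>j<n. if j = i then u j k else 0)"
      unfolding W_def blinfun.sum_right by (intro sum.cong) (auto simp: Q_u Q_u_orth)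
    then show ?thesis using that by simp
  qed
  have u_W: "cinner (u i k) (W l) = cinner (u i k) (u i l)" if "i < n" for i k l
  proof -
    have "cinner (u i k) (W l) = (\<Sum>j<n. if j = i then cinner (u i k) (u i l) else 0)"
      unfolding W_def cinner.sum_right by (intro sum.cong) (auto simp: u_orth)
    then show ?thesis using that by simp
  qed
  have E_W: "E (W k) = W k" for k
    by (simp add: E_def blinfun.sum_left Q_W) (simp add: W_def)
  have X_W: "X (W k) = (\<Sum>i<n. x i *\<^sub>R u i k)" for k
    by (simp add: X_def blinfun.sum_left blinfun.scaleR_left Q_W)
  have W_W: "cinner (W k) (W l) = cinner (y k) (y l)" if "k \<le> N" "l \<le> N" for k l
  proof -
    have "cinner (W k) (W l) = (\<Sum>i<n. cinner (P i (y k)) (y l))"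
      unfolding W_def[of k] cinner.sum_left using that by (simp add: u_W u_P)
    also have "\<dots> = cinner ((\<Sum>i<n. P i) (y k)) (y l)"
      by (simp add: blinfun.sum_left cinner.sum_left)
    finally show ?thesis by (simp add: P_sum)
  qed
  \<comment> \<open>k < N is strict because \<open>W (Suc k)\<close> must still be one of the
    vectors whose inner products were copied.\<close>
  have XW_W: "cinner (X (W k)) (W l) = cinner (W (Suc k)) (W l)" if "k < N" "l \<le> N" for k l
  proof -
    have "cinner (X (W k)) (W l) = (\<Sum>i<n. of_real (x i) * cinner (P i (y k)) (y l))"
      unfolding X_W cinner.sum_left cinner_scaleR_left using that by (simp add: u_W u_P)
    also have "\<dots> = cinner (Y (y k)) (y l)"
      by (simp add: Y_def blinfun.sum_left cinner.sum_left blinfun.scaleR_left cinner_scaleR_left)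
    finally show ?thesis using that by (simp add: W_W y_Suc)
  qed
  have E: "projection E"
  proof -
    have "E o\<^sub>L E = (\<Sum>i<n. \<Sum>j<n. Q i o\<^sub>L Q j)"
      unfolding E_def blinfun_compose_sum_left by (simp only: blinfun_compose_sum_right)
    also have "\<dots> = (\<Sum>i<n. \<Sum>j<n. if j = i then Q i else 0)"
      by (intro sum.cong refl) (auto simp: Q_orth projection_idem[OF Q_proj])
    finally show ?thesis
      using Q_proj by (auto simp: projection_def E_def intro!: selfadjoint_sum)
  qed
  have EQ: "E o\<^sub>L Q i = Q i" "Q i o\<^sub>L E = Q i" if "i < n" for i
  proof -
    have "E o\<^sub>L Q i = (\<Sum>j<n. if j = i then Q i else 0)"
      unfolding E_def blinfun_compose_sum_left
      by (intro sum.cong refl) (auto simp: Q_orth projection_idem[OF Q_proj])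
    moreover have "Q i o\<^sub>L E = (\<Sum>j<n. if j = i then Q i else 0)"
      unfolding E_def blinfun_compose_sum_right
      by (intro sum.cong refl) (auto simp: Q_orth projection_idem[OF Q_proj])
    ultimately show "E o\<^sub>L Q i = Q i" "Q i o\<^sub>L E = Q i" using that by simp_all
  qed
  have Q_sa: "sa_on E (Q i)" if "i < n" for i
    using EQ[OF that] Q_proj[of i]
    by (auto simp: sa_on_def E projection_selfadjoint selfadjoint_clinear intro!: ops_onI)
  have X: "sa_on E X"
    unfolding X_def sa_on_def using E Q_sa
    by (auto intro!: ops_on_sum selfadjoint_sum ops_on_scaleR selfadjoint_scaleR dest: sa_onD)
  have X_ab: "form_in E a b X"
    unfolding form_in_def E_def X_def qform_sum qform_scaleR sum_distrib_left using x
    by (auto intro!: sum_mono mult_right_mono qform_nonneg_projection Q_proj)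

  obtain d w where w: "orthonormal_on {..<d::nat} w"
      and e_W': "\<And>k. k < Suc N \<Longrightarrow> fin_proj {..<d} w (W k) = W k"
      and w_span: "\<And>z l. (\<And>k. k < Suc N \<Longrightarrow> cinner z (W k) = 0) \<Longrightarrow> l < d \<Longrightarrow> cinner z (w l) = 0"
    using gram_schmidt[of "Suc N" W] by blast
  define e where "e = fin_proj {..<d} w"
  have e: "projection e" unfolding e_def by (rule projection_fin_proj[OF w]) simp
  have e_W: "e (W k) = W k" if "k \<le> N" for k using e_W'[of k] that by (simp add: e_def)
  have e_zero: "e z = 0" if "\<And>k. k \<le> N \<Longrightarrow> cinner z (W k) = 0" for z
    using w_span[of z] that
    by (simp add: e_def fin_proj_apply) (metis (no_types, lifting) lessThan_iff of_real_0 scaleC_of_real scaleR_zero_left sum.neutral)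
  \<comment> \<open>\<open>E\<close> fixes every \<open>W k\<close>, so z - E z is orthogonal to
    their span, the range of \<open>e\<close>.\<close>
  have eE: "e o\<^sub>L E = e"
  proof (rule blinfun_eqI)
    fix z
    have "cinner (z - E z) (W k) = 0" if "k \<le> N" for k
      using selfadjoint_cinner[OF projection_selfadjoint[OF E], of z "W k"] by (simp add: cinner_diff_left E_W)
    then have "e (z - E z) = 0" by (rule e_zero)
    then show "(e o\<^sub>L E) z = e z" by (simp add: blinfun.diff_right)
  qed
  have Ee: "E o\<^sub>L e = e"
  proof (rule blinfun_eqI, rule cinner_eqI)
    fix z z'
    have "cinner ((E o\<^sub>L e) z) z' = cinner z ((e o\<^sub>L E) z')"
      by (simp add: selfadjoint_cinner[OF projection_selfadjoint[OF E]]
          selfadjoint_cinner[OF projection_selfadjoint[OF e]])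
    then show "cinner ((E o\<^sub>L e) z) z' = cinner (e z) z'"
      by (simp add: eE selfadjoint_cinner[OF projection_selfadjoint[OF e]])
  qed
  define U where "U = 2 *\<^sub>R e - E"
  have e_sa: "sa_on E e"
    unfolding sa_on_def using E e eE Ee
    by (auto simp: projection_selfadjoint selfadjoint_clinear intro!: ops_onI)
  have U: "sa_on E U"
    unfolding U_def by (intro sa_on_diff sa_on_scaleR e_sa sa_on_self E)
  note U_self = sa_onD(3)[OF U]
  have UU: "U o\<^sub>L U = E"
    by (simp add: U_def blinfun_comp_simps eE Ee projection_idem[OF e] projection_idem[OF E]
        algebra_simps flip: scaleR_add_left)
  have UU_apply: "U (U z) = E z" for z using UU by (metis blinfun_apply_blinfun_compose)
  have U_W: "U (W k) = W k" if "k \<le> N" for k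
    using that by (simp add: U_def blinfun.bilinear_simps e_W E_W scaleR_2)
  define X' where "X' = U o\<^sub>L X o\<^sub>L U"
  have X': "sa_on E X'"
    unfolding X'_def sa_on_def using U X E
    by (auto intro!: ops_on_compose selfadjoint_conj dest: sa_onD)
  have X'_ab: "form_in E a b X'"
  proof -
    have "qform E (U z) = qform E z" for z
      using qform_conj[OF U_self, of E z] UU ops_on_right[OF E sa_onD(2)[OF U]]
      by (simp add: blinfun_compose_assoc ops_on_left[OF E sa_onD(2)[OF U]])
    then show ?thesis
      using X_ab by (simp add: form_in_def X'_def qform_conj[OF U_self]) metis
  qed
  define B where "B = (1/2) *\<^sub>R X + (1/2) *\<^sub>R X'"
  have B: "sa_on E B"
    unfolding B_def by (intro sa_on_add sa_on_scaleR X X')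
  have B_ab: "form_in E a b B"
    unfolding form_in_def
  proof
    fix z
    have "a * qform E z \<le> qform X z \<and> qform X z \<le> b * qform E z"
      "a * qform E z \<le> qform X' z \<and> qform X' z \<le> b * qform E z"
      using X_ab X'_ab by (simp_all only: form_in_def)
    then show "a * qform E z \<le> qform B z \<and> qform B z \<le> b * qform E z"
      by (simp add: B_def qform_simps)
  qed
  \<comment> \<open>By \<open>XW_W\<close> the vector X (W k) - W (Suc k) is orthogonal to the range
    of \<open>e\<close>, so the compression of X acts on these vectors as a shift.\<close>
  have eX_W: "e (X (W k)) = W (Suc k)" if "k < N" for k
  proof -
    have "e (X (W k) - W (Suc k)) = 0"
      using that by (intro e_zero) (simp add: cinner_diff_left XW_W)
    then show ?thesis using that by (simp add: blinfun.diff_right e_W)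
  qed
  \<comment> \<open>Averaging with the reflected operator removes the off-diagonal blocks e X (E -
    e) and (E - e) X e, so B (W k) is e (X (W k)).\<close>
  have B_W: "B (W k) = W (Suc k)" if "k < N" for k
  proof -
    have "B (W k) = (1/2) *\<^sub>R (X (W k) + U (X (W k)))"
      using that by (simp add: B_def X'_def blinfun.bilinear_simps U_W scaleR_add_right)
    also have "U (X (W k)) = 2 *\<^sub>R W (Suc k) - X (W k)"
      using that by (simp add: U_def blinfun.bilinear_simps eX_W ops_on_apply(2)[OF E sa_onD(2)[OF X]])
    finally show ?thesis by simp
  qed
  have B_pow: "op_power E B k (W 0) = W k" if "k \<le> N" for k
    using that by (induction k) (simp_all add: E_W B_W)
  have X_u: "X (u i k) = x i *\<^sub>R u i k" if "i < n" for i k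
  proof -
    have "X (u i k) = (\<Sum>j<n. if j = i then x i *\<^sub>R u i k else 0)"
      unfolding X_def blinfun.sum_left blinfun.scaleR_left
      by (intro sum.cong) (auto simp: Q_u Q_u_orth)
    then show ?thesis using that by simp
  qed
  have X_pow: "op_power E X k (W 0) = (\<Sum>i<n. (x i ^ k) *\<^sub>R u i 0)" for k
  proof (induction k)
    case 0
    show ?case by (simp add: E_W) (simp add: W_def)
  next
    case (Suc k)
    then show ?case
      by (simp add: blinfun.sum_right blinfun.scaleR_right X_u mult.commute)
  qed
  have X'_pow: "op_power E X' k (W 0) = U (op_power E X k (W 0))" for k
  proof (induction k)
    case 0
    show ?case by (simp add: E_W U_W)
  next
    case (Suc k)
    then show ?case
      by (simp add: X'_def UU_apply ops_on_apply(1)[OF E sa_onD(2)[OF X]])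
  qed
  have W0: "(norm (W 0))\<^sup>2 = (norm \<xi>)\<^sup>2"
    using W_W[of 0 0] by (simp add: y_def flip: Re_cinner_same)
  have q_Y: "qform (op_poly id_blinfun p Y) \<xi> = qform (op_poly E p B) (W 0)"
    unfolding op_poly_qform by (intro sum.cong refl) (use W_W[of _ 0] in \<open>simp add: B_pow N_def y_def\<close>)
  have q_X: "qform (op_poly E p X) (W 0) = (\<Sum>i<n. poly p (x i) * qform (P i) \<xi>)"
  proof -
    have "Re (cinner (op_power E X k (W 0)) (W 0)) = (\<Sum>i<n. x i ^ k * qform (P i) \<xi>)" for k
      unfolding X_pow cinner.sum_left cinner_scaleR_left
      by (simp add: u_W u_P y_def qform_def)
    then have "qform (op_poly E p X) (W 0) = (\<Sum>k\<le>degree p. \<Sum>i<n. coeff p k * x i ^ k * qform (P i) \<xi>)"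
      unfolding op_poly_qform by (simp add: sum_distrib_left mult.assoc)
    also have "\<dots> = (\<Sum>i<n. \<Sum>k\<le>degree p. coeff p k * x i ^ k * qform (P i) \<xi>)"
      by (rule sum.swap)
    finally show ?thesis by (simp add: poly_altdef sum_distrib_right)
  qed
  have q_X': "qform (op_poly E p X') (W 0) = qform (op_poly E p X) (W 0)"
    unfolding op_poly_qform X'_pow by (simp add: selfadjoint_cinner[OF U_self] U_W)
  have cont: "continuous_on {a..b} f"
    using convex J continuous_on_subset unfolding operator_convex_on_def by blast
  have dist: "\<bar>qform (cfc_on E f Z) (W 0) - qform (op_poly E p Z) (W 0)\<bar> \<le> \<epsilon> * (norm \<xi>)\<^sup>2"
    if "sa_on E Z" "form_in E a b Z" for Z
    using cfc_on_qform_dist_le[OF that cont \<epsilon> p, of "W 0"] unfolding W0 .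
  \<comment> \<open>Convexity is a property of f, not of p. Returning to p costs \<epsilon> on the
    left and two halves of \<epsilon> on the right, the 2 \<epsilon> of the claim. \<open>U\<close>
    fixes \<open>W 0\<close>, so the forms of p(X) and p(X') agree there.\<close>
  have "cfc_on E f B \<preceq> (1/2) *\<^sub>R cfc_on E f X + (1/2) *\<^sub>R cfc_on E f X'"
    unfolding B_def by (rule operator_convex_midpoint[OF convex X X' X_ab X'_ab J])
  then have "qform (cfc_on E f B) (W 0)
      \<le> 1/2 * qform (cfc_on E f X) (W 0) + 1/2 * qform (cfc_on E f X') (W 0)"
    by (drule_tac op_le_qform) (simp add: qform_simps)
  then have "qform (op_poly E p B) (W 0) \<le> qform (op_poly E p X) (W 0) + 2 * (\<epsilon> * (norm \<xi>)\<^sup>2)"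
    using dist[OF B B_ab] dist[OF X X_ab] dist[OF X' X'_ab] q_X' by linarith
  then show ?thesis
    using q_Y q_X by (simp add: Y_def mult.assoc)
qed

lemma povm_jensen:
  fixes P :: "nat \<Rightarrow> 'k::chilbert \<Rightarrow>\<^sub>L 'k"
  assumes universe: "infinite_dimensional TYPE('u::chilbert)"
    and convex: "operator_convex_on TYPE('u) J f"
    and J: "{a..b} \<subseteq> J"
    and P: "\<And>i. i < n \<Longrightarrow> positive_op (P i)" and P_sum: "(\<Sum>i<n. P i) = id_blinfun"
    and x: "\<And>i. i < n \<Longrightarrow> x i \<in> {a..b}"
  shows "qform (cfc f (\<Sum>i<n. x i *\<^sub>R P i)) \<xi> \<le> (\<Sum>i<n. f (x i) * qform (P i) \<xi>)"
proof (rule le_if_le_add_eps)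
  let ?Y = "\<Sum>i<n. x i *\<^sub>R P i"
  fix \<epsilon> :: real assume \<epsilon>: "\<epsilon> > 0"
  have cont: "continuous_on {a..b} f"
    using convex J continuous_on_subset unfolding operator_convex_on_def by blast
  obtain p where p: "\<And>r. r \<in> {a..b} \<Longrightarrow> \<bar>poly p r - f r\<bar> \<le> \<epsilon>"
    using polynomial_approximation_eps[OF cont \<epsilon>] by blast
  have id: "(norm \<xi>)\<^sup>2 = (\<Sum>i<n. qform (P i) \<xi>)" for \<xi>
    using P_sum by (metis qform_id qform_sum)
  have "sa_on id_blinfun ?Y"
    unfolding sa_on_id
    by (intro selfadjoint_sum selfadjoint_scaleR positive_op_selfadjoint[OF P]) simp
  moreover have "form_in id_blinfun a b ?Y"
    unfolding form_in_def qform_id id qform_sum qform_scaleR sum_distrib_left using x P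
    by (auto intro!: sum_mono mult_right_mono positive_op_qform)
  ultimately have "\<bar>qform (cfc f ?Y) \<xi> - qform (op_poly id_blinfun p ?Y) \<xi>\<bar> \<le> \<epsilon> * (norm \<xi>)\<^sup>2"
    using \<epsilon> p by (intro cfc_on_qform_dist_le[OF _ _ cont]) auto
  moreover have "qform (op_poly id_blinfun p ?Y) \<xi>
      \<le> (\<Sum>i<n. poly p (x i) * qform (P i) \<xi>) + 2 * \<epsilon> * (norm \<xi>)\<^sup>2"
    using \<epsilon> by (intro povm_jensen_poly[OF universe convex J P P_sum x p]) auto
  moreover have "(\<Sum>i<n. poly p (x i) * qform (P i) \<xi>) \<le> (\<Sum>i<n. (f (x i) + \<epsilon>) * qform (P i) \<xi>)"
  proof (intro sum_mono mult_right_mono)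
    fix i assume "i \<in> {..<n}"
    then show "poly p (x i) \<le> f (x i) + \<epsilon>" "0 \<le> qform (P i) \<xi>"
      using p[OF x, of i] P[of i] by (auto simp: positive_op_qform)
  qed
  moreover have "(\<Sum>i<n. (f (x i) + \<epsilon>) * qform (P i) \<xi>) = (\<Sum>i<n. f (x i) * qform (P i) \<xi>) + \<epsilon> * (norm \<xi>)\<^sup>2"
    by (simp add: id algebra_simps sum.distrib sum_distrib_left)
  \<comment> \<open>One \<epsilon> for passing from f(Y) to p(Y), two from
    \<open>povm_jensen_poly\<close>, and one for returning from p to f at the points
    \<open>x i\<close>.\<close>
  ultimately have "qform (cfc f ?Y) \<xi> \<le> (\<Sum>i<n. f (x i) * qform (P i) \<xi>) + 4 * (\<epsilon> * (norm \<xi>)\<^sup>2)"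
    by linarith
  then show "qform (cfc f ?Y) \<xi> \<le> (\<Sum>i<n. f (x i) * qform (P i) \<xi>) + \<epsilon> * (4 * (norm \<xi>)\<^sup>2)"
    by (simp add: mult_ac)
qed simp

text \<open>A positive linear map on the continuous functions of [a, b], represented by its
  restriction to the dense subspace of polynomials; \<open>pfc_value\<close> describes its value at
  a continuous function.\<close>

definition positive_functional_calculus ::
    "real \<Rightarrow> real \<Rightarrow> (real poly \<Rightarrow> 'k::chilbert \<Rightarrow>\<^sub>L 'k) \<Rightarrow> bool" where
  "positive_functional_calculus a b L \<longleftrightarrow>
     (\<forall>p q. L (p + q) = L p + L q) \<and> (\<forall>c p. L (smult c p) = c *\<^sub>R L p) \<and>
     (\<forall>p. (\<forall>r\<in>{a..b}. 0 \<le> poly p r) \<longrightarrow> positive_op (L p))"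

lemma pfcD:
  assumes "positive_functional_calculus a b L"
  shows "L (p + q) = L p + L q" "L (smult c p) = c *\<^sub>R L p"
    "(\<And>r. r \<in> {a..b} \<Longrightarrow> 0 \<le> poly p r) \<Longrightarrow> positive_op (L p)"
  using assms unfolding positive_functional_calculus_def by blast+

lemma pfc_zero: "positive_functional_calculus a b L \<Longrightarrow> L 0 = 0"
  using pfcD(2)[of a b L 0 0] by simp

lemma pfc_sum: "positive_functional_calculus a b L \<Longrightarrow> L (\<Sum>i\<in>I. p i) = (\<Sum>i\<in>I. L (p i))"
  by (induction I rule: infinite_finite_induct) (auto simp: pfc_zero pfcD(1))

lemma pfc_diff: "positive_functional_calculus a b L \<Longrightarrow> L (p - q) = L p - L q"
  using pfcD(1)[of a b L p "smult (-1) q"] pfcD(2)[of a b L "-1" q] by simp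

lemma pfc_bounds:
  assumes L: "positive_functional_calculus a b L" and p: "\<And>r. r \<in> {a..b} \<Longrightarrow> poly p r \<le> poly q r"
  shows "qform (L p) x \<le> qform (L q) x"
  using positive_op_qform[of "L (q - p)" x] pfcD(3)[OF L, of "q - p"] p
  by (simp add: pfc_diff[OF L] qform_simps)

text \<open>A polynomial is bounded on [a, b] by some c, so p = (c + p) - c is a difference of
  polynomials with positive images.\<close>

lemma pfc_selfadjoint:
  assumes L: "positive_functional_calculus a b L"
  shows "selfadjoint (L p)"
proof -
  have "bounded (poly p ` {a..b})"
    by (intro compact_imp_bounded compact_continuous_image continuous_intros) auto
  then obtain c where "\<forall>y\<in>poly p ` {a..b}. norm y \<le> c"
    unfolding bounded_iff by (rule exE)
  then have c: "\<bar>poly p r\<bar> \<le> c" if "r \<in> {a..b}" for r using that by simp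
  have pos: "positive_op (L ([:c:] + p))"
  proof (intro pfcD(3)[OF L])
    fix r assume "r \<in> {a..b}"
    from c[OF this] show "0 \<le> poly ([:c:] + p) r" by simp
  qed
  have "selfadjoint (L 1)"
    by (intro positive_op_selfadjoint pfcD(3)[OF L]) simp
  then have "selfadjoint (L [:c:])"
    using pfcD(2)[OF L, of c 1] by (simp add: selfadjoint_scaleR)
  moreover have "L p = L ([:c:] + p) - L [:c:]" by (simp add: pfcD(1)[OF L])
  ultimately show ?thesis
    using selfadjoint_diff[OF positive_op_selfadjoint[OF pos]] by simp
qed

text \<open>The images of the Bernstein basis are positive, sum to the identity and have L(x) as
  their sum weighted by the nodes. \<open>povm_jensen\<close> then bounds f(L(x)) by L of the n-th
  Bernstein approximation of f, which tends to G.\<close>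

lemma pfc_jensen:
  fixes L :: "real poly \<Rightarrow> 'k::chilbert \<Rightarrow>\<^sub>L 'k"
  assumes universe: "infinite_dimensional TYPE('u::chilbert)"
    and convex: "operator_convex_on TYPE('u) J f"
    and J: "{a..b} \<subseteq> J" and ab: "a \<le> b"
    and L: "positive_functional_calculus a b L" and L_one: "L 1 = id_blinfun"
    and G: "\<And>q. uniform_limit {a..b} (\<lambda>n. poly (q n)) f sequentially \<Longrightarrow> (\<lambda>n. L (q n)) \<longlonglongrightarrow> G"
  shows "qform (cfc f (L [:0, 1:])) \<xi> \<le> qform G \<xi>"
proof (cases "a < b")
  case True
  let ?x = "\<lambda>n k. a + (b - a) * (real k / real n)"
  have cont: "continuous_on {a..b} f"
    using convex J continuous_on_subset unfolding operator_convex_on_def by blast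
  have le: "qform (cfc f (L [:0, 1:])) \<xi> \<le> qform (L (bernstein_approx f a b n)) \<xi>" if n: "n > 0" for n
  proof -
    let ?P = "\<lambda>k. L (bernstein_poly a b n k)"
    have "L [:0, 1:] = (\<Sum>k<Suc n. ?x n k *\<^sub>R ?P k)"
      unfolding bernstein_approx_id[OF True n, symmetric] bernstein_approx_def lessThan_Suc_atMost
      by (simp add: pfc_sum[OF L] pfcD(2)[OF L])
    moreover have "qform (L (bernstein_approx f a b n)) \<xi> = (\<Sum>k<Suc n. f (?x n k) * qform (?P k) \<xi>)"
      unfolding bernstein_approx_def lessThan_Suc_atMost
      by (simp add: pfc_sum[OF L] pfcD(2)[OF L] qform_sum qform_scaleR)
    moreover have "qform (cfc f (\<Sum>k<Suc n. ?x n k *\<^sub>R ?P k)) \<xi> \<le> (\<Sum>k<Suc n. f (?x n k) * qform (?P k) \<xi>)"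
    proof (rule povm_jensen[OF universe convex J])
      show "positive_op (?P k)" for k
        using True by (intro pfcD(3)[OF L]) (auto simp: poly_bernstein_poly intro!: Bernstein_nonneg)
      show "(\<Sum>k<Suc n. ?P k) = id_blinfun"
        unfolding lessThan_Suc_atMost pfc_sum[OF L, symmetric] bernstein_poly_sum[OF True] by (rule L_one)
      fix k assume "k < Suc n"
      then have k: "0 \<le> real k / real n" "real k / real n \<le> 1" using n by auto
      then have "0 \<le> (b - a) * (real k / real n)" "(b - a) * (real k / real n) \<le> b - a"
        using True by (intro mult_nonneg_nonneg mult_left_le; simp)+
      then show "?x n k \<in> {a..b}" by (simp only: atLeastAtMost_iff) linarith
    qed
    ultimately show ?thesis by simp
  qed
  have "(\<lambda>n. qform (L (bernstein_approx f a b n)) \<xi>) \<longlonglongrightarrow> qform G \<xi>"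
    by (intro tendsto_qform G bernstein_approx_uniform cont True)
  then show ?thesis
    by (rule tendsto_lowerbound) (use le in \<open>auto simp: eventually_sequentially intro!: exI[of _ 1]\<close>)
next
  case False
  \<comment> \<open>On a one-point interval the Bernstein substitution would divide by 0. Instead
    L(x) = a I follows from positivity, and \<open>povm_jensen\<close> is applied to the single
    operator I.\<close>
  then have b: "b = a" using ab by simp
  have L_const: "L [:c:] = c *\<^sub>R id_blinfun" for c
    using pfcD(2)[OF L, of c 1] by (simp add: L_one)
  have "qform (L [:0, 1:]) x = qform (L [:a:]) x" for x
    by (intro antisym pfc_bounds[OF L]) (auto simp: b)
  then have "L [:0, 1:] = L [:a:]"
    using norm_le_numerical_radius[of "L [:0, 1:] - L [:a:]" 0]
    by (simp add: qform_simps pfc_selfadjoint[OF L] selfadjoint_diff)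
  then have L_X: "L [:0, 1:] = a *\<^sub>R id_blinfun" by (simp add: L_const)
  have "(\<lambda>n. L [:f a:]) \<longlonglongrightarrow> G"
    by (rule G) (simp add: uniform_limit_iff b)
  then have "G = f a *\<^sub>R id_blinfun"
    using LIMSEQ_unique[OF tendsto_const] by (auto simp: L_const)
  moreover have "qform (cfc f (\<Sum>i<Suc 0. a *\<^sub>R id_blinfun)) \<xi> \<le> (\<Sum>i<Suc 0. f a * qform id_blinfun \<xi>)"
    by (rule povm_jensen[OF universe convex J]) (auto simp: b qform_id intro!: positive_opI)
  ultimately show ?thesis by (simp add: L_X qform_simps)
qed

section \<open>Bochner integrals of functions with values in a convex cone\<close>

definition convex_cone_set :: "'a::real_vector set \<Rightarrow> bool" where
  "convex_cone_set C \<longleftrightarrow> 0 \<in> C \<and> (\<forall>x\<in>C. \<forall>y\<in>C. x + y \<in> C) \<and> (\<forall>x\<in>C. \<forall>r\<ge>0. r *\<^sub>R x \<in> C)"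

lemma infdist_cone_add:
  fixes C :: "'a::real_normed_vector set"
  assumes C: "convex_cone_set C"
  shows "infdist (u + v) C \<le> infdist u C + infdist v C"
proof -
  have ne: "C \<noteq> {}" using C by (auto simp: convex_cone_set_def)
  have "infdist (u + v) C - dist u c \<le> infdist v C" if c: "c \<in> C" for c
    unfolding infdist_notempty[OF ne, of v]
  proof (rule cINF_greatest[OF ne])
    fix c' assume c': "c' \<in> C"
    have "infdist (u + v) C \<le> dist (u + v) (c + c')"
      using C c c' by (intro infdist_le) (auto simp: convex_cone_set_def)
    also have "\<dots> \<le> dist u c + dist v c'"
      by (rule dist_triangle_add)
    finally show "infdist (u + v) C - dist u c \<le> dist v c'" by simp
  qed
  then have "infdist (u + v) C - infdist v C \<le> dist u c" if "c \<in> C" for c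
    using that by (simp add: algebra_simps)
  then have "infdist (u + v) C - infdist v C \<le> infdist u C"
    unfolding infdist_notempty[OF ne, of u] by (intro cINF_greatest[OF ne])
  then show ?thesis by simp
qed

lemma infdist_cone_scaleR:
  fixes C :: "'a::real_normed_vector set"
  assumes C: "convex_cone_set C" and r: "0 \<le> r"
  shows "infdist (r *\<^sub>R v) C \<le> r * infdist v C"
proof (cases "r = 0")
  case True
  then show ?thesis using C by (simp add: convex_cone_set_def)
next
  case False
  have ne: "C \<noteq> {}" using C by (auto simp: convex_cone_set_def)
  have "infdist (r *\<^sub>R v) C / r \<le> infdist v C"
    unfolding infdist_notempty[OF ne, of v]
  proof (rule cINF_greatest[OF ne])
    fix c assume c: "c \<in> C"
    have "infdist (r *\<^sub>R v) C \<le> dist (r *\<^sub>R v) (r *\<^sub>R c)"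
      using C c r by (intro infdist_le) (auto simp: convex_cone_set_def)
    also have "\<dots> = r * dist v c"
      using r by (simp add: dist_norm flip: scaleR_diff_right)
    finally show "infdist (r *\<^sub>R v) C / r \<le> dist v c"
      using r False by (simp add: field_simps)
  qed
  then show ?thesis using r False by (simp add: field_simps)
qed

lemma infdist_cone_sum:
  fixes C :: "'a::real_normed_vector set"
  assumes C: "convex_cone_set C"
  shows "infdist (\<Sum>i\<in>I. v i) C \<le> (\<Sum>i\<in>I. infdist (v i) C)"
proof (induction I rule: infinite_finite_induct)
  case (insert i I)
  then show ?case
    using infdist_cone_add[OF C, of "v i" "\<Sum>i\<in>I. v i"] by simp
qed (use C in \<open>simp_all add: convex_cone_set_def\<close>)

abbreviation sb_integrable :: "'t measure \<Rightarrow> ('t \<Rightarrow> 'b::real_vector) \<Rightarrow> bool" where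
  "sb_integrable \<equiv> Bochner_Integration.simple_bochner_integrable"

abbreviation sb_integral :: "'t measure \<Rightarrow> ('t \<Rightarrow> 'b::real_vector) \<Rightarrow> 'b" where
  "sb_integral \<equiv> Bochner_Integration.simple_bochner_integral"

lemma sb_integrable_simple_function: "sb_integrable M s \<Longrightarrow> simple_function M s"
  by (auto elim: simple_bochner_integrable.cases)

text \<open>The distance to a convex cone is sublinear, so it can be pulled into the integral.\<close>

lemma infdist_simple_integral:
  fixes s :: "'t \<Rightarrow> 'a::real_normed_vector"
  assumes C: "convex_cone_set C" and s: "sb_integrable M s"
  shows "ennreal (infdist (sb_integral M s) C) \<le> (\<integral>\<^sup>+t. ennreal (infdist (s t) C) \<partial>M)"
proof -
  have C0: "infdist 0 C = 0" using C by (simp add: convex_cone_set_def)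
  have s': "sb_integrable M (\<lambda>t. infdist (s t) C)"
    using simple_bochner_integrable_compose2[of "\<lambda>x y. infdist x C" M s s] s C0 by simp
  have "infdist (sb_integral M s) C
      \<le> (\<Sum>y\<in>s ` space M. infdist (measure M {t \<in> space M. s t = y} *\<^sub>R y) C)"
    unfolding simple_bochner_integral_def by (rule infdist_cone_sum[OF C])
  also have "\<dots> \<le> (\<Sum>y\<in>s ` space M. measure M {t \<in> space M. s t = y} *\<^sub>R infdist y C)"
    by (intro sum_mono) (simp add: infdist_cone_scaleR[OF C])
  also have "\<dots> = sb_integral M (\<lambda>t. infdist (s t) C)"
    by (rule simple_bochner_integral_partition[symmetric])
      (auto intro: s' sb_integrable_simple_function s)
  finally have "ennreal (infdist (sb_integral M s) C) \<le> ennreal (sb_integral M (\<lambda>t. infdist (s t) C))"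
    by (rule ennreal_leI)
  also have "\<dots> = (\<integral>\<^sup>+t. ennreal (infdist (s t) C) \<partial>M)"
    by (rule simple_bochner_integral_eq_nn_integral[OF s']) (rule infdist_nonneg)
  finally show ?thesis .
qed

text \<open>Without second countability a difference of two Borel functions need not be Borel. A
  simple function has finitely many values, so the difference is treated separately on each of its
  level sets.\<close>

lemma borel_measurable_norm_diff_simple:
  fixes g :: "'t \<Rightarrow> 'b::real_normed_vector"
  assumes g: "g \<in> borel_measurable M" and s: "sb_integrable M s"
  shows "(\<lambda>t. norm (g t - s t)) \<in> borel_measurable M"
proof (rule measurable_compose_countable'[where I = "s ` space M" and f = "\<lambda>c t. norm (g t - c)" and g = s])
  show "(\<lambda>t. norm (g t - c)) \<in> borel_measurable M" for c
    by (rule measurable_compose[OF g]) (intro borel_measurable_continuous_onI continuous_intros)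
  show "s \<in> measurable M (count_space (s ` space M))"
    using sb_integrable_simple_function[OF s] by (auto simp: measurable_def simple_function_def)
      (metis (no_types, lifting) measurable_sets measurable_simple_function s sb_integrable_simple_function sets_count_space UNIV_I Pow_UNIV)
  show "countable (s ` space M)"
    using sb_integrable_simple_function[OF s] by (simp add: simple_function_def countable_finite)
qed

text \<open>The approximating simple functions need not take values in C, but their distance to C is
  at most their distance to the integrand. By \<open>infdist_simple_integral\<close> the distance of
  their integrals to C tends to 0. Uniqueness, additivity and positivity of the integral follow by
  choosing C.\<close>

lemma has_integral_bochner_in_closure:
  fixes g1 :: "'t \<Rightarrow> 'a::banach" and g2 :: "'t \<Rightarrow> 'b::banach" and g3 :: "'t \<Rightarrow> 'c::banach"
  assumes C: "convex_cone_set C"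
    and g1: "has_integral_bochner M g1 x1" and g2: "has_integral_bochner M g2 x2"
    and g3: "has_integral_bochner M g3 x3"
    and g: "\<And>t. t \<in> space M \<Longrightarrow> (g1 t, g2 t, g3 t) \<in> C"
  shows "(x1, x2, x3) \<in> closure C"
proof -
  obtain s1 where s1: "g1 \<in> borel_measurable M" "\<And>i. sb_integrable M (s1 i)"
    "(\<lambda>i. \<integral>\<^sup>+t. ennreal (norm (g1 t - s1 i t)) \<partial>M) \<longlonglongrightarrow> 0" "(\<lambda>i. sb_integral M (s1 i)) \<longlonglongrightarrow> x1"
    using g1 unfolding has_integral_bochner_def by blast
  obtain s2 where s2: "g2 \<in> borel_measurable M" "\<And>i. sb_integrable M (s2 i)"
    "(\<lambda>i. \<integral>\<^sup>+t. ennreal (norm (g2 t - s2 i t)) \<partial>M) \<longlonglongrightarrow> 0" "(\<lambda>i. sb_integral M (s2 i)) \<longlonglongrightarrow> x2"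
    using g2 unfolding has_integral_bochner_def by blast
  obtain s3 where s3: "g3 \<in> borel_measurable M" "\<And>i. sb_integrable M (s3 i)"
    "(\<lambda>i. \<integral>\<^sup>+t. ennreal (norm (g3 t - s3 i t)) \<partial>M) \<longlonglongrightarrow> 0" "(\<lambda>i. sb_integral M (s3 i)) \<longlonglongrightarrow> x3"
    using g3 unfolding has_integral_bochner_def by blast
  define s where "s i t = (s1 i t, s2 i t, s3 i t)" for i t
  have s: "sb_integrable M (s i)" for i
    unfolding s_def
    by (intro simple_bochner_integrable_compose2[of Pair] s1 s2 s3) (simp_all add: zero_prod_def)
  have int_s: "sb_integral M (s i) = (sb_integral M (s1 i), sb_integral M (s2 i), sb_integral M (s3 i))" for i
  proof -
    have "fst (sb_integral M (s i)) = sb_integral M (\<lambda>t. fst (s i t))"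
      "fst (snd (sb_integral M (s i))) = sb_integral M (\<lambda>t. fst (snd (s i t)))"
      "snd (snd (sb_integral M (s i))) = sb_integral M (\<lambda>t. snd (snd (s i t)))"
      by (rule simple_bochner_integral_linear[OF _ s, symmetric],
          intro bounded_linear.linear bounded_linear_fst bounded_linear_snd
            bounded_linear_compose[OF bounded_linear_fst bounded_linear_snd]
            bounded_linear_compose[OF bounded_linear_snd bounded_linear_snd])+
    then show ?thesis by (simp add: s_def prod_eq_iff)
  qed
  have lim_s: "(\<lambda>i. sb_integral M (s i)) \<longlonglongrightarrow> (x1, x2, x3)"
    unfolding int_s by (intro tendsto_Pair s1 s2 s3)
  have bound: "ennreal (infdist (sb_integral M (s i)) C) \<le>
      (\<integral>\<^sup>+t. ennreal (norm (g1 t - s1 i t)) \<partial>M) + ((\<integral>\<^sup>+t. ennreal (norm (g2 t - s2 i t)) \<partial>M)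
      + (\<integral>\<^sup>+t. ennreal (norm (g3 t - s3 i t)) \<partial>M))" for i
  proof -
    note [measurable] = borel_measurable_norm_diff_simple[OF s1(1,2)]
      borel_measurable_norm_diff_simple[OF s2(1,2)] borel_measurable_norm_diff_simple[OF s3(1,2)]
    have "ennreal (infdist (sb_integral M (s i)) C) \<le> (\<integral>\<^sup>+t. ennreal (infdist (s i t) C) \<partial>M)"
      by (rule infdist_simple_integral[OF C s])
    also have "\<dots> \<le> (\<integral>\<^sup>+t. ennreal (norm (g1 t - s1 i t)) + (ennreal (norm (g2 t - s2 i t))
        + ennreal (norm (g3 t - s3 i t))) \<partial>M)"
    proof (rule nn_integral_mono)
      fix t assume t: "t \<in> space M"
      have "infdist (s i t) C \<le> dist (s i t) (g1 t, g2 t, g3 t)"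
        by (rule infdist_le[OF g[OF t]])
      also have "\<dots> = norm (g1 t - s1 i t, g2 t - s2 i t, g3 t - s3 i t)"
        by (subst dist_commute) (simp add: s_def dist_norm)
      also have "\<dots> \<le> norm (g1 t - s1 i t) + norm (g2 t - s2 i t, g3 t - s3 i t)"
        by (rule norm_Pair_le)
      also have "\<dots> \<le> norm (g1 t - s1 i t) + (norm (g2 t - s2 i t) + norm (g3 t - s3 i t))"
        by (intro add_left_mono norm_Pair_le)
      finally show "ennreal (infdist (s i t) C) \<le> ennreal (norm (g1 t - s1 i t))
          + (ennreal (norm (g2 t - s2 i t)) + ennreal (norm (g3 t - s3 i t)))"
        by (simp add: ennreal_leI flip: ennreal_plus)
    qed
    also have "\<dots> = (\<integral>\<^sup>+t. ennreal (norm (g1 t - s1 i t)) \<partial>M) + ((\<integral>\<^sup>+t. ennreal (norm (g2 t - s2 i t)) \<partial>M)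
      + (\<integral>\<^sup>+t. ennreal (norm (g3 t - s3 i t)) \<partial>M))"
      by (simp add: nn_integral_add)
    finally show ?thesis .
  qed
  have "(\<lambda>i. (\<integral>\<^sup>+t. ennreal (norm (g1 t - s1 i t)) \<partial>M) + ((\<integral>\<^sup>+t. ennreal (norm (g2 t - s2 i t)) \<partial>M)
      + (\<integral>\<^sup>+t. ennreal (norm (g3 t - s3 i t)) \<partial>M))) \<longlonglongrightarrow> 0 + (0 + 0)" (is "?B \<longlonglongrightarrow> _")
    by (intro tendsto_add s1(3) s2(3) s3(3))
  then have lim0: "?B \<longlonglongrightarrow> 0" by simp
  have "(\<lambda>i. ennreal (infdist (sb_integral M (s i)) C)) \<longlonglongrightarrow> 0"
    by (rule tendsto_sandwich[OF always_eventually always_eventually tendsto_const lim0])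
      (simp_all add: bound)
  moreover have "(\<lambda>i. ennreal (infdist (sb_integral M (s i)) C)) \<longlonglongrightarrow> ennreal (infdist (x1, x2, x3) C)"
    by (intro tendsto_ennrealI tendsto_infdist lim_s)
  ultimately have "ennreal (infdist (x1, x2, x3) C) = 0"
    using LIMSEQ_unique by blast
  then have "infdist (x1, x2, x3) C = 0"
    using infdist_nonneg[of "(x1, x2, x3)" C] by (simp add: ennreal_eq_0_iff)
  moreover have "C \<noteq> {}" using C by (auto simp: convex_cone_set_def)
  ultimately show ?thesis by (simp add: in_closure_iff_infdist_zero)
qed

text \<open>C is the closed subspace of triples whose first two entries agree; the third entry is a
  filler.\<close>

lemma has_integral_bochner_unique:
  fixes g :: "'t \<Rightarrow> 'a::banach"
  assumes "has_integral_bochner M g x" "has_integral_bochner M g y"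
  shows "x = y"
proof -
  let ?C = "{z :: 'a \<times> 'a \<times> 'a. fst z = fst (snd z)}"
  have "closed ?C" by (intro closed_Collect_eq continuous_intros)
  moreover have "(x, y, x) \<in> closure ?C"
    by (rule has_integral_bochner_in_closure[OF _ assms assms(1)]) (auto simp: convex_cone_set_def)
  ultimately show ?thesis by simp
qed

text \<open>C is the graph of addition. Integrability of the sum is a hypothesis, so no
  measurability of a sum has to be derived.\<close>

lemma has_integral_bochner_add_eq:
  fixes g :: "'t \<Rightarrow> 'a::banach"
  assumes "has_integral_bochner M g x" "has_integral_bochner M h y" "has_integral_bochner M k z"
    "\<And>t. t \<in> space M \<Longrightarrow> k t = g t + h t"
  shows "z = x + y"
proof -
  let ?C = "{z :: 'a \<times> 'a \<times> 'a. snd (snd z) = fst z + fst (snd z)}"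
  have "closed ?C" by (intro closed_Collect_eq continuous_intros)
  moreover have "(x, y, z) \<in> closure ?C"
    by (rule has_integral_bochner_in_closure[OF _ assms(1-3)])
      (auto simp: convex_cone_set_def assms(4) scaleR_add_right)
  ultimately show ?thesis by simp
qed

lemma bochner_int_eqI:
  "has_integral_bochner M (\<lambda>t. indicat_real S t *\<^sub>R g t) x \<Longrightarrow> bochner_int M S g = x"
  unfolding bochner_int_def using has_integral_bochner_unique by (intro the_equality)

text \<open>Multiplying the approximating simple functions by the indicator of S does not increase
  the error. Their integrals have no limit known beforehand, so convergence comes from the Cauchy
  criterion and completeness.\<close>

lemma bochner_integrable_restrict:
  fixes g :: "'t \<Rightarrow> 'a::banach"
  assumes g: "bochner_integrable M g" and S: "S \<in> sets M"
  shows "has_integral_bochner M (\<lambda>t. indicat_real S t *\<^sub>R g t) (bochner_int M S g)"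
proof -
  let ?g = "\<lambda>t. indicat_real S t *\<^sub>R g t"
  obtain s x where s: "g \<in> borel_measurable M" "\<And>i. sb_integrable M (s i)"
    "(\<lambda>i. \<integral>\<^sup>+t. ennreal (norm (g t - s i t)) \<partial>M) \<longlonglongrightarrow> 0" "(\<lambda>i. sb_integral M (s i)) \<longlonglongrightarrow> x"
    using g unfolding bochner_integrable_def has_integral_bochner_def by blast
  define s' where "s' i t = indicat_real S t *\<^sub>R s i t" for i t
  have s': "sb_integrable M (s' i)" for i
  proof -
    note sf = sb_integrable_simple_function[OF s(2), of i]
    have "simple_function M (s' i)"
      unfolding s'_def by (intro simple_function_compose2[where h = "(*\<^sub>R)"] simple_function_indicator S sf)
    moreover have "emeasure M {t \<in> space M. s' i t \<noteq> 0} \<le> emeasure M {t \<in> space M. s i t \<noteq> 0}"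
    proof (rule emeasure_mono)
      have "{t \<in> space M. s i t \<noteq> 0} = s i -` (- {0}) \<inter> space M" by auto
      then show "{t \<in> space M. s i t \<noteq> 0} \<in> sets M"
        using measurable_sets[OF measurable_simple_function[OF sf], of "- {0}"] by simp
    qed (auto simp: s'_def)
    ultimately show ?thesis
      using s(2)[of i] by (auto simp: simple_bochner_integrable.simps top_unique)
  qed
  have meas: "?g \<in> borel_measurable M"
  proof -
    have "?g = (\<lambda>t. if t \<in> S then g t else 0)" by (auto simp: indicator_def)
    then show ?thesis using S s(1) by (simp add: measurable_If_set)
  qed
  have le: "(\<integral>\<^sup>+t. ennreal (norm (?g t - s' i t)) \<partial>M) \<le> (\<integral>\<^sup>+t. ennreal (norm (g t - s i t)) \<partial>M)" for i
    by (intro nn_integral_mono) (auto simp: s'_def indicator_def)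
  have lim0: "(\<lambda>i. \<integral>\<^sup>+t. ennreal (norm (?g t - s' i t)) \<partial>M) \<longlonglongrightarrow> 0"
    by (rule tendsto_sandwich[OF always_eventually always_eventually tendsto_const s(3)])
      (simp_all add: le)
  have Cauchy: "Cauchy (\<lambda>i. sb_integral M (s' i))"
  proof (rule CauchyI)
    fix \<epsilon> :: real assume \<epsilon>: "\<epsilon> > 0"
    have "\<forall>\<^sub>F i in sequentially. (\<integral>\<^sup>+t. ennreal (norm (?g t - s' i t)) \<partial>M) < ennreal (\<epsilon> / 2)"
      using order_tendstoD(2)[OF lim0, of "ennreal (\<epsilon> / 2)"] \<epsilon> by simp
    then obtain N where N: "\<And>i. i \<ge> N \<Longrightarrow> (\<integral>\<^sup>+t. ennreal (norm (?g t - s' i t)) \<partial>M) < ennreal (\<epsilon> / 2)"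
      unfolding eventually_sequentially by blast
    have "norm (sb_integral M (s' m) - sb_integral M (s' n)) < \<epsilon>" if mn: "m \<ge> N" "n \<ge> N" for m n
    proof -
      have d: "sb_integrable M (\<lambda>t. s' m t - s' n t)"
        by (intro simple_bochner_integrable_compose2[of "(-)"] s') simp
      have nd: "sb_integrable M (\<lambda>t. norm (s' m t - s' n t))"
        using simple_bochner_integrable_compose2[of "\<lambda>x y. norm x" M, OF _ d d] by simp
      have "ennreal (norm (sb_integral M (s' m) - sb_integral M (s' n)))
          \<le> ennreal (sb_integral M (\<lambda>t. norm (s' m t - s' n t)))"
        unfolding simple_bochner_integral_diff[OF s' s', symmetric]
        by (intro ennreal_leI simple_bochner_integral_norm_bound d)
      also have "\<dots> = (\<integral>\<^sup>+t. ennreal (norm (s' m t - s' n t)) \<partial>M)"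
        by (rule simple_bochner_integral_eq_nn_integral[OF nd]) simp
      also have "\<dots> \<le> (\<integral>\<^sup>+t. ennreal (norm (?g t - s' m t)) + ennreal (norm (?g t - s' n t)) \<partial>M)"
      proof (rule nn_integral_mono)
        fix t
        have "norm (s' m t - s' n t) \<le> norm (?g t - s' m t) + norm (?g t - s' n t)"
          using norm_triangle_ineq4[of "?g t - s' n t" "?g t - s' m t"] by simp
        then show "ennreal (norm (s' m t - s' n t)) \<le> ennreal (norm (?g t - s' m t)) + ennreal (norm (?g t - s' n t))"
          by (simp add: ennreal_leI flip: ennreal_plus)
      qed
      also have "\<dots> = (\<integral>\<^sup>+t. ennreal (norm (?g t - s' m t)) \<partial>M) + (\<integral>\<^sup>+t. ennreal (norm (?g t - s' n t)) \<partial>M)"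
        using borel_measurable_norm_diff_simple[OF meas s', of m]
          borel_measurable_norm_diff_simple[OF meas s', of n]
        by (intro nn_integral_add) simp_all
      also have "\<dots> < ennreal (\<epsilon> / 2) + ennreal (\<epsilon> / 2)"
        by (intro add_strict_mono N mn)
      also have "\<dots> = ennreal \<epsilon>" using \<epsilon> by (simp flip: ennreal_plus)
      finally show ?thesis by (simp add: ennreal_less_iff)
    qed
    then show "\<exists>K. \<forall>m\<ge>K. \<forall>n\<ge>K. norm (sb_integral M (s' m) - sb_integral M (s' n)) < \<epsilon>"
      by blast
  qed
  obtain y where y: "(\<lambda>i. sb_integral M (s' i)) \<longlonglongrightarrow> y"
    using Cauchy unfolding Cauchy_convergent_iff convergent_def by (rule exE)
  have "has_integral_bochner M ?g y"
    unfolding has_integral_bochner_def using meas s' lim0 y by blast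
  then show ?thesis using bochner_int_eqI by metis
qed

lemma has_integral_bochner_indicator:
  fixes c :: "'a::banach"
  assumes F: "F \<in> sets M" and fin: "finite_measure M"
  shows "has_integral_bochner M (\<lambda>t. indicat_real F t *\<^sub>R c) (measure M F *\<^sub>R c)"
proof -
  let ?i = "\<lambda>t. indicat_real F t"
  have i: "sb_integrable M ?i"
  proof
    show "simple_function M ?i" by (rule simple_function_indicator[OF F])
    show "emeasure M {y \<in> space M. ?i y \<noteq> 0} \<noteq> \<infinity>"
      using finite_measure.emeasure_finite[OF fin] by simp
  qed
  have s: "sb_integrable M (\<lambda>t. ?i t *\<^sub>R c)"
    using simple_bochner_integrable_compose2[of "\<lambda>x y. x *\<^sub>R c" M ?i ?i] i by simp
  have "ennreal (sb_integral M ?i) = (\<integral>\<^sup>+t. ennreal (?i t) \<partial>M)"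
    by (rule simple_bochner_integral_eq_nn_integral[OF i]) simp
  also have "\<dots> = emeasure M F"
    using F by (simp add: ennreal_indicator)
  also have "\<dots> = ennreal (measure M F)"
    by (simp add: finite_measure.emeasure_eq_measure[OF fin])
  finally have "sb_integral M ?i = measure M F"
    by (simp add: ennreal_inj)
  then have "sb_integral M (\<lambda>t. ?i t *\<^sub>R c) = measure M F *\<^sub>R c"
    using simple_bochner_integral_linear[OF bounded_linear.linear[OF bounded_linear_scaleR_left] i, of c] by simp
  then show ?thesis
    unfolding has_integral_bochner_def
    using s borel_measurable_simple_function[OF sb_integrable_simple_function[OF s]]
    by (intro conjI exI[of _ "\<lambda>_ t. ?i t *\<^sub>R c"]) auto
qed

section \<open>The Jensen cone\<close>

text \<open>The value at f of the continuous extension of L. Requiring the limit along every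
  approximating sequence leaves the choice free: Bernstein polynomials in \<open>pfc_jensen\<close>,
  and polynomials approximating on a larger interval in \<open>jensen_cone_add\<close>.\<close>

definition pfc_value ::
    "real \<Rightarrow> real \<Rightarrow> (real poly \<Rightarrow> 'k::chilbert \<Rightarrow>\<^sub>L 'k) \<Rightarrow> (real \<Rightarrow> real) \<Rightarrow> ('k \<Rightarrow>\<^sub>L 'k) \<Rightarrow> bool" where
  "pfc_value a b L f G \<longleftrightarrow>
     (\<forall>q. uniform_limit {a..b} (\<lambda>n. poly (q n)) f sequentially \<longrightarrow> (\<lambda>n. L (q n)) \<longlonglongrightarrow> G)"

text \<open>The interval belongs to the triple and is not fixed in advance, since a field of
  operators over a noncompact space may leave every compact part of \<open>J\<close>.\<close>

definition jensen_cone :: "real set \<Rightarrow> (real \<Rightarrow> real) \<Rightarrow>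
    (('k::chilbert \<Rightarrow>\<^sub>L 'k) \<times> ('k \<Rightarrow>\<^sub>L 'k) \<times> ('k \<Rightarrow>\<^sub>L 'k)) set" where
  "jensen_cone J f = {(D, Z, G). \<exists>a b L. a \<in> J \<and> b \<in> J \<and> a \<le> b \<and>
     positive_functional_calculus a b L \<and> L 1 = D \<and> L [:0, 1:] = Z \<and> pfc_value a b L f G}"

lemma pfc_valueD:
  "pfc_value a b L f G \<Longrightarrow> uniform_limit {a..b} (\<lambda>n. poly (q n)) f sequentially \<Longrightarrow> (\<lambda>n. L (q n)) \<longlonglongrightarrow> G"
  unfolding pfc_value_def by simp

lemma jensen_coneI:
  assumes "a \<in> J" "b \<in> J" "a \<le> b" "positive_functional_calculus a b L" "L 1 = D" "L [:0, 1:] = Z"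
    "\<And>q. uniform_limit {a..b} (\<lambda>n. poly (q n)) f sequentially \<Longrightarrow> (\<lambda>n. L (q n)) \<longlonglongrightarrow> G"
  shows "(D, Z, G) \<in> jensen_cone J f"
proof -
  have "pfc_value a b L f G" using assms(7) by (simp add: pfc_value_def)
  then show ?thesis
    unfolding jensen_cone_def mem_Collect_eq prod.case
    by (intro exI[of _ a] exI[of _ b] exI[of _ L] conjI assms(1-6))
qed

lemma jensen_coneE:
  assumes "(D, Z, G) \<in> jensen_cone J f"
  obtains a b L where "a \<in> J" "b \<in> J" "a \<le> b" "positive_functional_calculus a b L"
    "L 1 = D" "L [:0, 1:] = Z" "pfc_value a b L f G"
  using assms unfolding jensen_cone_def mem_Collect_eq prod.case by (elim exE conjE) (rule that)

lemma is_interval_Icc_subset: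
  assumes "is_interval J" "a \<in> J" "b \<in> J"
  shows "{a..b :: real} \<subseteq> J"
proof
  fix x assume "x \<in> {a..b}"
  then show "x \<in> J" by (intro mem_is_interval_1_I[OF assms]) auto
qed

text \<open>Both maps are regarded on the smallest interval that contains the two given ones:
  positivity there is a stronger requirement on a polynomial, and uniform approximation there
  restricts to both.\<close>

lemma jensen_cone_add:
  assumes "(D, Z, G) \<in> jensen_cone J f" "(D', Z', G') \<in> jensen_cone J f"
  shows "(D + D', Z + Z', G + G') \<in> jensen_cone J f"
proof -
  obtain a b L where L: "a \<in> J" "b \<in> J" "a \<le> b" "positive_functional_calculus a b L" "L 1 = D" "L [:0, 1:] = Z" "pfc_value a b L f G"
    using jensen_coneE[OF assms(1)] .
  obtain a' b' L' where L': "a' \<in> J" "b' \<in> J" "a' \<le> b'" "positive_functional_calculus a' b' L'" "L' 1 = D'" "L' [:0, 1:] = Z'"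
    "pfc_value a' b' L' f G'"
    using jensen_coneE[OF assms(2)] .
  show ?thesis
  proof (rule jensen_coneI[of "min a a'" _ "max b b'" "\<lambda>p. L p + L' p"])
    show "positive_functional_calculus (min a a') (max b b') (\<lambda>p. L p + L' p)"
      unfolding positive_functional_calculus_def
    proof (intro conjI allI impI)
      fix p :: "real poly" assume p: "\<forall>r\<in>{min a a'..max b b'}. 0 \<le> poly p r"
      show "positive_op (L p + L' p)"
        using p by (intro positive_op_add pfcD(3)[OF L(4)] pfcD(3)[OF L'(4)])
          (simp_all add: min_le_iff_disj le_max_iff_disj)
    qed (simp_all add: pfcD[OF L(4)] pfcD[OF L'(4)] scaleR_add_right)
    fix q :: "nat \<Rightarrow> real poly"
    assume q: "uniform_limit {min a a'..max b b'} (\<lambda>n. poly (q n)) f sequentially"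
    show "(\<lambda>n. L (q n) + L' (q n)) \<longlonglongrightarrow> G + G'"
      by (intro tendsto_add pfc_valueD[OF L(7)] pfc_valueD[OF L'(7)] uniform_limit_on_subset[OF q]) auto
  qed (use L L' in \<open>auto simp: min_def max_def\<close>)
qed

lemma jensen_cone_image:
  assumes C: "(D, Z, G) \<in> jensen_cone J f" and \<phi>: "bounded_linear \<phi>"
    and pos: "\<And>X. positive_op X \<Longrightarrow> positive_op (\<phi> X)"
  shows "(\<phi> D, \<phi> Z, \<phi> G) \<in> jensen_cone J f"
proof -
  obtain a b L where L: "a \<in> J" "b \<in> J" "a \<le> b" "positive_functional_calculus a b L" "L 1 = D" "L [:0, 1:] = Z" "pfc_value a b L f G"
    using jensen_coneE[OF C] .
  interpret \<phi>: bounded_linear \<phi> by fact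
  show ?thesis
  proof (rule jensen_coneI[of a _ b "\<lambda>p. \<phi> (L p)"])
    show "positive_functional_calculus a b (\<lambda>p. \<phi> (L p))"
      unfolding positive_functional_calculus_def
      by (auto simp: pfcD(1,2)[OF L(4)] \<phi>.add \<phi>.scaleR intro!: pos pfcD(3)[OF L(4)])
    show "(\<lambda>n. \<phi> (L (q n))) \<longlonglongrightarrow> \<phi> G" if "uniform_limit {a..b} (\<lambda>n. poly (q n)) f sequentially" for q
      by (intro \<phi>.tendsto pfc_valueD[OF L(7) that])
  qed (use L in auto)
qed

lemma bounded_linear_conj: "bounded_linear (\<lambda>X. S o\<^sub>L X o\<^sub>L S)"
  by (intro bounded_linear_compose[OF bounded_bilinear.bounded_linear_left[OF bounded_bilinear_blinfun_compose]
        bounded_bilinear.bounded_linear_right[OF bounded_bilinear_blinfun_compose]])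

lemma jensen_cone_scaleR:
  "(D, Z, G) \<in> jensen_cone J f \<Longrightarrow> 0 \<le> r \<Longrightarrow> (r *\<^sub>R D, r *\<^sub>R Z, r *\<^sub>R G) \<in> jensen_cone J f"
  by (erule jensen_cone_image) (auto intro: bounded_linear_scaleR_right positive_op_scaleR)

lemma jensen_cone_conj:
  "(D, Z, G) \<in> jensen_cone J f \<Longrightarrow> selfadjoint S \<Longrightarrow>
    (S o\<^sub>L D o\<^sub>L S, S o\<^sub>L Z o\<^sub>L S, S o\<^sub>L G o\<^sub>L S) \<in> jensen_cone J f"
  by (erule jensen_cone_image) (auto intro: bounded_linear_conj positive_op_conj)

text \<open>The point mass p \<mapsto> p(x) P on the one-point interval.\<close>

lemma jensen_cone_point:
  assumes x: "x \<in> J" and P: "positive_op P"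
  shows "(P, x *\<^sub>R P, f x *\<^sub>R P) \<in> jensen_cone J f"
proof (rule jensen_coneI[of x _ x "\<lambda>p. poly p x *\<^sub>R P"])
  show "positive_functional_calculus x x (\<lambda>p. poly p x *\<^sub>R P)"
    using P by (auto simp: positive_functional_calculus_def scaleR_add_left intro: positive_op_scaleR)
  fix q :: "nat \<Rightarrow> real poly"
  assume "uniform_limit {x..x} (\<lambda>n. poly (q n)) f sequentially"
  then have "(\<lambda>n. poly (q n) x) \<longlonglongrightarrow> f x"
    by (rule tendsto_uniform_limitI) simp
  then show "(\<lambda>n. poly (q n) x *\<^sub>R P) \<longlonglongrightarrow> f x *\<^sub>R P"
    by (intro tendsto_scaleR tendsto_const)
qed (use x in auto)

lemma jensen_cone_zero: "J \<noteq> {} \<Longrightarrow> (0, 0, 0) \<in> jensen_cone J f"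
  using jensen_cone_point[of _ J 0 f] positive_op_zero by auto

lemma jensen_cone_convex: "J \<noteq> {} \<Longrightarrow> convex_cone_set (jensen_cone J f)"
  unfolding convex_cone_set_def zero_prod_def
  by (auto simp: jensen_cone_zero jensen_cone_add jensen_cone_scaleR)

text \<open>The witness is p \<mapsto> \<phi> (p(X)). Conditions on \<phi> are imposed only on
  polynomials in X and their limit, so that it may be a congruence defined everywhere as well as a
  positive map on an algebra.\<close>

lemma jensen_cone_functional_calculus:
  assumes X: "selfadjoint X" "form_in id_blinfun a b X" and ab: "a \<in> J" "b \<in> J" "a \<le> b"
    and \<phi>: "\<And>p q. \<phi> (op_poly id_blinfun p X + op_poly id_blinfun q X)
        = \<phi> (op_poly id_blinfun p X) + \<phi> (op_poly id_blinfun q X)"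
      "\<And>c p. \<phi> (c *\<^sub>R op_poly id_blinfun p X) = c *\<^sub>R \<phi> (op_poly id_blinfun p X)"
      "\<And>p. positive_op (op_poly id_blinfun p X) \<Longrightarrow> positive_op (\<phi> (op_poly id_blinfun p X))"
      "\<And>q. (\<lambda>n. op_poly id_blinfun (q n) X) \<longlonglongrightarrow> cfc f X \<Longrightarrow>
        (\<lambda>n. \<phi> (op_poly id_blinfun (q n) X)) \<longlonglongrightarrow> \<phi> (cfc f X)"
  shows "(\<phi> id_blinfun, \<phi> X, \<phi> (cfc f X)) \<in> jensen_cone J f"
proof (rule jensen_coneI[OF ab, of "\<lambda>p. \<phi> (op_poly id_blinfun p X)"])
  have sa: "sa_on id_blinfun X" using X by (simp add: sa_on_id)
  show "positive_functional_calculus a b (\<lambda>p. \<phi> (op_poly id_blinfun p X))"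
    unfolding positive_functional_calculus_def
  proof (intro conjI allI impI)
    fix p :: "real poly" assume p: "\<forall>r\<in>{a..b}. 0 \<le> poly p r"
    have "positive_op (op_poly id_blinfun p X)"
      using p form_in_spectrum_real[OF sa X(2)] sa_onD(3)[OF op_poly_sa_on[OF sa]]
      by (intro positive_opI op_poly_nonneg[OF sa]) auto
    then show "positive_op (\<phi> (op_poly id_blinfun p X))" by (rule \<phi>)
  qed (simp_all add: op_poly_add op_poly_smult \<phi>)
  show "\<phi> (op_poly id_blinfun 1 X) = \<phi> id_blinfun" "\<phi> (op_poly id_blinfun [:0, 1:] X) = \<phi> X"
    using sa_onD[OF sa] by (simp_all add: op_poly_one op_poly_X)
  show "(\<lambda>n. \<phi> (op_poly id_blinfun (q n) X)) \<longlonglongrightarrow> \<phi> (cfc f X)"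
    if "uniform_limit {a..b} (\<lambda>n. poly (q n)) f sequentially" for q
    by (rule \<phi>(4)[OF cfc_on_tendsto[OF sa X(2) that]])
qed

lemma jensen_cone_selfadjoint:
  assumes C: "(D, Z, G) \<in> jensen_cone J f" and f: "continuous_on J f" and J: "is_interval J"
  shows "selfadjoint D" "selfadjoint Z" "selfadjoint G"
proof -
  obtain a b L where L: "a \<in> J" "b \<in> J" "a \<le> b" "positive_functional_calculus a b L" "L 1 = D" "L [:0, 1:] = Z" "pfc_value a b L f G"
    using jensen_coneE[OF C] .
  have cont: "continuous_on {a..b} f"
    using f is_interval_Icc_subset[OF J L(1,2)] by (rule continuous_on_subset)
  obtain q where "uniform_limit {a..b} (\<lambda>n. poly (q n)) f sequentially"
    using polynomial_approximation[OF cont] .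
  then show "selfadjoint G"
    by (rule selfadjoint_limit[OF pfc_valueD[OF L(7)] pfc_selfadjoint[OF L(4)]])
  show "selfadjoint D" "selfadjoint Z"
    using pfc_selfadjoint[OF L(4)] L(5,6) by blast+
qed

lemma jensen_cone_normalised:
  fixes Z G :: "'k::chilbert \<Rightarrow>\<^sub>L 'k"
  assumes universe: "infinite_dimensional TYPE('u::chilbert)"
    and convex: "operator_convex_on TYPE('u) J f" and J: "is_interval J"
    and C: "(id_blinfun, Z, G) \<in> jensen_cone J f"
  shows "qform (cfc f Z) \<xi> \<le> qform G \<xi>" "\<exists>a\<in>J. \<exists>b\<in>J. form_in id_blinfun a b Z"
proof -
  obtain a b L where L: "a \<in> J" "b \<in> J" "a \<le> b" "positive_functional_calculus a b L"
    "L 1 = id_blinfun" "L [:0, 1:] = Z" "pfc_value a b L f G"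
    using jensen_coneE[OF C] .
  show "qform (cfc f Z) \<xi> \<le> qform G \<xi>"
    using pfc_jensen[OF universe convex is_interval_Icc_subset[OF J L(1,2)] L(3,4,5) pfc_valueD[OF L(7)]] L(6) by simp
  have const: "L [:c:] = c *\<^sub>R id_blinfun" for c
    using pfcD(2)[OF L(4), of c 1] by (simp add: L(5))
  have "a * qform id_blinfun x \<le> qform Z x \<and> qform Z x \<le> b * qform id_blinfun x" for x
    using pfc_bounds[OF L(4), of "[:a:]" "[:0, 1:]" x] pfc_bounds[OF L(4), of "[:0, 1:]" "[:b:]" x]
    by (simp add: const L(6) qform_scaleR)
  then show "\<exists>a\<in>J. \<exists>b\<in>J. form_in id_blinfun a b Z"
    using L(1,2) unfolding form_in_def by blast
qed

text \<open>\<open>J\<close> may be open or closed at either end. If it has a point below a,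
  convergence makes that point a lower bound for all large n; otherwise a is the least element of
  \<open>J\<close> and bounds every \<open>Z n\<close> through the endpoints given for it. The upper
  end is symmetric.\<close>

lemma eventually_form_in_interval:
  fixes X :: "'k::chilbert \<Rightarrow>\<^sub>L 'k"
  assumes J: "a \<in> J" "b \<in> J" and X: "form_in id_blinfun a b X" and lim: "Z \<longlonglongrightarrow> X"
    and Z: "\<And>n::nat. \<exists>a\<in>J. \<exists>b\<in>J. form_in id_blinfun a b (Z n)"
  obtains a' b' where "a' \<in> J" "b' \<in> J" "\<forall>\<^sub>F n in sequentially. form_in id_blinfun a' b' (Z n)"
proof -
  have close: "\<forall>\<^sub>F n in sequentially. \<forall>x. \<bar>qform (Z n) x - qform X x\<bar> \<le> \<delta> * (norm x)\<^sup>2" if "\<delta> > 0" for \<delta>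
    using tendstoD[OF lim that]
  proof eventually_elim
    case (elim n)
    have "\<bar>qform (Z n - X) x\<bar> \<le> \<delta> * (norm x)\<^sup>2" for x
    proof -
      have "\<bar>qform (Z n - X) x\<bar> \<le> norm (Z n - X) * (norm x)\<^sup>2" by (rule abs_qform_le)
      also have "\<dots> \<le> \<delta> * (norm x)\<^sup>2" using elim by (intro mult_right_mono) (auto simp: dist_norm)
      finally show ?thesis .
    qed
    then show ?case by (simp add: qform_simps)
  qed
  have Xab: "a * (norm x)\<^sup>2 \<le> qform X x" "qform X x \<le> b * (norm x)\<^sup>2" for x
    using X by (simp_all add: form_in_def qform_id)
  have "\<exists>a'\<in>J. \<forall>\<^sub>F n in sequentially. \<forall>x. a' * (norm x)\<^sup>2 \<le> qform (Z n) x"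
  proof (cases "\<exists>a'\<in>J. a' < a")
    case True
    then obtain a' where a': "a' \<in> J" "a' < a" by blast
    have "\<forall>\<^sub>F n in sequentially. \<forall>x. a' * (norm x)\<^sup>2 \<le> qform (Z n) x"
      using close[of "a - a'"] a'(2)
    proof (simp, elim eventually_mono, intro allI)
      fix n x
      assume "\<forall>x. \<bar>qform (Z n) x - qform X x\<bar> \<le> (a - a') * (norm x)\<^sup>2"
      then have "\<bar>qform (Z n) x - qform X x\<bar> \<le> a * (norm x)\<^sup>2 - a' * (norm x)\<^sup>2"
        by (simp add: left_diff_distrib)
      then show "a' * (norm x)\<^sup>2 \<le> qform (Z n) x" using Xab(1)[of x] by linarith
    qed
    then show ?thesis using a' by blast
  next
    case False
    have "a * (norm x)\<^sup>2 \<le> qform (Z n) x" for n x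
    proof -
      obtain a0 b0 where a0: "a0 \<in> J" "form_in id_blinfun a0 b0 (Z n)" using Z by blast
      then have "a \<le> a0" using False by force
      then have "a * (norm x)\<^sup>2 \<le> a0 * (norm x)\<^sup>2" by (intro mult_right_mono) auto
      also have "\<dots> \<le> qform (Z n) x" using a0(2) by (simp add: form_in_def qform_id)
      finally show ?thesis .
    qed
    then show ?thesis using J(1) by (intro bexI[of _ a]) auto
  qed
  then obtain a' where a': "a' \<in> J" "\<forall>\<^sub>F n in sequentially. \<forall>x. a' * (norm x)\<^sup>2 \<le> qform (Z n) x" by blast
  have "\<exists>b'\<in>J. \<forall>\<^sub>F n in sequentially. \<forall>x. qform (Z n) x \<le> b' * (norm x)\<^sup>2"
  proof (cases "\<exists>b'\<in>J. b < b'")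
    case True
    then obtain b' where b': "b' \<in> J" "b < b'" by blast
    have "\<forall>\<^sub>F n in sequentially. \<forall>x. qform (Z n) x \<le> b' * (norm x)\<^sup>2"
      using close[of "b' - b"] b'(2)
    proof (simp, elim eventually_mono, intro allI)
      fix n x
      assume "\<forall>x. \<bar>qform (Z n) x - qform X x\<bar> \<le> (b' - b) * (norm x)\<^sup>2"
      then have "\<bar>qform (Z n) x - qform X x\<bar> \<le> b' * (norm x)\<^sup>2 - b * (norm x)\<^sup>2"
        by (simp add: left_diff_distrib)
      then show "qform (Z n) x \<le> b' * (norm x)\<^sup>2" using Xab(2)[of x] by linarith
    qed
    then show ?thesis using b' by blast
  next
    case False
    have "qform (Z n) x \<le> b * (norm x)\<^sup>2" for n x
    proof -
      obtain a0 b0 where b0: "b0 \<in> J" "form_in id_blinfun a0 b0 (Z n)" using Z by blast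
      then have "qform (Z n) x \<le> b0 * (norm x)\<^sup>2" by (simp add: form_in_def qform_id)
      also have "b0 \<le> b" using False b0 by force
      then have "b0 * (norm x)\<^sup>2 \<le> b * (norm x)\<^sup>2" by (intro mult_right_mono) auto
      finally show ?thesis .
    qed
    then show ?thesis using J(2) by (intro bexI[of _ b]) auto
  qed
  then obtain b' where b': "b' \<in> J" "\<forall>\<^sub>F n in sequentially. \<forall>x. qform (Z n) x \<le> b' * (norm x)\<^sup>2" by blast
  have "\<forall>\<^sub>F n in sequentially. form_in id_blinfun a' b' (Z n)"
    using a'(2) b'(2) by eventually_elim (simp add: form_in_def qform_id)
  then show ?thesis using a'(1) b'(1) that by blast
qed

text \<open>A triple of the closure with first entry \<open>I\<close> is approximated by triples whose first entry is
  exactly \<open>I\<close>: shrink it below \<open>I\<close> and add a multiple of a point mass.\<close>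

lemma jensen_closure:
  fixes X G :: "'k::chilbert \<Rightarrow>\<^sub>L 'k"
  assumes universe: "infinite_dimensional TYPE('u::chilbert)"
    and convex: "operator_convex_on TYPE('u) J f" and J: "is_interval J"
    and C: "(id_blinfun, X, G) \<in> closure (jensen_cone J f)"
    and ab: "a \<in> J" "b \<in> J" and X: "form_in id_blinfun a b X"
  shows "cfc f X \<preceq> G"
proof -
  have cont: "continuous_on J f" using convex by (simp add: operator_convex_on_def)
  obtain s where s: "\<And>n. s n \<in> jensen_cone J f" "s \<longlonglongrightarrow> (id_blinfun, X, G)"
    using C unfolding closure_sequential by blast
  define D where "D n = fst (s n)" for n
  define Z where "Z n = fst (snd (s n))" for n
  define H where "H n = snd (snd (s n))" for n
  have s_eq: "(D n, Z n, H n) \<in> jensen_cone J f" for n using s(1) by (simp add: D_def Z_def H_def)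
  have D: "D \<longlonglongrightarrow> id_blinfun" and Z: "Z \<longlonglongrightarrow> X" and H: "H \<longlonglongrightarrow> G"
    using tendsto_fst[OF s(2)] tendsto_fst[OF tendsto_snd[OF s(2)]] tendsto_snd[OF tendsto_snd[OF s(2)]]
    by (simp_all add: D_def[abs_def] Z_def[abs_def] H_def[abs_def])
  define \<epsilon> where "\<epsilon> n = norm (D n - id_blinfun)" for n
  have \<epsilon>: "\<epsilon> \<longlonglongrightarrow> 0"
    unfolding \<epsilon>_def using tendsto_norm[OF tendsto_diff[OF D tendsto_const[of id_blinfun]]] by simp
  have \<epsilon>0: "0 \<le> \<epsilon> n" for n by (simp add: \<epsilon>_def)
  \<comment> \<open>D n \<le> (1 + \<epsilon> n) I, so this factor brings D n below the identity; it
    tends to 1.\<close>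
  define r where "r n = 1 / (1 + \<epsilon> n)" for n
  have r: "r \<longlonglongrightarrow> 1"
    unfolding r_def using tendsto_divide[OF tendsto_const[of 1] tendsto_add[OF tendsto_const[of 1] \<epsilon>]] by simp
  have r0: "0 \<le> r n" for n using \<epsilon>0[of n] by (simp add: r_def)
  define P where "P n = id_blinfun - r n *\<^sub>R D n" for n
  have P_lim: "P \<longlonglongrightarrow> 0"
    unfolding P_def using tendsto_diff[OF tendsto_const[of id_blinfun] tendsto_scaleR[OF r D]] by simp
  have P: "positive_op (P n)" for n
  proof (rule positive_opI)
    show "selfadjoint (P n)"
      unfolding P_def
      by (intro selfadjoint_diff selfadjoint_id selfadjoint_scaleR jensen_cone_selfadjoint(1)[OF s_eq cont J])
    fix x
    have "qform (D n) x - (norm x)\<^sup>2 \<le> \<epsilon> n * (norm x)\<^sup>2"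
      using abs_qform_le[of "D n - id_blinfun" x] by (simp add: \<epsilon>_def qform_simps qform_id)
    then have "qform (D n) x \<le> (1 + \<epsilon> n) * (norm x)\<^sup>2" by (simp add: algebra_simps)
    then show "0 \<le> qform (P n) x"
      using \<epsilon>0[of n] by (simp add: P_def qform_simps qform_id r_def field_simps)
  qed
  \<comment> \<open>The point mass sits at a because a lies in \<open>J\<close>. Its weight
    \<open>P n\<close> tends to 0, so the limits X and G are unchanged.\<close>
  define Z' where "Z' n = r n *\<^sub>R Z n + a *\<^sub>R P n" for n
  define H' where "H' n = r n *\<^sub>R H n + f a *\<^sub>R P n" for n
  have "(r n *\<^sub>R D n + P n, Z' n, H' n) \<in> jensen_cone J f" for n
    unfolding Z'_def H'_def
    by (intro jensen_cone_add jensen_cone_scaleR s_eq r0 jensen_cone_point ab P)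
  then have C': "(id_blinfun, Z' n, H' n) \<in> jensen_cone J f" for n by (simp add: P_def)
  have Z': "Z' \<longlonglongrightarrow> X"
    unfolding Z'_def using tendsto_add[OF tendsto_scaleR[OF r Z] tendsto_scaleR[OF tendsto_const[of a] P_lim]] by simp
  have H': "H' \<longlonglongrightarrow> G"
    unfolding H'_def using tendsto_add[OF tendsto_scaleR[OF r H] tendsto_scaleR[OF tendsto_const[of "f a"] P_lim]] by simp
  have sa_Z': "sa_on id_blinfun (Z' n)" for n
    unfolding sa_on_id by (rule jensen_cone_selfadjoint(2)[OF C' cont J])
  obtain a' b' where ab': "a' \<in> J" "b' \<in> J" "\<forall>\<^sub>F n in sequentially. form_in id_blinfun a' b' (Z' n)"
    using eventually_form_in_interval[OF ab X Z' jensen_cone_normalised(2)[OF universe convex J C']] .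
  have cont': "continuous_on {a'..b'} f"
    by (rule continuous_on_subset[OF cont is_interval_Icc_subset[OF J ab'(1,2)]])
  have lim: "(\<lambda>n. cfc f (Z' n)) \<longlonglongrightarrow> cfc f X"
    by (rule tendsto_cfc_on[OF Z' sa_Z' ab'(3) cont'])
  have saX: "sa_on id_blinfun X" by (rule sa_on_limit[OF Z' sa_Z'])
  have "selfadjoint (cfc f X)"
    using cfc_on_sa[OF saX X continuous_on_subset[OF cont is_interval_Icc_subset[OF J ab]]]
    by (simp add: sa_on_id)
  moreover have "selfadjoint G"
    by (rule selfadjoint_limit[OF H' jensen_cone_selfadjoint(3)[OF C' cont J]])
  moreover have "qform (cfc f X) x \<le> qform G x" for x
    by (rule LIMSEQ_le[OF tendsto_qform[OF lim] tendsto_qform[OF H']])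
      (use jensen_cone_normalised(1)[OF universe convex J C'] in blast)
  ultimately show ?thesis by (rule op_leI)
qed

section \<open>Perspectives\<close>

lemma closure_image_triple:
  fixes \<phi> :: "'a::real_normed_vector \<Rightarrow> 'a"
  assumes \<phi>: "bounded_linear \<phi>" and im: "\<And>D Z G. (D, Z, G) \<in> C \<Longrightarrow> (\<phi> D, \<phi> Z, \<phi> G) \<in> C"
    and C: "(D, Z, G) \<in> closure C"
  shows "(\<phi> D, \<phi> Z, \<phi> G) \<in> closure C"
proof -
  obtain s where s: "\<And>n. s n \<in> C" "s \<longlonglongrightarrow> (D, Z, G)"
    using C unfolding closure_sequential by blast
  have lim: "(\<lambda>n. (\<phi> (fst (s n)), \<phi> (fst (snd (s n))), \<phi> (snd (snd (s n))))) \<longlonglongrightarrow> (\<phi> D, \<phi> Z, \<phi> G)"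
    using tendsto_fst[OF s(2)] tendsto_fst[OF tendsto_snd[OF s(2)]] tendsto_snd[OF tendsto_snd[OF s(2)]]
    by (intro tendsto_Pair bounded_linear.tendsto[OF \<phi>]) simp_all
  have "(\<phi> (fst (s n)), \<phi> (fst (snd (s n))), \<phi> (snd (snd (s n)))) \<in> C" for n
    using s(1)[of n] by (intro im) simp
  then show ?thesis
    unfolding closure_sequential using lim by (intro exI conjI allI)
qed

lemma perspective_normalise:
  assumes D: "positive_op D" and inv: "invertible_op D"
  defines "S \<equiv> op_powr D (-1/2)" and "R \<equiv> op_powr D (1/2)"
  shows "selfadjoint S" "selfadjoint R" "S o\<^sub>L D o\<^sub>L S = id_blinfun" "R o\<^sub>L R = D"
    "R o\<^sub>L (S o\<^sub>L X o\<^sub>L S) o\<^sub>L R = X"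
proof -
  note half = op_powr_half[OF positive_op_selfadjoint[OF D] positive_op_qform[OF D] inv]
  show "selfadjoint S" "selfadjoint R" and RR: "R o\<^sub>L R = D"
    using half by (simp_all add: S_def R_def)
  have SR: "S o\<^sub>L R = id_blinfun" "R o\<^sub>L S = id_blinfun" using half by (simp_all add: S_def R_def)
  have "S o\<^sub>L D o\<^sub>L S = (S o\<^sub>L R) o\<^sub>L (R o\<^sub>L S)"
    by (simp only: RR[symmetric] blinfun_compose_assoc)
  then show "S o\<^sub>L D o\<^sub>L S = id_blinfun" by (simp add: SR)
  have "R o\<^sub>L (S o\<^sub>L X o\<^sub>L S) o\<^sub>L R = (R o\<^sub>L S) o\<^sub>L X o\<^sub>L (S o\<^sub>L R)"
    by (simp only: blinfun_compose_assoc)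
  then show "R o\<^sub>L (S o\<^sub>L X o\<^sub>L S) o\<^sub>L R = X" by (simp add: SR)
qed

lemma form_in_normalised:
  assumes D: "positive_op D" "invertible_op D"
    and ab: "\<And>x. a * qform D x \<le> qform Z x" "\<And>x. qform Z x \<le> b * qform D x"
  shows "form_in id_blinfun a b (op_powr D (-1/2) o\<^sub>L Z o\<^sub>L op_powr D (-1/2))"
proof -
  let ?S = "op_powr D (-1/2)"
  note n = perspective_normalise[OF D]
  have "qform id_blinfun x = qform D (?S x)" for x
    using qform_conj[OF n(1), of D x] by (simp only: n(3))
  then show ?thesis
    unfolding form_in_def qform_conj[OF n(1)] using ab by simp
qed

text \<open>Membership in the closure would only confine the form of Z by points of the closure of
  \<open>J\<close>. The separate bounds with a, b in \<open>J\<close> keep the normalised operator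
  where f is continuous; conjugation by D^(1/2) then restores the perspective.\<close>

lemma perspective_le:
  assumes universe: "infinite_dimensional TYPE('u::chilbert)"
    and convex: "operator_convex_on TYPE('u) J f" and J: "is_interval J"
    and C: "(D, Z, G) \<in> closure (jensen_cone J f)"
    and D: "positive_op D" "invertible_op D" and ab: "a \<in> J" "b \<in> J"
      "\<And>x. a * qform D x \<le> qform Z x" "\<And>x. qform Z x \<le> b * qform D x"
  shows "op_perspective f D Z \<preceq> G"
proof -
  let ?S = "op_powr D (-1/2)" and ?R = "op_powr D (1/2)"
  note n = perspective_normalise[OF D]
  have "(?S o\<^sub>L D o\<^sub>L ?S, ?S o\<^sub>L Z o\<^sub>L ?S, ?S o\<^sub>L G o\<^sub>L ?S) \<in> closure (jensen_cone J f)"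
    by (rule closure_image_triple[OF bounded_linear_conj jensen_cone_conj[OF _ n(1)] C])
  then have "cfc f (?S o\<^sub>L Z o\<^sub>L ?S) \<preceq> ?S o\<^sub>L G o\<^sub>L ?S"
    unfolding n(3) by (rule jensen_closure[OF universe convex J _ ab(1,2) form_in_normalised[OF D ab(3,4)]])
  then have "positive_op (?R o\<^sub>L ((?S o\<^sub>L G o\<^sub>L ?S) - cfc f (?S o\<^sub>L Z o\<^sub>L ?S)) o\<^sub>L ?R)"
    unfolding op_le_def by (rule positive_op_conj[OF n(2)])
  then show ?thesis
    unfolding op_le_def op_perspective_def by (simp only: blinfun_comp_simps n(5))
qed

text \<open>The witness is p \<mapsto> D^(1/2) p(D^(-1/2) Z D^(-1/2)) D^(1/2), which has values D at
  1, Z at x and the perspective at f.\<close>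

lemma perspective_in_cone:
  assumes D: "positive_op D" "invertible_op D" and Z: "selfadjoint Z" and ab: "a \<in> J" "b \<in> J" "a \<le> b"
      "\<And>x. a * qform D x \<le> qform Z x" "\<And>x. qform Z x \<le> b * qform D x"
  shows "(D, Z, op_perspective f D Z) \<in> jensen_cone J f"
proof -
  let ?S = "op_powr D (-1/2)" and ?R = "op_powr D (1/2)"
  note n = perspective_normalise[OF D]
  have "(?R o\<^sub>L id_blinfun o\<^sub>L ?R, ?R o\<^sub>L (?S o\<^sub>L Z o\<^sub>L ?S) o\<^sub>L ?R, op_perspective f D Z) \<in> jensen_cone J f"
    unfolding op_perspective_def
  proof (rule jensen_cone_functional_calculus[OF selfadjoint_conj[OF n(1) Z] form_in_normalised[OF D ab(4,5)] ab(1-3)])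
    show "positive_op (?R o\<^sub>L X o\<^sub>L ?R)" if "positive_op X" for X
      using that by (rule positive_op_conj[OF n(2)])
  qed (simp_all add: blinfun_comp_simps tendsto_blinfun_compose tendsto_const)
  then show ?thesis by (simp only: n(4,5) blinfun_comp_id)
qed

section \<open>Positive linear maps on an operator algebra\<close>

lemma cstar_closed_under:
  assumes "unital_cstar_algebra \<AA>"
  shows "id_blinfun \<in> \<AA>" "\<And>X Y. X \<in> \<AA> \<Longrightarrow> Y \<in> \<AA> \<Longrightarrow> X + Y \<in> \<AA>"
    "\<And>X Y. X \<in> \<AA> \<Longrightarrow> Y \<in> \<AA> \<Longrightarrow> X o\<^sub>L Y \<in> \<AA>" "\<And>r X. X \<in> \<AA> \<Longrightarrow> r *\<^sub>R X \<in> \<AA>" "closed \<AA>"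
  using assms by (auto simp: unital_cstar_algebra_def simp flip: op_scaleC_of_real)

lemma cstar_op_poly:
  assumes "unital_cstar_algebra \<AA>" "X \<in> \<AA>"
  shows "op_poly id_blinfun p X \<in> \<AA>"
proof (induction p)
  case 0
  show ?case using cstar_closed_under(4)[OF assms, of 0] by simp
next
  case (pCons c p)
  then show ?case
    unfolding op_poly_pCons using assms by (intro cstar_closed_under[OF assms(1)])
qed

lemma positive_linear_map_linear:
  assumes "positive_linear_map \<AA> \<BB> \<phi>"
  shows "X \<in> \<AA> \<Longrightarrow> Y \<in> \<AA> \<Longrightarrow> \<phi> (X + Y) = \<phi> X + \<phi> Y" "X \<in> \<AA> \<Longrightarrow> \<phi> (r *\<^sub>R X) = r *\<^sub>R \<phi> X"
    "X \<in> \<AA> \<Longrightarrow> positive_op X \<Longrightarrow> positive_op (\<phi> X)"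
  using assms by (auto simp: positive_linear_map_def simp flip: op_scaleC_of_real)

lemma positive_linear_map_diff:
  assumes alg: "unital_cstar_algebra \<AA>" and \<phi>: "positive_linear_map \<AA> \<BB> \<phi>" and X: "X \<in> \<AA>" "Y \<in> \<AA>"
  shows "X - Y \<in> \<AA>" "\<phi> (X - Y) = \<phi> X - \<phi> Y"
proof -
  have Y': "(-1) *\<^sub>R Y \<in> \<AA>" by (rule cstar_closed_under(4)[OF alg X(2)])
  show "X - Y \<in> \<AA>" using cstar_closed_under(2)[OF alg X(1) Y'] by simp
  show "\<phi> (X - Y) = \<phi> X - \<phi> Y"
    using positive_linear_map_linear(1)[OF \<phi> X(1) Y'] positive_linear_map_linear(2)[OF \<phi> X(2), of "-1"] by simp
qed

lemma positive_linear_map_mono: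
  assumes alg: "unital_cstar_algebra \<AA>" and \<phi>: "positive_linear_map \<AA> \<BB> \<phi>"
    and X: "X \<in> \<AA>" "Y \<in> \<AA>" "selfadjoint X" "selfadjoint Y" "\<And>x. qform X x \<le> qform Y x"
  shows "qform (\<phi> X) y \<le> qform (\<phi> Y) y"
proof -
  have "positive_op (Y - X)"
    using X by (intro positive_opI) (simp_all add: selfadjoint_diff qform_simps)
  then have "positive_op (\<phi> (Y - X))"
    using positive_linear_map_linear(3)[OF \<phi>] positive_linear_map_diff(1)[OF alg \<phi> X(2,1)] by blast
  then show ?thesis
    using positive_op_qform[of "\<phi> (Y - X)" y]
    by (simp add: positive_linear_map_diff(2)[OF alg \<phi> X(2,1)] qform_simps)
qed

lemma positive_linear_map_bounds:
  assumes alg: "unital_cstar_algebra \<AA>" and \<phi>: "positive_linear_map \<AA> \<BB> \<phi>"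
    and X: "X \<in> \<AA>" "selfadjoint X"
  shows "(\<And>x. c * (norm x)\<^sup>2 \<le> qform X x) \<Longrightarrow> c * qform (\<phi> id_blinfun) y \<le> qform (\<phi> X) y"
    and "(\<And>x. qform X x \<le> c * (norm x)\<^sup>2) \<Longrightarrow> qform (\<phi> X) y \<le> c * qform (\<phi> id_blinfun) y"
proof -
  note id = cstar_closed_under(1)[OF alg]
  have c: "c *\<^sub>R id_blinfun \<in> \<AA>" by (rule cstar_closed_under(4)[OF alg id])
  have \<phi>c: "qform (\<phi> (c *\<^sub>R id_blinfun)) y = c * qform (\<phi> id_blinfun) y"
    by (simp add: positive_linear_map_linear(2)[OF \<phi> id] qform_simps)
  show "(\<And>x. c * (norm x)\<^sup>2 \<le> qform X x) \<Longrightarrow> c * qform (\<phi> id_blinfun) y \<le> qform (\<phi> X) y"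
    unfolding \<phi>c[symmetric]
    by (rule positive_linear_map_mono[OF alg \<phi> c X(1)])
      (use X in \<open>simp_all add: selfadjoint_scaleR qform_simps qform_id\<close>)
  show "(\<And>x. qform X x \<le> c * (norm x)\<^sup>2) \<Longrightarrow> qform (\<phi> X) y \<le> c * qform (\<phi> id_blinfun) y"
    unfolding \<phi>c[symmetric]
    by (rule positive_linear_map_mono[OF alg \<phi> X(1) c])
      (use X in \<open>simp_all add: selfadjoint_scaleR qform_simps qform_id\<close>)
qed

lemma positive_linear_map_id:
  assumes "unital_cstar_algebra \<AA>" "positive_linear_map \<AA> \<BB> \<phi>"
  shows "positive_op (\<phi> id_blinfun)"
  by (rule positive_linear_map_linear(3)[OF assms(2) cstar_closed_under(1)[OF assms(1)] positive_op_id])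

text \<open>Everything follows from -c I \<le> X \<le> c I with c = norm X. The norm bound supplies
  the continuity of \<phi> that positivity leaves implicit.\<close>

lemma positive_linear_map_selfadjoint:
  assumes alg: "unital_cstar_algebra \<AA>" and \<phi>: "positive_linear_map \<AA> \<BB> \<phi>"
    and X: "X \<in> \<AA>" "selfadjoint X"
  shows "selfadjoint (\<phi> X)" "norm (\<phi> X) \<le> norm X * norm (\<phi> id_blinfun)"
proof -
  note id = cstar_closed_under(1)[OF alg]
  let ?c = "norm X *\<^sub>R (id_blinfun :: 'a \<Rightarrow>\<^sub>L 'a)"
  have c: "?c \<in> \<AA>" by (rule cstar_closed_under(4)[OF alg id])
  have bd: "- norm X * (norm x)\<^sup>2 \<le> qform X x" "qform X x \<le> norm X * (norm x)\<^sup>2" for x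
    using abs_qform_le[of X x] by (simp_all add: abs_le_iff)
  have "0 \<le> qform (?c + X) x" for x
    using bd(1)[of x] by (simp add: qform_simps qform_id)
  then have "positive_op (?c + X)"
    using X(2) by (intro positive_opI selfadjoint_add selfadjoint_scaleR selfadjoint_id)
  then have "positive_op (\<phi> (?c + X))"
    by (rule positive_linear_map_linear(3)[OF \<phi> cstar_closed_under(2)[OF alg c X(1)]])
  moreover have "\<phi> X = \<phi> (?c + X) - norm X *\<^sub>R \<phi> id_blinfun"
    by (simp add: positive_linear_map_linear(1)[OF \<phi> c X(1)] positive_linear_map_linear(2)[OF \<phi> id])
  ultimately show sa: "selfadjoint (\<phi> X)"
    using positive_linear_map_id[OF alg \<phi>]
    by (simp add: selfadjoint_diff selfadjoint_scaleR positive_op_selfadjoint)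
  show "norm (\<phi> X) \<le> norm X * norm (\<phi> id_blinfun)"
  proof (rule norm_le_numerical_radius[OF sa])
    fix x
    have "\<bar>qform (\<phi> X) x\<bar> \<le> norm X * qform (\<phi> id_blinfun) x"
      using positive_linear_map_bounds(1)[OF alg \<phi> X, of "- norm X" x, OF bd(1)]
        positive_linear_map_bounds(2)[OF alg \<phi> X, of "norm X" x, OF bd(2)]
      by (simp add: abs_le_iff minus_le_iff)
    also have "\<dots> \<le> norm X * (norm (\<phi> id_blinfun) * (norm x)\<^sup>2)"
      using abs_qform_le[of "\<phi> id_blinfun" x] by (intro mult_left_mono) auto
    finally show "\<bar>qform (\<phi> X) x\<bar> \<le> norm X * norm (\<phi> id_blinfun) * (norm x)\<^sup>2"
      by (simp add: mult.assoc)
  qed simp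
qed

lemma positive_linear_map_in_cone:
  assumes alg: "unital_cstar_algebra \<AA>" and \<phi>: "positive_linear_map \<AA> \<BB> \<phi>"
    and X: "X \<in> \<AA>" "selfadjoint X" and ab: "form_in id_blinfun a b X" "a \<in> J" "b \<in> J" "a \<le> b"
    and f: "continuous_on {a..b} f"
  shows "(\<phi> id_blinfun, \<phi> X, \<phi> (cfc f X)) \<in> jensen_cone J f"
proof (rule jensen_cone_functional_calculus[OF X(2) ab])
  have p: "op_poly id_blinfun p X \<in> \<AA>" for p by (rule cstar_op_poly[OF alg X(1)])
  have sa: "sa_on id_blinfun X" using X by (simp add: sa_on_id)
  show "\<phi> (op_poly id_blinfun p X + op_poly id_blinfun q X)
      = \<phi> (op_poly id_blinfun p X) + \<phi> (op_poly id_blinfun q X)" for p q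
    by (rule positive_linear_map_linear(1)[OF \<phi> p p])
  show "\<phi> (c *\<^sub>R op_poly id_blinfun p X) = c *\<^sub>R \<phi> (op_poly id_blinfun p X)" for c p
    by (rule positive_linear_map_linear(2)[OF \<phi> p])
  show "positive_op (\<phi> (op_poly id_blinfun p X))" if "positive_op (op_poly id_blinfun p X)" for p
    by (rule positive_linear_map_linear(3)[OF \<phi> p that])
  fix q :: "nat \<Rightarrow> real poly"
  let ?P = "\<lambda>n. op_poly id_blinfun (q n) X"
  assume lim: "?P \<longlonglongrightarrow> cfc f X"
  \<comment> \<open>\<phi> is linear and positive on \<AA> only, so the limit has to be placed
    there, by closedness. The differences are self-adjoint, as the norm bound requires.\<close>
  have cfc: "cfc f X \<in> \<AA>"
    using closed_sequentially[OF cstar_closed_under(5)[OF alg], of ?P, OF p lim] .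
  have "selfadjoint (cfc f X)" using cfc_on_sa[OF sa ab(1) f] by (simp add: sa_on_id)
  then have "selfadjoint (?P n - cfc f X)" for n
    using sa_onD(3)[OF op_poly_sa_on[OF sa]] by (simp add: selfadjoint_diff)
  then have "norm (\<phi> (?P n - cfc f X)) \<le> norm (?P n - cfc f X) * norm (\<phi> id_blinfun)" for n
    by (rule positive_linear_map_selfadjoint(2)[OF alg \<phi> positive_linear_map_diff(1)[OF alg \<phi> p cfc]])
  then have "norm (\<phi> (?P n) - \<phi> (cfc f X)) \<le> norm (?P n - cfc f X) * norm (\<phi> id_blinfun)" for n
    by (simp only: positive_linear_map_diff(2)[OF alg \<phi> p cfc])
  then have le: "\<forall>n. norm (\<phi> (?P n) - \<phi> (cfc f X)) \<le> norm (?P n - cfc f X) * norm (\<phi> id_blinfun)"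
    by blast
  have "(\<lambda>n. norm (?P n - cfc f X) * norm (\<phi> id_blinfun)) \<longlonglongrightarrow> 0"
    by (rule tendsto_mult_left_zero[OF tendsto_norm_zero[OF LIM_zero[OF lim]]])
  then have "(\<lambda>n. \<phi> (?P n) - \<phi> (cfc f X)) \<longlonglongrightarrow> 0"
    by (rule Lim_null_comparison[OF always_eventually[OF le]])
  then show "(\<lambda>n. \<phi> (?P n)) \<longlonglongrightarrow> \<phi> (cfc f X)" by (rule LIM_zero_cancel)
qed

section \<open>Integrals of operator fields\<close>

text \<open>Free scalars make positivity of \<open>D S\<close>, comparison of two integrals and the
  three-term estimate of \<open>sigma_lower_integral\<close> instances of one statement.\<close>

lemma has_integral_bochner_positive:
  fixes g1 g2 g3 :: "'t \<Rightarrow> 'k::chilbert \<Rightarrow>\<^sub>L 'k"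
  assumes g: "has_integral_bochner M g1 x1" "has_integral_bochner M g2 x2" "has_integral_bochner M g3 x3"
    and pos: "\<And>t. t \<in> space M \<Longrightarrow> positive_op (\<alpha> *\<^sub>R g1 t + \<beta> *\<^sub>R g2 t + \<gamma> *\<^sub>R g3 t)"
  shows "positive_op (\<alpha> *\<^sub>R x1 + \<beta> *\<^sub>R x2 + \<gamma> *\<^sub>R x3)"
proof -
  define h :: "('k \<Rightarrow>\<^sub>L 'k) \<times> ('k \<Rightarrow>\<^sub>L 'k) \<times> ('k \<Rightarrow>\<^sub>L 'k) \<Rightarrow> 'k \<Rightarrow>\<^sub>L 'k" where
    "h z = \<alpha> *\<^sub>R fst z + \<beta> *\<^sub>R fst (snd z) + \<gamma> *\<^sub>R snd (snd z)" for z
  let ?C = "{z. positive_op (h z)}"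
  have "h (y + z) = h y + h z" "h (r *\<^sub>R z) = r *\<^sub>R h z" for y z r
    by (simp_all add: h_def algebra_simps)
  moreover have "h 0 = 0" by (simp add: h_def)
  ultimately have cone: "convex_cone_set ?C"
    by (simp add: convex_cone_set_def positive_op_add positive_op_scaleR positive_op_zero)
  have closed: "closed ?C"
    unfolding closed_sequential_limits
  proof (intro allI impI, elim conjE)
    fix s l assume s: "\<forall>n. s n \<in> ?C" "s \<longlonglongrightarrow> l"
    have "(\<lambda>n. h (s n)) \<longlonglongrightarrow> h l"
      unfolding h_def
      by (intro tendsto_add tendsto_scaleR tendsto_const tendsto_fst tendsto_snd s(2))
    then have "positive_op (h l)" by (rule positive_op_limit) (use s(1) in simp)
    then show "l \<in> ?C" by simp
  qed
  have "(x1, x2, x3) \<in> closure ?C"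
    by (rule has_integral_bochner_in_closure[OF cone g]) (use pos in \<open>simp add: h_def\<close>)
  then show ?thesis using closed by (simp add: h_def)
qed

lemma has_integral_bochner_null:
  fixes g :: "'t \<Rightarrow> 'b::banach"
  assumes g: "g \<in> borel_measurable M" and S: "emeasure M S = 0" "S \<in> sets M"
    and zero: "\<And>t. t \<in> space M \<Longrightarrow> t \<notin> S \<Longrightarrow> g t = 0"
  shows "has_integral_bochner M g 0"
proof -
  have s: "sb_integrable M (\<lambda>_. 0 :: 'b)" by (rule simple_bochner_integrable.intros) simp_all
  have "AE t in M. ennreal (norm (g t - 0)) = 0"
    using AE_I'[of S M "\<lambda>t. ennreal (norm (g t - 0)) = 0"] S zero by auto
  then have "(\<integral>\<^sup>+t. ennreal (norm (g t - 0)) \<partial>M) = (\<integral>\<^sup>+t. 0 \<partial>M)"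
    by (rule nn_integral_cong_AE)
  then have "(\<integral>\<^sup>+t. ennreal (norm (g t - 0)) \<partial>M) = 0" by simp
  moreover have "sb_integral M (\<lambda>_. 0 :: 'b) = 0"
    by (simp add: simple_bochner_integral_def image_constant_conv)
  ultimately show ?thesis
    unfolding has_integral_bochner_def using g s
    by (intro conjI exI[of _ "\<lambda>_ _. 0"]) simp_all
qed

text \<open>Makes the preimages of such sets under norm continuous fields closed, hence measurable,
  in \<open>sigma_bound\<close>.\<close>

lemma closed_form_lower: "closed {X :: 'h::chilbert \<Rightarrow>\<^sub>L 'h. \<forall>x. c * (norm x)\<^sup>2 \<le> \<sigma> * qform X x}"
  unfolding closed_sequential_limits
proof (intro allI impI, elim conjE, simp only: mem_Collect_eq)
  fix s and l :: "'h \<Rightarrow>\<^sub>L 'h"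
  assume s: "\<forall>n. \<forall>x. c * (norm x)\<^sup>2 \<le> \<sigma> * qform (s n) x" "s \<longlonglongrightarrow> l"
  have "c * (norm x)\<^sup>2 \<le> \<sigma> * qform l x" for x
    by (rule LIMSEQ_le_const[OF tendsto_mult[OF tendsto_const tendsto_qform[OF s(2)]]]) (use s(1) in blast)
  then show "\<forall>x. c * (norm x)\<^sup>2 \<le> \<sigma> * qform l x" by blast
qed

section \<open>Spectral bounds for integrated fields\<close>

locale jensen_field =
  fixes T :: "'t topology" and \<mu> :: "'t measure"
    and \<AA> :: "('h::chilbert \<Rightarrow>\<^sub>L 'h) set" and \<BB> :: "('k::chilbert \<Rightarrow>\<^sub>L 'k) set"
    and J :: "real set" and A :: "'t \<Rightarrow> 'h \<Rightarrow>\<^sub>L 'h" and \<Phi> :: "'t \<Rightarrow> ('h \<Rightarrow>\<^sub>L 'h) \<Rightarrow> ('k \<Rightarrow>\<^sub>L 'k)"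
  assumes radon: "bounded_radon_measure T \<mu>"
    and algebra: "unital_cstar_algebra \<AA>"
    and interval: "is_interval J"
    and A_field: "continuous_field T \<AA> A"
    and A_selfadjoint: "\<And>t. t \<in> topspace T \<Longrightarrow> selfadjoint (A t)"
    and A_spectrum: "\<And>t. t \<in> topspace T \<Longrightarrow> spectrum_in id_blinfun (A t) J"
    and \<Phi>_field: "positive_map_field T \<AA> \<BB> \<Phi>"
    and \<Phi>_unital: "unital_field \<mu> \<Phi>"
    and \<Phi>_invertible: "\<And>t. t \<in> topspace T \<Longrightarrow> invertible_op (\<Phi> t id_blinfun)"
    and \<Phi>A_integrable: "bochner_integrable \<mu> (\<lambda>t. \<Phi> t (A t))"
    and nontrivial: "(id_blinfun :: 'k \<Rightarrow>\<^sub>L 'k) \<noteq> 0"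
begin

definition D :: "'t set \<Rightarrow> 'k \<Rightarrow>\<^sub>L 'k" where
  "D S = bochner_int \<mu> S (\<lambda>t. \<Phi> t id_blinfun)"

definition Z :: "'t set \<Rightarrow> 'k \<Rightarrow>\<^sub>L 'k" where
  "Z S = bochner_int \<mu> S (\<lambda>t. \<Phi> t (A t))"

lemma space_\<mu>: "space \<mu> = topspace T"
  and finite_\<mu>: "finite_measure \<mu>"
  using radon by (simp_all add: bounded_radon_measure_def)

lemma sets_\<mu>: "sets \<mu> = sigma_sets (topspace T) {U. openin T U}"
  using radon by (simp add: bounded_radon_measure_def)

lemma openin_sets: "openin T U \<Longrightarrow> U \<in> sets \<mu>"
  by (simp add: sets_\<mu> sigma_sets.Basic)

lemma closedin_sets: "closedin T F \<Longrightarrow> F \<in> sets \<mu>"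
proof -
  assume F: "closedin T F"
  then have "topspace T - F \<in> sets \<mu>" by (intro openin_sets) (simp add: closedin_def)
  then have "space \<mu> - (topspace T - F) \<in> sets \<mu>" by (rule sets.compl_sets)
  moreover have "space \<mu> - (topspace T - F) = F"
    using closedin_subset[OF F] by (auto simp: space_\<mu>)
  ultimately show ?thesis by simp
qed

lemma \<Phi>_positive: "t \<in> topspace T \<Longrightarrow> positive_linear_map \<AA> \<BB> (\<Phi> t)"
  using \<Phi>_field by (simp add: positive_map_field_def)

lemma A_in: "t \<in> topspace T \<Longrightarrow> A t \<in> \<AA>"
  using A_field by (simp add: continuous_field_def)

lemma \<Phi>_id_positive: "t \<in> topspace T \<Longrightarrow> positive_op (\<Phi> t id_blinfun)"
  by (rule positive_linear_map_id[OF algebra \<Phi>_positive])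

lemma \<Phi>A_selfadjoint: "t \<in> topspace T \<Longrightarrow> selfadjoint (\<Phi> t (A t))"
  by (rule positive_linear_map_selfadjoint(1)[OF algebra \<Phi>_positive A_in A_selfadjoint])

text \<open>Endpoints in \<open>J\<close> come from \<open>spectrum_in_form_in\<close>, which needs
  a nonzero space \<open>'h\<close>. If that space were zero, \<open>\<Phi> t id_blinfun\<close>
  would be 0, which is not invertible on the nonzero space \<open>'k\<close>.\<close>

lemma A_bounds:
  assumes t: "t \<in> topspace T"
  obtains a b where "a \<in> J" "b \<in> J" "a \<le> b" "form_in id_blinfun a b (A t)"
proof -
  have "(id_blinfun :: 'h \<Rightarrow>\<^sub>L 'h) \<noteq> 0"
  proof
    assume "(id_blinfun :: 'h \<Rightarrow>\<^sub>L 'h) = 0"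
    then have "\<Phi> t id_blinfun = 0"
      using positive_linear_map_linear(2)[OF \<Phi>_positive[OF t] cstar_closed_under(1)[OF algebra], of 0] by simp
    then show False
      using \<Phi>_invertible[OF t] nontrivial by (auto simp: invertible_on_def)
  qed
  then show ?thesis
    using spectrum_in_form_in[OF _ _ A_spectrum[OF t]] A_selfadjoint[OF t] that by (auto simp: sa_on_id)
qed

lemma \<Phi>A_bounds:
  assumes t: "t \<in> topspace T" and ab: "form_in id_blinfun a b (A t)"
  shows "a * qform (\<Phi> t id_blinfun) x \<le> qform (\<Phi> t (A t)) x"
    "qform (\<Phi> t (A t)) x \<le> b * qform (\<Phi> t id_blinfun) x"
  using ab positive_linear_map_bounds[OF algebra \<Phi>_positive[OF t] A_in[OF t] A_selfadjoint[OF t]]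
  by (simp_all add: form_in_def qform_id)

lemma \<Phi>_cfc_in_cone:
  assumes t: "t \<in> topspace T" and f: "continuous_on J f"
  shows "(\<Phi> t id_blinfun, \<Phi> t (A t), \<Phi> t (cfc f (A t))) \<in> jensen_cone J f"
proof -
  obtain a b where ab: "a \<in> J" "b \<in> J" "a \<le> b" "form_in id_blinfun a b (A t)"
    using A_bounds[OF t] .
  show ?thesis
    by (rule positive_linear_map_in_cone[OF algebra \<Phi>_positive[OF t] A_in[OF t] A_selfadjoint[OF t] ab(4,1,2,3)
        continuous_on_subset[OF f is_interval_Icc_subset[OF interval ab(1,2)]]])
qed

lemma \<Phi>_perspective_in_cone:
  assumes t: "t \<in> topspace T"
  shows "(\<Phi> t id_blinfun, \<Phi> t (A t), op_perspective f (\<Phi> t id_blinfun) (\<Phi> t (A t))) \<in> jensen_cone J f"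
proof -
  obtain a b where ab: "a \<in> J" "b \<in> J" "a \<le> b" "form_in id_blinfun a b (A t)"
    using A_bounds[OF t] .
  show ?thesis
    by (rule perspective_in_cone[OF \<Phi>_id_positive[OF t] \<Phi>_invertible[OF t] \<Phi>A_selfadjoint[OF t] ab(1-3)
        \<Phi>A_bounds[OF t ab(4)]])
qed

lemma D_integral: "S \<in> sets \<mu> \<Longrightarrow> has_integral_bochner \<mu> (\<lambda>t. indicat_real S t *\<^sub>R \<Phi> t id_blinfun) (D S)"
  unfolding D_def using \<Phi>_unital
  by (intro bochner_integrable_restrict) (auto simp: unital_field_def bochner_integrable_def)

lemma Z_integral: "S \<in> sets \<mu> \<Longrightarrow> has_integral_bochner \<mu> (\<lambda>t. indicat_real S t *\<^sub>R \<Phi> t (A t)) (Z S)"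
  unfolding Z_def using \<Phi>A_integrable by (rule bochner_integrable_restrict)

lemma D_positive: "S \<in> sets \<mu> \<Longrightarrow> positive_op (D S)"
  using has_integral_bochner_positive[OF D_integral D_integral D_integral, of S S S 1 0 0]
  by (simp add: indicator_def positive_op_zero \<Phi>_id_positive space_\<mu>)

lemma integral_in_closure:
  assumes S: "S \<in> sets \<mu>" and ne: "J \<noteq> {}" and G: "bochner_integrable \<mu> G"
    and cone: "\<And>t. t \<in> topspace T \<Longrightarrow> (\<Phi> t id_blinfun, \<Phi> t (A t), G t) \<in> jensen_cone J f"
  shows "(D S, Z S, bochner_int \<mu> S G) \<in> closure (jensen_cone J f)"
proof (rule has_integral_bochner_in_closure[OF jensen_cone_convex[OF ne] D_integral[OF S] Z_integral[OF S]
      bochner_integrable_restrict[OF G S]])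
  fix t assume "t \<in> space \<mu>"
  then show "(indicat_real S t *\<^sub>R \<Phi> t id_blinfun, indicat_real S t *\<^sub>R \<Phi> t (A t), indicat_real S t *\<^sub>R G t)
      \<in> jensen_cone J f"
    using cone[of t] by (simp add: space_\<mu> indicator_def jensen_cone_zero[OF ne])
qed

lemma emeasure_pos:
  assumes S: "S \<in> sets \<mu>" and inv: "invertible_op (D S)"
  shows "emeasure \<mu> S \<noteq> 0"
proof
  assume 0: "emeasure \<mu> S = 0"
  have "has_integral_bochner \<mu> (\<lambda>t. indicat_real S t *\<^sub>R \<Phi> t id_blinfun) 0"
    using D_integral[OF S] unfolding has_integral_bochner_def
    by (intro has_integral_bochner_null[OF _ 0 S, unfolded has_integral_bochner_def]) auto
  then have "D S = 0" using has_integral_bochner_unique[OF D_integral[OF S]] by blast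
  then show False using inv nontrivial by (auto simp: invertible_on_def)
qed

text \<open>Integrates a pointwise bound in which an extra margin d is available on F only; the
  margin survives with weight the measure of F. With F empty it is plain monotonicity.\<close>

lemma sigma_lower_integral:
  assumes S: "S \<in> sets \<mu>" and F: "F \<in> sets \<mu>" "F \<subseteq> S"
    and le: "\<And>t x. t \<in> S \<Longrightarrow> t \<in> topspace T \<Longrightarrow>
      c * qform (\<Phi> t id_blinfun) x + indicat_real F t * d * (norm x)\<^sup>2 \<le> \<sigma> * qform (\<Phi> t (A t)) x"
  shows "c * qform (D S) x + d * measure \<mu> F * (norm x)\<^sup>2 \<le> \<sigma> * qform (Z S) x"
proof -
  have "positive_op (\<sigma> *\<^sub>R Z S + (- c) *\<^sub>R D S + (- d) *\<^sub>R (measure \<mu> F *\<^sub>R id_blinfun))"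
  proof (rule has_integral_bochner_positive[OF Z_integral[OF S] D_integral[OF S]
        has_integral_bochner_indicator[OF F(1) finite_\<mu>]])
    fix t assume t: "t \<in> space \<mu>"
    show "positive_op (\<sigma> *\<^sub>R (indicat_real S t *\<^sub>R \<Phi> t (A t)) + (- c) *\<^sub>R (indicat_real S t *\<^sub>R \<Phi> t id_blinfun)
        + (- d) *\<^sub>R (indicat_real F t *\<^sub>R id_blinfun))"
    proof (cases "t \<in> S")
      case True
      have t': "t \<in> topspace T" using t by (simp add: space_\<mu>)
      show ?thesis
      proof (rule positive_opI)
        show "selfadjoint (\<sigma> *\<^sub>R (indicat_real S t *\<^sub>R \<Phi> t (A t)) + (- c) *\<^sub>R (indicat_real S t *\<^sub>R \<Phi> t id_blinfun)
            + (- d) *\<^sub>R (indicat_real F t *\<^sub>R id_blinfun))"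
          by (intro selfadjoint_add selfadjoint_scaleR \<Phi>A_selfadjoint[OF t']
              positive_op_selfadjoint[OF \<Phi>_id_positive[OF t']] selfadjoint_id)
        show "0 \<le> qform (\<sigma> *\<^sub>R (indicat_real S t *\<^sub>R \<Phi> t (A t)) + (- c) *\<^sub>R (indicat_real S t *\<^sub>R \<Phi> t id_blinfun)
            + (- d) *\<^sub>R (indicat_real F t *\<^sub>R id_blinfun)) x" for x
          using le[OF True t', of x] True by (simp add: qform_simps qform_id mult_ac)
      qed
    next
      case False
      then have "indicat_real S t = 0" "indicat_real F t = 0" using F(2) by (auto simp: indicator_def)
      then show ?thesis by (simp add: positive_op_zero)
    qed
  qed
  from positive_op_qform[OF this, of x] show ?thesis by (simp add: qform_simps qform_id mult_ac)
qed

text \<open>The sign \<open>\<sigma>\<close> covers lower and upper bounds at once. If the infimum \<open>\<alpha>\<close> of \<open>\<sigma> J\<close> is not attained,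
  the sets \<open>F m\<close>, where \<open>\<sigma> A\<^sub>t\<close> stays away from \<open>\<alpha>\<close> and \<open>\<Phi>\<^sub>t(I)\<close> from \<open>0\<close>, exhaust \<open>S\<close>; one of
  them has positive measure, which makes the integral stay away from \<open>\<alpha> D\<close>.\<close>

lemma sigma_bound:
  assumes S: "S \<in> sets \<mu>" and inv: "invertible_op (D S)"
    and A_ge: "\<And>t. t \<in> topspace T \<Longrightarrow> \<exists>k\<in>K. \<forall>x. k * (norm x)\<^sup>2 \<le> \<sigma> * qform (A t) x"
    and \<Phi>A_ge: "\<And>t c x. t \<in> topspace T \<Longrightarrow> (\<And>x. c * (norm x)\<^sup>2 \<le> \<sigma> * qform (A t) x) \<Longrightarrow>
      c * qform (\<Phi> t id_blinfun) x \<le> \<sigma> * qform (\<Phi> t (A t)) x"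
  shows "\<exists>k\<in>K. \<forall>x. k * qform (D S) x \<le> \<sigma> * qform (Z S) x"
proof -
  have S_T: "S \<subseteq> topspace T" using sets.sets_into_space[OF S] by (simp add: space_\<mu>)
  have S_pos: "emeasure \<mu> S \<noteq> 0" by (rule emeasure_pos[OF S inv])
  then have "S \<noteq> {}" by auto
  then have ne: "K \<noteq> {}" using A_ge S_T by blast
  have Dq: "0 \<le> qform (D S) x" for x by (rule positive_op_qform[OF D_positive[OF S]])
  have D_sa: "sa_on id_blinfun (D S)" using D_positive[OF S] by (simp add: sa_on_id positive_op_selfadjoint)
  show ?thesis
  proof (cases "bdd_below K")
    case False
    \<comment> \<open>K has no lower bound, so a very negative k suffices: D S dominates \<delta> I,
      and the form of \<sigma> Z S is bounded.\<close>
    obtain \<delta> where \<delta>: "\<delta> > 0" "\<And>x. \<delta> * qform id_blinfun x \<le> qform (D S) x"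
      using invertible_lower_bound[OF D_sa Dq inv] by blast
    let ?N = "\<bar>\<sigma>\<bar> * norm (Z S)"
    obtain k where k: "k \<in> K" "k \<le> - (?N / \<delta>)"
      using False unfolding bdd_below_def by (meson linear)
    have "k * qform (D S) x \<le> \<sigma> * qform (Z S) x" for x
    proof -
      have "k * qform (D S) x \<le> - (?N / \<delta>) * qform (D S) x"
        by (rule mult_right_mono[OF k(2) Dq])
      also have "\<dots> \<le> - (?N * (norm x)\<^sup>2)"
      proof -
        have "?N * (\<delta> * (norm x)\<^sup>2) \<le> ?N * qform (D S) x"
          using \<delta>(2)[of x] by (intro mult_left_mono) (simp_all add: qform_id)
        then show ?thesis using \<delta>(1) by (simp add: field_simps)
      qed
      also have "\<dots> \<le> \<sigma> * qform (Z S) x"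
      proof -
        have "\<bar>\<sigma> * qform (Z S) x\<bar> \<le> \<bar>\<sigma>\<bar> * (norm (Z S) * (norm x)\<^sup>2)"
          unfolding abs_mult by (intro mult_left_mono abs_qform_le) simp
        then show ?thesis by (simp add: abs_le_iff mult.assoc)
      qed
      finally show ?thesis .
    qed
    then show ?thesis using k(1) by blast
  next
    case True
    define \<alpha> where "\<alpha> = Inf K"
    have \<alpha>: "\<alpha> \<le> k" if "k \<in> K" for k unfolding \<alpha>_def using that True by (rule cInf_lower)
    have A_\<alpha>: "\<alpha> * (norm x)\<^sup>2 \<le> \<sigma> * qform (A t) x" if t: "t \<in> topspace T" for t x
    proof -
      obtain k where k: "k \<in> K" "\<And>x. k * (norm x)\<^sup>2 \<le> \<sigma> * qform (A t) x" using A_ge[OF t] by blast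
      have "\<alpha> * (norm x)\<^sup>2 \<le> k * (norm x)\<^sup>2" using \<alpha>[OF k(1)] by (rule mult_right_mono) simp
      then show ?thesis using k(2)[of x] by linarith
    qed
    have \<Phi>A_\<alpha>: "\<alpha> * qform (\<Phi> t id_blinfun) x \<le> \<sigma> * qform (\<Phi> t (A t)) x" if "t \<in> topspace T" for t x
      by (rule \<Phi>A_ge[OF that A_\<alpha>[OF that]])
    show ?thesis
    proof (cases "\<alpha> \<in> K")
      case True
      have "\<alpha> * qform (D S) x \<le> \<sigma> * qform (Z S) x" for x
        using sigma_lower_integral[OF S, of "{}" \<alpha> 0 \<sigma> x] \<Phi>A_\<alpha> by simp
      then show ?thesis using True by blast
    next
      case False
      define r where "r m = 1 / real (Suc m)" for m
      have r: "r m > 0" for m by (simp add: r_def)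
      define F where "F m = {t \<in> topspace T. A t \<in> {X. \<forall>x. (\<alpha> + r m) * (norm x)\<^sup>2 \<le> \<sigma> * qform X x}} \<inter>
        {t \<in> topspace T. \<Phi> t id_blinfun \<in> {X. \<forall>x. r m * (norm x)\<^sup>2 \<le> 1 * qform X x}}" for m
      have F_sets: "F m \<in> sets \<mu>" for m
        unfolding F_def
      proof (intro sets.Int closedin_sets closedin_continuous_map_preimage)
        show "continuous_map T euclidean A" using A_field by (simp add: continuous_field_def)
        show "continuous_map T euclidean (\<lambda>t. \<Phi> t id_blinfun)"
          using \<Phi>_field cstar_closed_under(1)[OF algebra] by (simp add: positive_map_field_def)
      qed (simp_all only: closed_closedin[symmetric] closed_form_lower)
      have cover: "S \<subseteq> (\<Union>m. F m)"
      proof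
        fix t assume "t \<in> S"
        then have t: "t \<in> topspace T" using S_T by blast
        obtain k where k: "k \<in> K" "\<And>x. k * (norm x)\<^sup>2 \<le> \<sigma> * qform (A t) x" using A_ge[OF t] by blast
        have "\<alpha> < k" using \<alpha>[OF k(1)] k(1) False by (metis less_le)
        obtain \<delta> where \<delta>: "\<delta> > 0" "\<And>x. \<delta> * qform id_blinfun x \<le> qform (\<Phi> t id_blinfun) x"
          using invertible_lower_bound[OF _ _ \<Phi>_invertible[OF t]] \<Phi>_id_positive[OF t]
          by (metis positive_op_qform positive_op_selfadjoint sa_on_id)
        obtain m where m: "inverse (real (Suc m)) < min \<delta> (k - \<alpha>)"
          using reals_Archimedean[of "min \<delta> (k - \<alpha>)"] \<delta>(1) \<open>\<alpha> < k\<close> by auto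
        have rm: "r m \<le> \<delta>" "\<alpha> + r m \<le> k" using m by (simp_all add: r_def inverse_eq_divide)
        have "(\<alpha> + r m) * (norm x)\<^sup>2 \<le> \<sigma> * qform (A t) x" for x
          using mult_right_mono[OF rm(2), of "(norm x)\<^sup>2"] k(2)[of x] by simp
        moreover have "r m * (norm x)\<^sup>2 \<le> 1 * qform (\<Phi> t id_blinfun) x" for x
          using mult_right_mono[OF rm(1), of "(norm x)\<^sup>2"] \<delta>(2)[of x] by (simp add: qform_id)
        ultimately have "t \<in> F m" unfolding F_def using t by blast
        then show "t \<in> (\<Union>m. F m)" by blast
      qed
      have "\<exists>m. emeasure \<mu> (F m \<inter> S) \<noteq> 0"
      proof (rule ccontr)
        assume "\<not> ?thesis"
        then have "emeasure \<mu> (\<Union>m. F m \<inter> S) = 0"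
          using F_sets S by (intro emeasure_UN_eq_0) auto
        moreover have "(\<Union>m. F m \<inter> S) = S" using cover by blast
        ultimately show False using S_pos by simp
      qed
      then obtain m where m: "emeasure \<mu> (F m \<inter> S) \<noteq> 0" by blast
      \<comment> \<open>One factor \<open>r m\<close> is the gap of \<sigma> A t above \<alpha>, the
        other the lower bound of \<open>\<Phi> t id_blinfun\<close> that turns the gap into a
        multiple of the identity.\<close>
      define c where "c = r m * r m * measure \<mu> (F m \<inter> S)"
      have "measure \<mu> (F m \<inter> S) \<noteq> 0"
        using m by (simp add: finite_measure.emeasure_eq_measure[OF finite_\<mu>])
      then have c: "c > 0"
        using r[of m] by (simp add: c_def zero_less_measure_iff)
      have lower: "\<alpha> * qform (D S) x + c * (norm x)\<^sup>2 \<le> \<sigma> * qform (Z S) x" for x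
        unfolding c_def
      proof (rule sigma_lower_integral[OF S])
        fix t x assume t: "t \<in> S" "t \<in> topspace T"
        show "\<alpha> * qform (\<Phi> t id_blinfun) x + indicat_real (F m \<inter> S) t * (r m * r m) * (norm x)\<^sup>2
            \<le> \<sigma> * qform (\<Phi> t (A t)) x"
        proof (cases "t \<in> F m")
          case True
          then have F: "\<And>x. (\<alpha> + r m) * (norm x)\<^sup>2 \<le> \<sigma> * qform (A t) x"
            "r m * (norm x)\<^sup>2 \<le> qform (\<Phi> t id_blinfun) x" by (simp_all add: F_def)
          have "(\<alpha> + r m) * qform (\<Phi> t id_blinfun) x \<le> \<sigma> * qform (\<Phi> t (A t)) x"
            by (rule \<Phi>A_ge[OF t(2) F(1)])
          moreover have "r m * (r m * (norm x)\<^sup>2) \<le> r m * qform (\<Phi> t id_blinfun) x"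
            using F(2) r[of m] by (intro mult_left_mono) simp_all
          ultimately show ?thesis using True t(1) by (simp add: distrib_right mult.assoc)
        next
          case False
          then show ?thesis using \<Phi>A_\<alpha>[OF t(2), of x] by simp
        qed
      qed (use F_sets S in auto)
      \<comment> \<open>Converts the surplus c I into a multiple of D S. Then \<alpha> + c' exceeds
        the infimum of K, so a point of K lies below it.\<close>
      define c' where "c' = c / (norm (D S) + 1)"
      have c': "c' > 0" using c by (simp add: c'_def add_nonneg_pos)
      have "c' * qform (D S) x \<le> c * (norm x)\<^sup>2" for x
      proof -
        have "qform (D S) x \<le> (norm (D S) + 1) * (norm x)\<^sup>2"
          using abs_qform_le[of "D S" x] by (simp add: distrib_right abs_le_iff add_increasing2)
        then have "c' * qform (D S) x \<le> c' * ((norm (D S) + 1) * (norm x)\<^sup>2)"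
          using c' by (intro mult_left_mono) simp_all
        also have "\<dots> = c * (norm x)\<^sup>2"
        proof -
          have "norm (D S) + 1 \<noteq> 0" using norm_ge_zero[of "D S"] by linarith
          then show ?thesis by (simp add: c'_def)
        qed
        finally show ?thesis .
      qed
      then have "(\<alpha> + c') * qform (D S) x \<le> \<sigma> * qform (Z S) x" for x
        using lower[of x] by (simp add: distrib_right) (meson add_left_mono order_trans)
      moreover obtain k where k: "k \<in> K" "k < \<alpha> + c'"
        using cInf_lessD[OF ne, of "\<alpha> + c'"] c' unfolding \<alpha>_def by auto
      moreover have "k * qform (D S) x \<le> (\<alpha> + c') * qform (D S) x" for x
        using k(2) Dq by (intro mult_right_mono) simp_all
      ultimately show ?thesis by (meson order_trans)
    qed
  qed
qed

text \<open>\<open>sigma_bound\<close> with \<sigma> = 1 and K = J gives the lower endpoint, with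
  \<sigma> = -1 and K = -J the upper one.\<close>

lemma Z_bounds:
  assumes S: "S \<in> sets \<mu>" and inv: "invertible_op (D S)"
  obtains a b where "a \<in> J" "b \<in> J" "a \<le> b"
    "\<And>x. a * qform (D S) x \<le> qform (Z S) x" "\<And>x. qform (Z S) x \<le> b * qform (D S) x"
proof -
  have "\<exists>a\<in>J. \<forall>x. a * qform (D S) x \<le> 1 * qform (Z S) x"
  proof (rule sigma_bound[OF S inv])
    show "\<exists>k\<in>J. \<forall>x. k * (norm x)\<^sup>2 \<le> 1 * qform (A t) x" if t: "t \<in> topspace T" for t
    proof -
      obtain a b where "a \<in> J" "form_in id_blinfun a b (A t)" using A_bounds[OF t] .
      then show ?thesis by (intro bexI[of _ a]) (simp_all add: form_in_def qform_id)
    qed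
    show "c * qform (\<Phi> t id_blinfun) x \<le> 1 * qform (\<Phi> t (A t)) x"
      if t: "t \<in> topspace T" and c: "\<And>x. c * (norm x)\<^sup>2 \<le> 1 * qform (A t) x" for t c x
      using positive_linear_map_bounds(1)[OF algebra \<Phi>_positive[OF t] A_in[OF t] A_selfadjoint[OF t], of c x] c
      by simp
  qed
  then obtain a where a: "a \<in> J" "\<And>x. a * qform (D S) x \<le> qform (Z S) x" by auto
  have "\<exists>k\<in>uminus ` J. \<forall>x. k * qform (D S) x \<le> (-1) * qform (Z S) x"
  proof (rule sigma_bound[OF S inv])
    show "\<exists>k\<in>uminus ` J. \<forall>x. k * (norm x)\<^sup>2 \<le> (-1) * qform (A t) x" if t: "t \<in> topspace T" for t
    proof -
      obtain a b where "b \<in> J" "form_in id_blinfun a b (A t)" using A_bounds[OF t] .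
      then show ?thesis by (intro bexI[of _ "- b"]) (simp_all add: form_in_def qform_id)
    qed
    show "c * qform (\<Phi> t id_blinfun) x \<le> (-1) * qform (\<Phi> t (A t)) x"
      if t: "t \<in> topspace T" and c: "\<And>x. c * (norm x)\<^sup>2 \<le> (-1) * qform (A t) x" for t c x
    proof -
      have "qform (A t) x \<le> - c * (norm x)\<^sup>2" for x using c[of x] by simp
      then show ?thesis
        using positive_linear_map_bounds(2)[OF algebra \<Phi>_positive[OF t] A_in[OF t] A_selfadjoint[OF t], of "- c" x]
        by simp
    qed
  qed
  then obtain b where b: "b \<in> J" "\<And>x. qform (Z S) x \<le> b * qform (D S) x" by auto
  show ?thesis
  proof (cases "a \<le> b")
    case True
    then show ?thesis using a b that by blast
  next
    case False
    \<comment> \<open>The endpoints were found independently; if they are in the wrong order, a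
      serves as both.\<close>
    have "b * qform (D S) x \<le> a * qform (D S) x" for x
      using False positive_op_qform[OF D_positive[OF S]] by (intro mult_right_mono) auto
    then have "qform (Z S) x \<le> a * qform (D S) x" for x using b(2)[of x] order_trans by blast
    then show ?thesis using a that[of a a] by blast
  qed
qed

lemma Z_selfadjoint: "S \<in> sets \<mu> \<Longrightarrow> selfadjoint (Z S)"
proof -
  assume S: "S \<in> sets \<mu>"
  let ?C = "{z :: ('k \<Rightarrow>\<^sub>L 'k) \<times> ('k \<Rightarrow>\<^sub>L 'k) \<times> ('k \<Rightarrow>\<^sub>L 'k). selfadjoint (fst z)}"
  have closed: "closed ?C"
    unfolding closed_sequential_limits
    by (intro allI impI, elim conjE, simp only: mem_Collect_eq)
      (rule selfadjoint_limit[OF tendsto_fst], blast+)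
  have "(Z S, Z S, Z S) \<in> closure ?C"
  proof (rule has_integral_bochner_in_closure[OF _ Z_integral[OF S] Z_integral[OF S] Z_integral[OF S]])
    show "convex_cone_set ?C"
      by (simp add: convex_cone_set_def selfadjoint_add selfadjoint_scaleR)
    show "(indicat_real S t *\<^sub>R \<Phi> t (A t), indicat_real S t *\<^sub>R \<Phi> t (A t), indicat_real S t *\<^sub>R \<Phi> t (A t)) \<in> ?C"
      if "t \<in> space \<mu>" for t
      using that by (simp add: space_\<mu> selfadjoint_scaleR \<Phi>A_selfadjoint)
  qed
  then show ?thesis using closed by simp
qed

end

theorem theorem3p1:
  fixes T1 T2 T :: "'t topology"
    and \<mu> :: "'t measure"
    and \<AA> :: "('h::chilbert \<Rightarrow>\<^sub>L 'h) set"
    and \<BB> :: "('k::chilbert \<Rightarrow>\<^sub>L 'k) set"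
    and f :: "real \<Rightarrow> real" and J :: "real set"
    and A :: "'t \<Rightarrow> ('h \<Rightarrow>\<^sub>L 'h)"
    and \<Phi> :: "'t \<Rightarrow> ('h \<Rightarrow>\<^sub>L 'h) \<Rightarrow> ('k \<Rightarrow>\<^sub>L 'k)"
    and D1 D2 Z Z1 Z2 :: "'k \<Rightarrow>\<^sub>L 'k"
  assumes T1: "locally_compact_space T1" "Hausdorff_space T1"
    and T2: "locally_compact_space T2" "Hausdorff_space T2"
    and disjoint: "topspace T1 \<inter> topspace T2 = {}"
    and T_def: "T = disjoint_union_topology T1 T2"
    and radon: "bounded_radon_measure T \<mu>"
    and algebras: "unital_cstar_algebra \<AA>" "unital_cstar_algebra \<BB>"
    and interval: "is_interval J"
    and universe: "infinite_dimensional TYPE('u::chilbert)"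
    and convex: "operator_convex_on TYPE('u) J f"
    and A_field: "continuous_field T \<AA> A"
    and A_selfadjoint: "\<And>t. t \<in> topspace T \<Longrightarrow> selfadjoint (A t)"
    and A_spectrum: "\<And>t. t \<in> topspace T \<Longrightarrow> spectrum_in id_blinfun (A t) J"
    and \<Phi>_field: "positive_map_field T \<AA> \<BB> \<Phi>"
    and \<Phi>_unital: "unital_field \<mu> \<Phi>"
    and D1_def: "D1 = bochner_int \<mu> (topspace T1) (\<lambda>t. \<Phi> t id_blinfun)"
    and D2_def: "D2 = bochner_int \<mu> (topspace T2) (\<lambda>t. \<Phi> t id_blinfun)"
    and Z_def: "Z = bochner_int \<mu> (topspace T) (\<lambda>t. \<Phi> t (A t))"
    and Z1_def: "Z1 = bochner_int \<mu> (topspace T1) (\<lambda>t. \<Phi> t (A t))"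
    and Z2_def: "Z2 = bochner_int \<mu> (topspace T2) (\<lambda>t. \<Phi> t (A t))"
    and D_invertible: "invertible_op D1" "invertible_op D2"
    and \<Phi>_invertible: "\<And>t. t \<in> topspace T \<Longrightarrow> invertible_op (\<Phi> t id_blinfun)"
    and integrable:
      "bochner_integrable \<mu> (\<lambda>t. \<Phi> t (A t))"
      "bochner_integrable \<mu> (\<lambda>t. op_perspective f (\<Phi> t id_blinfun) (\<Phi> t (A t)))"
      "bochner_integrable \<mu> (\<lambda>t. \<Phi> t (cfc f (A t)))"
  shows
    "(cfc f Z \<preceq> op_perspective f D1 Z1 + op_perspective f D2 Z2 \<and>
      op_perspective f D1 Z1 + op_perspective f D2 Z2
        \<preceq> bochner_int \<mu> (topspace T) (\<lambda>t. op_perspective f (\<Phi> t id_blinfun) (\<Phi> t (A t))) \<and>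
      bochner_int \<mu> (topspace T) (\<lambda>t. op_perspective f (\<Phi> t id_blinfun) (\<Phi> t (A t)))
        \<preceq> bochner_int \<mu> (topspace T) (\<lambda>t. \<Phi> t (cfc f (A t)))) \<and>
     (bochner_int \<mu> (topspace T1) (\<lambda>t. \<Phi> t (cfc f (A t))) - op_perspective f D1 Z1
        \<preceq> bochner_int \<mu> (topspace T) (\<lambda>t. \<Phi> t (cfc f (A t))) - cfc f Z \<and>
      0 \<preceq> bochner_int \<mu> (topspace T1) (\<lambda>t. \<Phi> t (cfc f (A t))) - op_perspective f D1 Z1)"
proof (cases "(id_blinfun :: 'k \<Rightarrow>\<^sub>L 'k) = 0")
  case True
  then show ?thesis by (simp add: op_le_trivial)
next
  case False
  interpret F: jensen_field T \<mu> \<AA> \<BB> J A \<Phi>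
    by unfold_locales (use assms False in auto)
  have cont: "continuous_on J f" using convex by (simp add: operator_convex_on_def)
  let ?S1 = "topspace T1" and ?S2 = "topspace T2"
  let ?G = "\<lambda>t. op_perspective f (\<Phi> t id_blinfun) (\<Phi> t (A t))"
  let ?H = "\<lambda>t. \<Phi> t (cfc f (A t))"
  have T: "topspace T = ?S1 \<union> ?S2" by (simp add: T_def)
  have S1: "?S1 \<in> sets \<mu>"
    \<comment> \<open>Each summand is open in the topological sum, hence measurable.\<close>
    using disjoint by (intro F.openin_sets) (simp add: T_def openin_disjoint_union_topology Int_commute)
  have S2: "?S2 \<in> sets \<mu>"
    using disjoint by (intro F.openin_sets) (simp add: T_def openin_disjoint_union_topology Int_commute)
  have ST: "topspace T \<in> sets \<mu>" by (rule F.openin_sets) simp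
  have D: "D1 = F.D ?S1" "D2 = F.D ?S2" "Z1 = F.Z ?S1" "Z2 = F.Z ?S2" "Z = F.Z (topspace T)"
    by (simp_all add: D1_def D2_def Z1_def Z2_def Z_def F.D_def F.Z_def)

  obtain a1 b1 where ab1: "a1 \<in> J" "b1 \<in> J" "a1 \<le> b1"
    "\<And>x. a1 * qform D1 x \<le> qform Z1 x" "\<And>x. qform Z1 x \<le> b1 * qform D1 x"
    using F.Z_bounds[OF S1] D_invertible(1) unfolding D by blast
  obtain a2 b2 where ab2: "a2 \<in> J" "b2 \<in> J" "a2 \<le> b2"
    "\<And>x. a2 * qform D2 x \<le> qform Z2 x" "\<And>x. qform Z2 x \<le> b2 * qform D2 x"
    using F.Z_bounds[OF S2] D_invertible(2) unfolding D by blast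
  have J: "J \<noteq> {}" using ab1(1) by auto
  have D1: "positive_op D1" and D2: "positive_op D2"
    using F.D_positive[OF S1] F.D_positive[OF S2] by (simp_all only: D)
  have Z1: "selfadjoint Z1" and Z2: "selfadjoint Z2"
    using F.Z_selfadjoint[OF S1] F.Z_selfadjoint[OF S2] by (simp_all only: D)

  have split: "indicat_real (topspace T) t *\<^sub>R g t = indicat_real ?S1 t *\<^sub>R g t + indicat_real ?S2 t *\<^sub>R g t"
    for t and g :: "'t \<Rightarrow> 'k \<Rightarrow>\<^sub>L 'k"
    using disjoint by (auto simp: T indicator_def)
  have split_int: "bochner_int \<mu> (topspace T) g = bochner_int \<mu> ?S1 g + bochner_int \<mu> ?S2 g"
    if "bochner_integrable \<mu> g" for g :: "'t \<Rightarrow> 'k \<Rightarrow>\<^sub>L 'k"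
    by (rule has_integral_bochner_add_eq[OF bochner_integrable_restrict[OF that S1]
          bochner_integrable_restrict[OF that S2] bochner_integrable_restrict[OF that ST]])
      (rule split)
  have Z_sum: "Z = Z1 + Z2"
    unfolding Z_def Z1_def Z2_def by (rule split_int[OF integrable(1)])
  have D_sum: "D1 + D2 = id_blinfun"
  proof (rule has_integral_bochner_add_eq[symmetric])
    show "has_integral_bochner \<mu> (\<lambda>t. indicat_real ?S1 t *\<^sub>R \<Phi> t id_blinfun) D1"
      unfolding D by (rule F.D_integral[OF S1])
    show "has_integral_bochner \<mu> (\<lambda>t. indicat_real ?S2 t *\<^sub>R \<Phi> t id_blinfun) D2"
      unfolding D by (rule F.D_integral[OF S2])
    show "has_integral_bochner \<mu> (\<lambda>t. \<Phi> t id_blinfun) id_blinfun"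
      using \<Phi>_unital by (simp add: unital_field_def)
    show "\<Phi> t id_blinfun = indicat_real ?S1 t *\<^sub>R \<Phi> t id_blinfun + indicat_real ?S2 t *\<^sub>R \<Phi> t id_blinfun"
      if "t \<in> space \<mu>" for t
      using split[of t "\<lambda>t. \<Phi> t id_blinfun"] that by (simp add: F.space_\<mu>)
  qed

  \<comment> \<open>Stated for a general integrand with values in the cone, because both the
    pointwise perspectives and the fields \<open>\<Phi> t (cfc f (A t))\<close> qualify.\<close>
  have persp_le: "op_perspective f D1 Z1 \<preceq> bochner_int \<mu> ?S1 g" "op_perspective f D2 Z2 \<preceq> bochner_int \<mu> ?S2 g"
    if g: "bochner_integrable \<mu> g"
      and cone: "\<And>t. t \<in> topspace T \<Longrightarrow> (\<Phi> t id_blinfun, \<Phi> t (A t), g t) \<in> jensen_cone J f" for g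
    using perspective_le[OF universe convex interval F.integral_in_closure[OF S1 J g cone, folded D]
        D1 D_invertible(1) ab1(1,2,4,5)]
      perspective_le[OF universe convex interval F.integral_in_closure[OF S2 J g cone, folded D]
        D2 D_invertible(2) ab2(1,2,4,5)]
    by blast+
  note persp_G = persp_le[OF integrable(2) F.\<Phi>_perspective_in_cone]
  note persp_H = persp_le[OF integrable(3) F.\<Phi>_cfc_in_cone[OF _ cont]]

  have first: "cfc f Z \<preceq> op_perspective f D1 Z1 + op_perspective f D2 Z2"
  proof -
    have "(D1 + D2, Z1 + Z2, op_perspective f D1 Z1 + op_perspective f D2 Z2) \<in> jensen_cone J f"
      by (intro jensen_cone_add perspective_in_cone[OF D1 D_invertible(1) Z1 ab1]
          perspective_in_cone[OF D2 D_invertible(2) Z2 ab2])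
    then have C: "(id_blinfun, Z, op_perspective f D1 Z1 + op_perspective f D2 Z2) \<in> closure (jensen_cone J f)"
      unfolding D_sum Z_sum using closure_subset by blast
    have "form_in id_blinfun (min a1 a2) (max b1 b2) Z"
      unfolding form_in_def
    proof
      fix x
      have q: "qform id_blinfun x = qform D1 x + qform D2 x" "qform Z x = qform Z1 x + qform Z2 x"
        by (simp_all only: D_sum[symmetric] Z_sum qform_add)
      have "min a1 a2 * qform D1 x \<le> a1 * qform D1 x" "min a1 a2 * qform D2 x \<le> a2 * qform D2 x"
        "b1 * qform D1 x \<le> max b1 b2 * qform D1 x" "b2 * qform D2 x \<le> max b1 b2 * qform D2 x"
        by (intro mult_right_mono positive_op_qform D1 D2; simp)+
      then show "min a1 a2 * qform id_blinfun x \<le> qform Z x \<and> qform Z x \<le> max b1 b2 * qform id_blinfun x"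
        using ab1(4,5)[of x] ab2(4,5)[of x] unfolding q distrib_left by linarith
    qed
    moreover have "min a1 a2 \<in> J" "max b1 b2 \<in> J" using ab1 ab2 by (auto simp: min_def max_def)
    ultimately show ?thesis by (intro jensen_closure[OF universe convex interval C])
  qed
  have second: "op_perspective f D1 Z1 + op_perspective f D2 Z2 \<preceq> bochner_int \<mu> (topspace T) ?G"
    unfolding split_int[OF integrable(2)] by (rule op_le_add[OF persp_G])
  have pointwise: "?G t \<preceq> ?H t" if t: "t \<in> topspace T" for t
  proof -
    obtain a b where ab: "a \<in> J" "b \<in> J" "a \<le> b" "form_in id_blinfun a b (A t)"
      using F.A_bounds[OF t] .
    show ?thesis
      by (rule perspective_le[OF universe convex interval subsetD[OF closure_subset F.\<Phi>_cfc_in_cone[OF t cont]]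
            F.\<Phi>_id_positive[OF t] \<Phi>_invertible[OF t] ab(1,2) F.\<Phi>A_bounds[OF t ab(4)]])
  qed
  have third: "bochner_int \<mu> (topspace T) ?G \<preceq> bochner_int \<mu> (topspace T) ?H"
    using has_integral_bochner_positive[OF bochner_integrable_restrict[OF integrable(3) ST]
        bochner_integrable_restrict[OF integrable(2) ST] bochner_integrable_restrict[OF integrable(2) ST],
        of 1 "-1" 0] pointwise
    by (simp add: op_le_def F.space_\<mu>)
  have fourth: "bochner_int \<mu> ?S1 ?H - op_perspective f D1 Z1 \<preceq> bochner_int \<mu> (topspace T) ?H - cfc f Z"
  proof -
    \<comment> \<open>Subtracting the \<open>T1\<close> part leaves the nonnegative defect on
      \<open>T2\<close> plus the defect of the first inequality.\<close>
    have "bochner_int \<mu> (topspace T) ?H - cfc f Z - (bochner_int \<mu> ?S1 ?H - op_perspective f D1 Z1)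
        = (bochner_int \<mu> ?S2 ?H - op_perspective f D2 Z2)
          + (op_perspective f D1 Z1 + op_perspective f D2 Z2 - cfc f Z)"
      by (simp add: split_int[OF integrable(3)])
    then show ?thesis
      using positive_op_add persp_H(2) first unfolding op_le_def by metis
  qed
  have fifth: "0 \<preceq> bochner_int \<mu> ?S1 ?H - op_perspective f D1 Z1"
    using persp_H(1) by (simp add: op_le_def)
  show ?thesis using first second third fourth fifth by blast
qed

end
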